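(* Fix $\alpha,\beta>0$ and let $(\Omega,\mathfrak S,\mathbb P)$ be the probability space of the i.i.d. Beta$(\alpha,\beta)$ environment $\omega$ on $\mathbb Z^2$ described in the context. On $(\Omega,\mathfrak S,\mathbb P)$ there exists a real-valued stochastic process $\{B^\xi_{x,y}(\omega):x,y\in\mathbb Z^2,\ \xi\in\mathrm{ri}\,\mathcal U\}$ with the following properties. (1) For each $\xi\in\mathrm{ri}\,\mathcal U$, $x\mapsto e^{-B^\xi_{0,x}}$ is a harmonic function: for all $x\in\mathbb Z^2$, $$\omega_{x,x+e_1}e^{-B^\xi_{0,x+e_1}(\omega)}+\omega_{x,x+e_2}e^{-B^\xi_{0,x+e_2}(\omega)}=e^{-B^\xi_{0,x}(\omega)}\qquad\mathbb P\text{-a.s.}$$ (2) For each $\xi\in\mathrm{ri}\,\mathcal U$ there is an event $\Omega^{(\xi)}$ with $\mathbb P(\Omega^{(\xi)})=1$ such that for every $\omega\in\Omega^{(\xi)}$, $$B^\xi_{x,y}(\omega)=\lim_{N\to\infty}\Big(\log P^\omega_x\{X_{|z_N-x|_1}=z_N\}-\log P^\omega_y\{X_{|z_N-y|_1}=z_N\}\Big)$$ for all $x,y\in\mathbb Z^2$ and for any sequence $z_N\in\mathbb Z^2$ such that $|z_N|_1\to\infty$ and $z_N/|z_N|_1\to\xi$. (3) In the law of large numbers direction $\xi^*=(\frac{\alpha}{\alpha+\beta},\frac{\beta}{\alpha+\beta})$ we have $B^{\xi^*}_{x,y}(\omega)=0$.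
   Context: Let $e_1=(1,0)$, $e_2=(0,1)$, $|x|_1=|x_1|+|x_2|$. Fix $\alpha,\beta>0$. The environment space is $\Omega=[0,1]^{\mathbb Z^2}$ with Borel $\sigma$-field $\mathfrak S$; under $\mathbb P$ the coordinates $\omega_{x,x+e_1}$, $x\in\mathbb Z^2$, are i.i.d. Beta$(\alpha,\beta)$ random variables, and $\omega_{x,x+e_2}=1-\omega_{x,x+e_1}$. Given $\omega$ and $x\in\mathbb Z^2$, $P^\omega_x$ is the law of the Markov chain $(X_n)_{n\ge0}$ on $\mathbb Z^2$ with $X_0=x$ and transition probabilities $P^\omega_x(X_{n+1}=y+e_i\mid X_n=y)=\omega_{y,y+e_i}$, $i\in\{1,2\}$. Let $\mathrm{ri}\,\mathcal U=\{te_1+(1-t)e_2:0<t<1\}$. *)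

theory Defs
  imports "HOL-Probability.Probability"
begin

type_synonym site = "int \<times> int"

abbreviation e\<^sub>1 :: site where "e\<^sub>1 \<equiv> (1, 0)"
abbreviation e\<^sub>2 :: site where "e\<^sub>2 \<equiv> (0, 1)"

definition l1norm :: "site \<Rightarrow> nat" where
  "l1norm x = nat (\<bar>fst x\<bar> + \<bar>snd x\<bar>)"

definition site_vec :: "site \<Rightarrow> real \<times> real" where
  "site_vec x = (real_of_int (fst x), real_of_int (snd x))"

definition riU :: "(real \<times> real) set" where
  "riU = {t *\<^sub>R site_vec e\<^sub>1 + (1 - t) *\<^sub>R site_vec e\<^sub>2 | t. 0 < t \<and> t < 1}"

definition beta_law :: "real \<Rightarrow> real \<Rightarrow> real measure" where
  "beta_law \<alpha> \<beta> = density (restrict_space lborel {0..1})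
     (\<lambda>t. ennreal (t powr (\<alpha> - 1) * (1 - t) powr (\<beta> - 1) / Beta \<alpha> \<beta>))"

text \<open>
  Since the two weights out of a site sum to one, an environment is recorded by its horizontal weights: \<open>\<omega> x\<close> is the weight of the edge
  from \<open>x\<close> to \<open>x + e\<^sub>1\<close>.  The full family of edge weights is recovered by \<open>weight\<close>.
\<close>

type_synonym env = "site \<Rightarrow> real"

definition beta_env :: "real \<Rightarrow> real \<Rightarrow> env measure" where
  "beta_env \<alpha> \<beta> = (\<Pi>\<^sub>M x\<in>UNIV. beta_law \<alpha> \<beta>)"

definition weight :: "env \<Rightarrow> site \<Rightarrow> site \<Rightarrow> real" where
  "weight \<omega> x y = (if y = x + e\<^sub>1 then \<omega> x else if y = x + e\<^sub>2 then 1 - \<omega> x else 0)"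

definition walk_step :: "env \<Rightarrow> site \<Rightarrow> site pmf" where
  "walk_step \<omega> x = map_pmf (\<lambda>b. x + (if b then e\<^sub>1 else e\<^sub>2)) (bernoulli_pmf (\<omega> x))"

definition walk_kernel :: "env \<Rightarrow> site \<Rightarrow> nat \<Rightarrow> (nat \<Rightarrow> site) \<Rightarrow> site measure" where
  "walk_kernel \<omega> x n h = measure_pmf (case n of 0 \<Rightarrow> return_pmf x | Suc m \<Rightarrow> walk_step \<omega> (h m))"

text \<open>
  The law on path space \<open>nat \<Rightarrow> site\<close> of the Markov chain started at \<open>x\<close>, as the Ionescu Tulcea
  extension of the kernels above.  \<open>bernoulli_pmf\<close> clamps its parameter to \<open>[0,1]\<close>, which never
  matters on the environment space; the lemma \<open>quenched_path\<close> below gives the path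
  probabilities that characterise this law.
\<close>

definition quenched :: "env \<Rightarrow> site \<Rightarrow> (nat \<Rightarrow> site) measure" where
  "quenched \<omega> x = projective_family.lim UNIV
     (Ionescu_Tulcea.CI (walk_kernel \<omega> x) (\<lambda>_. count_space UNIV)) (\<lambda>_. count_space UNIV)"

lemma sets_beta_law [measurable_cong]:
  "sets (beta_law \<alpha> \<beta>) = sets (restrict_space borel {0..1})"
  by (simp add: beta_law_def sets_restrict_space)

lemma space_beta_env: "space (beta_env \<alpha> \<beta>) = {\<omega>. \<forall>x. 0 \<le> \<omega> x \<and> \<omega> x \<le> 1}"
  by (auto simp: beta_env_def space_PiM beta_law_def PiE_iff space_restrict_space)

lemma prob_space_beta_law:
  assumes "\<alpha> > 0" "\<beta> > 0"
  shows "prob_space (beta_law \<alpha> \<beta>)"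
proof
  have B: "Beta \<alpha> \<beta> > 0"
    using assms by (simp add: Beta_def Gamma_real_pos)
  let ?f = "\<lambda>t. t powr (\<alpha> - 1) * (1 - t) powr (\<beta> - 1)"
  have I: "((\<lambda>t. ?f t / Beta \<alpha> \<beta>) has_integral 1) {0..1}"
    using has_integral_divide[OF has_integral_Beta_real[OF assms], of "Beta \<alpha> \<beta>"] B by simp
  have [measurable]: "?f \<in> borel_measurable borel" by measurable
  have "emeasure (beta_law \<alpha> \<beta>) (space (beta_law \<alpha> \<beta>))
      = (\<integral>\<^sup>+t. ennreal (?f t / Beta \<alpha> \<beta>) * indicator {0..1} t \<partial>restrict_space lborel {0..1})"
    unfolding beta_law_def
    by (subst emeasure_density)
       (auto simp: space_restrict_space sets_restrict_space_iff intro!: measurable_restrict_space1)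
  also have "\<dots> = (\<integral>\<^sup>+t. ennreal (?f t / Beta \<alpha> \<beta> * indicator {0..1} t) \<partial>lborel)"
    by (subst nn_integral_restrict_space)
       (auto intro!: nn_integral_cong split: split_indicator)
  also have "\<dots> = ennreal 1"
  proof (rule nn_integral_has_integral_lborel)
    show "((\<lambda>t. ?f t / Beta \<alpha> \<beta> * indicator {0..1} t) has_integral 1) UNIV"
    proof -
      have "(\<lambda>t. ?f t / Beta \<alpha> \<beta> * indicator {0..1} t)
          = (\<lambda>t. if t \<in> {0..1} then ?f t / Beta \<alpha> \<beta> else 0)"
        by (auto simp: fun_eq_iff)
      then show ?thesis
        using I by (simp only: has_integral_restrict_UNIV)
    qed
  qed (use B in auto)
  finally show "emeasure (beta_law \<alpha> \<beta>) (space (beta_law \<alpha> \<beta>)) = 1" by simp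
qed

lemma prob_space_beta_env:
  assumes "\<alpha> > 0" "\<beta> > 0"
  shows "prob_space (beta_env \<alpha> \<beta>)"
  unfolding beta_env_def using prob_space_beta_law[OF assms] by (rule prob_space_PiM)

lemma pmf_walk_step:
  assumes "0 \<le> \<omega> x" "\<omega> x \<le> 1"
  shows "pmf (walk_step \<omega> x) y = weight \<omega> x y"
proof -
  have "pmf (walk_step \<omega> x) y
      = measure_pmf.prob (bernoulli_pmf (\<omega> x)) ((\<lambda>b. x + (if b then e\<^sub>1 else e\<^sub>2)) -` {y})"
    by (simp add: walk_step_def pmf_map)
  also have "(\<lambda>b. x + (if b then e\<^sub>1 else e\<^sub>2)) -` {y}
      = (if y = x + e\<^sub>1 then {True} else if y = x + e\<^sub>2 then {False} else {})"
    by (auto split: if_splits)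
  finally show ?thesis
    using assms by (simp add: weight_def measure_pmf_single)
qed

lemma Ionescu_Tulcea_walk: "Ionescu_Tulcea (walk_kernel \<omega> x) (\<lambda>_. count_space UNIV)"
proof (rule Ionescu_Tulcea.intro)
  fix i
  show "walk_kernel \<omega> x i \<in> PiM {0..<i} (\<lambda>_. count_space UNIV) \<rightarrow>\<^sub>M subprob_algebra (count_space UNIV)"
  proof (cases i)
    case (Suc m)
    have "(\<lambda>h. measure_pmf (walk_step \<omega> (h m)))
        \<in> PiM {0..<i} (\<lambda>_. count_space UNIV) \<rightarrow>\<^sub>M subprob_algebra (count_space UNIV)"
      by (rule measurable_compose[OF _ measurable_measure_pmf]) (simp add: Suc)
    then show ?thesis by (simp add: walk_kernel_def[abs_def] Suc)
  next
    case 0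
    then show ?thesis
      by (simp add: walk_kernel_def[abs_def] measure_pmf_in_subprob_algebra)
  qed
next
  show "prob_space (walk_kernel \<omega> x i h)" for i h
    unfolding walk_kernel_def by (rule measure_pmf.prob_space_axioms)
qed

lemma prob_space_quenched: "prob_space (quenched \<omega> x)"
proof -
  interpret Ionescu_Tulcea "walk_kernel \<omega> x" "\<lambda>_. count_space UNIV" by (rule Ionescu_Tulcea_walk)
  have "prob_space (distr PF.lim (PiM {} (\<lambda>_. count_space UNIV)) (\<lambda>h. restrict h {}))"
    by (simp only: distr_lim finite.emptyI PF.prob_space_P empty_subsetI)
  then show ?thesis
    unfolding quenched_def
    by (rule prob_space_distrD[rotated]) (rule measurable_restrict, simp add: PF.sets_lim cong: measurable_cong_sets)
qed

lemma sets_quenched [measurable_cong]: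
  "sets (quenched \<omega> x) = sets (\<Pi>\<^sub>M n\<in>UNIV. count_space UNIV)"
proof -
  interpret Ionescu_Tulcea "walk_kernel \<omega> x" "\<lambda>_. count_space UNIV" by (rule Ionescu_Tulcea_walk)
  show ?thesis unfolding quenched_def by (rule PF.sets_lim)
qed

lemma quenched_path:
  assumes "\<And>y. 0 \<le> \<omega> y \<and> \<omega> y \<le> 1"
  shows "measure (quenched \<omega> x) {X \<in> space (quenched \<omega> x). \<forall>i\<le>n. X i = p i}
       = (if p 0 = x then \<Prod>i<n. weight \<omega> (p i) (p (Suc i)) else 0)"
proof -
  interpret Ionescu_Tulcea "walk_kernel \<omega> x" "\<lambda>_. count_space UNIV" by (rule Ionescu_Tulcea_walk)
  let ?M = "\<lambda>_::nat. count_space (UNIV :: site set)"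
  define A where "A n = (\<Pi>\<^sub>E i\<in>{0..<n}. {p i})" for n
  have A[measurable]: "A n \<in> sets (PiM {0..<n} ?M)" for n
    unfolding A_def by (rule sets_PiM_I_finite) auto
  have A_Suc: "fun_upd h n y \<in> A (Suc n) \<longleftrightarrow> h \<in> A n \<and> y = p n"
    if "h \<in> space (PiM {0..<n} ?M)" for h n y
    using that by (auto simp: A_def space_PiM PiE_iff extensional_def less_Suc_eq)
  have w: "0 \<le> weight \<omega> y z" for y z
    using assms[of y] by (simp add: weight_def)
  have ind: "emeasure (C 0 (Suc n) (\<lambda>_. undefined)) (A (Suc n))
      = ennreal (if p 0 = x then \<Prod>i<n. weight \<omega> (p i) (p (Suc i)) else 0)" for n
  proof -
    have u: "(\<lambda>_. undefined) \<in> space (PiM {0..<0} ?M)"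
      by (simp add: space_PiM)
    have eP: "emeasure (eP n h) (A (Suc n))
        = emeasure (walk_kernel \<omega> x n p) {p n} * indicator (A n) h"
      if h: "h \<in> space (PiM {0..<n} ?M)" for h n
    proof -
      have "(\<lambda>y. fun_upd h n y) -` A (Suc n) \<inter> space (?M n) = (if h \<in> A n then {p n} else {})"
        using A_Suc[OF h] by auto
      moreover have "walk_kernel \<omega> x n h = walk_kernel \<omega> x n p" if "h \<in> A n"
        using that by (auto simp: walk_kernel_def A_def PiE_iff split: nat.split)
      ultimately show ?thesis
        by (simp add: emeasure_eP[OF h A])
    qed
    have step: "emeasure (C 0 (Suc n) (\<lambda>_. undefined)) (A (Suc n))
        = emeasure (walk_kernel \<omega> x n p) {p n} * emeasure (C 0 n (\<lambda>_. undefined)) (A n)" for n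
    proof -
      have "emeasure (C 0 (Suc n) (\<lambda>_. undefined)) (A (Suc n))
          = (\<integral>\<^sup>+h. emeasure (eP n h) (A (Suc n)) \<partial>C 0 n (\<lambda>_. undefined))"
        using measurable_eP[of n] space_C[OF u, of n] sets_C[OF u, of n]
        by (simp add: emeasure_bind[OF _ _ A] cong: measurable_cong_sets)
      also have "\<dots> = (\<integral>\<^sup>+h. emeasure (walk_kernel \<omega> x n p) {p n} * indicator (A n) h
          \<partial>C 0 n (\<lambda>_. undefined))"
        using space_C[OF u, of n] by (intro nn_integral_cong eP) auto
      finally show ?thesis
        using sets_C[OF u, of n] by (simp add: nn_integral_cmult_indicator)
    qed
    show ?thesis
    proof (induction n)
      case 0
      have "emeasure (C 0 0 (\<lambda>_. undefined)) (A 0) = 1"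
        unfolding C.simps
        by (subst emeasure_return[OF A]) (simp add: A_def)
      then show ?case
        unfolding step[of 0] by (simp add: walk_kernel_def emeasure_pmf_single)
    next
      case (Suc n)
      have "emeasure (walk_kernel \<omega> x (Suc n) p) {p (Suc n)} = ennreal (weight \<omega> (p n) (p (Suc n)))"
        using assms[of "p n"] by (simp add: walk_kernel_def emeasure_pmf_single pmf_walk_step)
      then have "emeasure (C 0 (Suc (Suc n)) (\<lambda>_. undefined)) (A (Suc (Suc n)))
          = ennreal (weight \<omega> (p n) (p (Suc n)))
            * ennreal (if p 0 = x then \<Prod>i<n. weight \<omega> (p i) (p (Suc i)) else 0)"
        by (simp only: step[of "Suc n"] Suc.IH)
      then show ?case
        by (simp only: ennreal_mult'[OF w, symmetric]) (simp add: mult.commute)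
    qed
  qed
  have "{X \<in> space (quenched \<omega> x). \<forall>i\<le>n. X i = p i} = PF.emb UNIV {0..<Suc n} (A (Suc n))"
    by (auto simp: quenched_def A_def prod_emb_def space_PiM PiE_iff less_Suc_eq_le)
  then have "emeasure (quenched \<omega> x) {X \<in> space (quenched \<omega> x). \<forall>i\<le>n. X i = p i}
      = emeasure (CI {0..<Suc n}) (A (Suc n))"
    using lim[OF _ A, of "Suc n"] by (simp add: quenched_def)
  also have "\<dots> = emeasure (C 0 (Suc n) (\<lambda>_. undefined)) (A (Suc n))"
    by (subst emeasure_CI[OF subset_refl A]) (simp add: prod_emb_id A_def)
  finally show ?thesis
    unfolding ind by (simp only: measure_def) (simp add: w prod_nonneg)
qed

end

theory Submission
  imports Defs "HOL-Real_Asymp.Real_Asymp"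
begin

text \<open>
  For every \<open>l > 0\<close> there is an explicit positive harmonic function on the quadrant whose horizontal ratios
  \<open>H x / H (x + e\<^sub>1)\<close> along a row are i.i.d. Beta\<open>(l + \<alpha>, \<beta>)\<close> and whose vertical ratios \<open>H (x + e\<^sub>2) / H x\<close> along a
  column are i.i.d. Beta\<open>(l, \<alpha>)\<close>.  It is built from the axes outwards, with auxiliary i.i.d. weights in the cells, by a
  map that preserves the product of the three beta laws and outputs the environment (a Burke property).  Hence \<open>ln H\<close> grows at
  an explicit linear rate, almost surely.

  To compare \<open>H\<close> with the probability \<open>h\<close> of hitting a far point \<open>z\<close>, split \<open>H\<close> according to the side of the
  rectangle below \<open>z\<close> through which the walk leaves.  By planarity each part has horizontal ratios that lie on
  one definite side of those of \<open>h\<close>.  One of the two parts is exponentially small: bound \<open>h\<close> by means of the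
  harmonic function with another parameter and use that the growth rate in direction \<open>\<xi>\<close> is a strictly unimodal function
  of \<open>l\<close>.  So the ratios of \<open>h\<close> are squeezed between random variables of known mean with parameters above
  and below the critical one, and converge almost surely.  In the direction \<open>\<xi>\<^sup>*\<close> every \<open>l\<close> lies on
  the same side; \<open>l \<rightarrow> \<infinity>\<close> and the reflected environment give the limit 1.
\<close>

subsection \<open>Polygamma functions and growth rates\<close>

text \<open>Harmonic functions with different \<open>l\<close> live on different probability spaces
  and are never coupled; only the law of the environment is common to them. The bounds are therefore
  pushed to functionals of the environment alone, the lower and upper limits of the horizontal
  ratios, which are measurable before any convergence is known. With c the critical parameter, the
  inverse of the lower limit has mean at most (l + \<alpha>) / (l + \<alpha> + \<beta>) for l > c,
  and the inverse of the upper limit has mean at least this for l < c. Letting l tend to c from both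
  sides, two ordered random variables get the same mean, so they agree almost surely. A boundary
  term is a hitting probability times a value of the harmonic function with parameter l. The former
  is at most the reciprocal of the normalised harmonic function with parameter c, so only the
  difference of the two rates enters. A critical parameter is found for s \<beta> > (1 - s)
  \<alpha>. The opposite inequality is reduced to this one by exchanging the axes, which exchanges
  \<alpha> and \<beta>.\<close>

lemma pos_notin_nonpos_Ints [simp]: "(x::real) > 0 \<Longrightarrow> x \<notin> \<int>\<^sub>\<le>\<^sub>0"
  by (auto elim!: nonpos_Ints_cases)

text \<open>With p, q, r the sums over k of (x + k) to the powers -3, -4, -5, Cauchy-Schwarz gives
  only q^2 <= p r. Strictness comes from the factorials: the two sides are 36 q^2 and 48 p
  r.\<close>

lemma Polygamma_log_convex:
  fixes x :: real
  assumes "x > 0"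
  shows "(Polygamma 3 x)\<^sup>2 < Polygamma 2 x * Polygamma 4 x"
proof -
  define a where "a k = inverse (x + real k)" for k
  have apos: "a k > 0" for k using assms by (simp add: a_def)
  have sums: "(\<lambda>k. a k ^ Suc n) sums ((-1) ^ Suc n * Polygamma n x / fact n)" if "n > 0" for n
    using Polygamma_LIMSEQ[of x n] assms that by (simp add: a_def power_inverse)
  have s3: "(\<lambda>k. a k ^ 3) sums (- Polygamma 2 x / 2)"
    using sums[of 2] by (simp add: fact_numeral eval_nat_numeral)
  have s4: "(\<lambda>k. a k ^ 4) sums (Polygamma 3 x / 6)"
    using sums[of 3] by (simp add: fact_numeral eval_nat_numeral)
  have s5: "(\<lambda>k. a k ^ 5) sums (- Polygamma 4 x / 24)"
    using sums[of 4] by (simp add: fact_numeral eval_nat_numeral)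
  define p q r where "p = - Polygamma 2 x / 2" and "q = Polygamma 3 x / 6" and "r = - Polygamma 4 x / 24"
  have r: "r > 0" using Polygamma_real_even_neg[of x 4] assms by (simp add: r_def)
  have q: "q > 0" using Polygamma_real_odd_pos[of x 3] assms by (simp add: q_def)
  \<comment> \<open>Cauchy-Schwarz by completing the square; \<open>q / r\<close> minimises the
    quadratic p - 2 c q + c^2 r in c.\<close>
  have "(\<lambda>k. a k ^ 3 - (2 * (q / r)) * a k ^ 4 + (q / r)\<^sup>2 * a k ^ 5)
      sums (p - (2 * (q / r)) * q + (q / r)\<^sup>2 * r)"
    unfolding p_def q_def r_def
    by (intro sums_add sums_diff sums_mult s3 s4 s5)
  moreover have "a k ^ 3 - (2 * (q / r)) * a k ^ 4 + (q / r)\<^sup>2 * a k ^ 5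
      = a k ^ 3 * (1 - q / r * a k)\<^sup>2" for k
    by (simp add: power2_eq_square algebra_simps eval_nat_numeral)
  ultimately have "(\<lambda>k. a k ^ 3 * (1 - q / r * a k)\<^sup>2) sums (p - (2 * (q / r)) * q + (q / r)\<^sup>2 * r)"
    by simp
  then have "0 \<le> p - (2 * (q / r)) * q + (q / r)\<^sup>2 * r"
    by (rule sums_le[OF _ sums_zero, rotated]) (simp add: apos less_imp_le)
  then have "q\<^sup>2 \<le> p * r"
    using r by (simp add: field_simps power2_eq_square)
  moreover have "0 < q\<^sup>2" using q by simp
  ultimately have "36 * q\<^sup>2 < 48 * (p * r)" by linarith
  then show ?thesis
    by (simp add: p_def q_def r_def power2_eq_square)
qed

text \<open>The quotient is the logarithmic derivative of \<open>- Polygamma 2\<close>, so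
  log-convexity makes it increase.\<close>

lemma Polygamma_quotient_strict_mono:
  fixes x y :: real
  assumes "0 < x" "x < y"
  shows "Polygamma 3 x / Polygamma 2 x < Polygamma 3 y / Polygamma 2 y"
proof (rule DERIV_pos_imp_increasing[OF \<open>x < y\<close>])
  fix z assume "x \<le> z" "z \<le> y"
  with assms have z: "z > 0" by simp
  have n: "Polygamma 2 z < 0" using Polygamma_real_even_neg[of z 2] z by simp
  have e: "Suc 3 = 4" "Suc 2 = 3" by simp_all
  have "((\<lambda>z. Polygamma 3 z / Polygamma 2 z) has_real_derivative
      (Polygamma 4 z * Polygamma 2 z - Polygamma 3 z * Polygamma 3 z) / (Polygamma 2 z * Polygamma 2 z)) (at z)"
    using has_field_derivative_Polygamma[of z 3 UNIV] has_field_derivative_Polygamma[of z 2 UNIV] n z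
    by (intro DERIV_divide) (simp_all add: e)
  moreover have "(Polygamma 4 z * Polygamma 2 z - Polygamma 3 z * Polygamma 3 z) / (Polygamma 2 z * Polygamma 2 z) > 0"
    using Polygamma_log_convex[OF z] n by (intro divide_pos_pos) (auto simp: power2_eq_square mult.commute mult_neg_neg)
  ultimately show "\<exists>l. DERIV (\<lambda>z. Polygamma 3 z / Polygamma 2 z) z :> l \<and> 0 < l" by blast
qed

text \<open>The series of 2 / (x + k)^3 is compared with a telescoping one, whose terms are the
  integrals of 2 / u^3 over unit intervals. The two bounds agree to leading order for large x, which
  identifies the limit of \<open>trigamma_ratio\<close> at infinity.\<close>

lemma Polygamma_2_bounds:
  fixes x :: real
  assumes "x > 0"
  shows "1 / x\<^sup>2 \<le> - Polygamma 2 x" and "- Polygamma 2 (x + 1) \<le> 1 / x\<^sup>2"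
proof -
  have sums: "(\<lambda>k. 2 * inverse (y + real k) ^ 3) sums (- Polygamma 2 y)" if "y > 0" for y :: real
    using sums_mult[OF Polygamma_LIMSEQ[of y 2], of 2] that
    by (simp add: fact_numeral eval_nat_numeral power_inverse)
  have lim: "(\<lambda>k. 1 / (x + real k)\<^sup>2) \<longlonglongrightarrow> 0" by real_asymp
  have tel: "(\<lambda>k. 1 / (x + real k)\<^sup>2 - 1 / (x + real (Suc k))\<^sup>2) sums (1 / x\<^sup>2)"
    using telescope_sums'[OF lim] by simp
  have D: "1 / u\<^sup>2 - 1 / (u + 1)\<^sup>2 \<le> 2 * inverse u ^ 3 \<and> 2 * inverse (u + 1) ^ 3 \<le> 1 / u\<^sup>2 - 1 / (u + 1)\<^sup>2"
    if "u > 0" for u :: real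
  proof -
    have "1 / u\<^sup>2 - 1 / (u + 1)\<^sup>2 = (2 * u + 1) / (u\<^sup>2 * (u + 1)\<^sup>2)"
      using that by (simp add: divide_simps power2_eq_square) (simp add: algebra_simps)
    moreover have "(2 * u + 1) / (u\<^sup>2 * (u + 1)\<^sup>2) \<le> 2 * inverse u ^ 3"
      using that by (simp add: divide_simps power2_eq_square power3_eq_cube) (simp add: algebra_simps)
    moreover have "2 * inverse (u + 1) ^ 3 \<le> (2 * u + 1) / (u\<^sup>2 * (u + 1)\<^sup>2)"
      using that by (simp add: divide_simps power2_eq_square power3_eq_cube) (simp add: algebra_simps)
    ultimately show ?thesis by simp
  qed
  show "1 / x\<^sup>2 \<le> - Polygamma 2 x"
  proof (rule sums_le[OF _ tel sums])
    show "1 / (x + real k)\<^sup>2 - 1 / (x + real (Suc k))\<^sup>2 \<le> 2 * inverse (x + real k) ^ 3" for k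
      using D[of "x + real k"] assms by (simp add: add_ac)
  qed fact
  show "- Polygamma 2 (x + 1) \<le> 1 / x\<^sup>2"
  proof (rule sums_le[OF _ sums tel])
    show "2 * inverse (x + 1 + real k) ^ 3 \<le> 1 / (x + real k)\<^sup>2 - 1 / (x + real (Suc k))\<^sup>2" for k
      using D[of "x + real k"] assms by (simp add: add_ac)
  qed (use assms in simp)
qed

text \<open>
  The exponential growth rate, in direction \<open>(s, t)\<close>, of the harmonic function with parameter \<open>l\<close>
  that is constructed below.
\<close>

definition rate :: "real \<Rightarrow> real \<Rightarrow> real \<Rightarrow> real \<Rightarrow> real \<Rightarrow> real" where
  "rate \<alpha> \<beta> l s t = t * (Digamma l - Digamma (l + \<alpha>)) - s * (Digamma (l + \<alpha>) - Digamma (l + \<alpha> + \<beta>))"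

definition rate' :: "real \<Rightarrow> real \<Rightarrow> real \<Rightarrow> real \<Rightarrow> real \<Rightarrow> real" where
  "rate' \<alpha> \<beta> l s t = t * (Polygamma 1 l - Polygamma 1 (l + \<alpha>))
     - s * (Polygamma 1 (l + \<alpha>) - Polygamma 1 (l + \<alpha> + \<beta>))"

context
  fixes \<alpha> \<beta> :: real
  assumes pos: "\<alpha> > 0" "\<beta> > 0"
begin

lemma rate_has_derivative:
  assumes "l > 0"
  shows "((\<lambda>l. rate \<alpha> \<beta> l s t) has_real_derivative rate' \<alpha> \<beta> l s t) (at l)"
  unfolding rate_def rate'_def using assms pos
  by (auto intro!: derivative_eq_intros)

text \<open>The derivative of \<open>rate\<close> in \<open>l\<close> has the sign of
  \<open>t * trigamma_ratio l - s\<close>, so a critical parameter for the direction (s, t) is a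
  solution of \<open>trigamma_ratio l = s / t\<close>.\<close>

definition trigamma_ratio :: "real \<Rightarrow> real" where
  "trigamma_ratio l = (Polygamma 1 l - Polygamma 1 (l + \<alpha>)) / (Polygamma 1 (l + \<alpha>) - Polygamma 1 (l + \<alpha> + \<beta>))"

lemma trigamma_diff_pos:
  assumes "l > 0"
  shows "Polygamma 1 l - Polygamma 1 (l + \<alpha>) > 0" "Polygamma 1 (l + \<alpha>) - Polygamma 1 (l + \<alpha> + \<beta>) > 0"
  using Polygamma_real_strict_antimono[of l "l + \<alpha>" 1]
    Polygamma_real_strict_antimono[of "l + \<alpha>" "l + \<alpha> + \<beta>" 1] assms pos by simp_all

text \<open>By the generalised mean value theorem the logarithmic derivatives of numerator and
  denominator are values of \<open>Polygamma 3 / Polygamma 2\<close> at points of two adjacent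
  intervals. That quotient increases, so the denominator has the larger one.\<close>

lemma trigamma_ratio_strict_antimono:
  assumes "0 < l" "l < m"
  shows "trigamma_ratio m < trigamma_ratio l"
proof (rule DERIV_neg_imp_decreasing[OF \<open>l < m\<close>])
  fix x assume "l \<le> x" "x \<le> m"
  with assms have x: "x > 0" by simp
  let ?D1 = "\<lambda>x. Polygamma 1 x - Polygamma 1 (x + \<alpha>)"
  let ?D2 = "\<lambda>x. Polygamma 1 (x + \<alpha>) - Polygamma 1 (x + \<alpha> + \<beta>)"
  let ?E1 = "\<lambda>x. Polygamma 2 x - Polygamma 2 (x + \<alpha>)"
  let ?E2 = "\<lambda>x. Polygamma 2 (x + \<alpha>) - Polygamma 2 (x + \<alpha> + \<beta>)"
  have e: "Suc 1 = 2" "Suc 2 = 3" by simp_all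
  have d1: "(?D1 has_real_derivative ?E1 x) (at x)" and d2: "(?D2 has_real_derivative ?E2 x) (at x)"
    using x pos unfolding e(1)[symmetric] by (auto intro!: derivative_eq_intros)
  note p = trigamma_diff_pos[OF x]
  have gmvt: "\<exists>z. u < z \<and> z < v \<and> (Polygamma 2 v - Polygamma 2 u) * Polygamma 2 z
      = (Polygamma 1 v - Polygamma 1 u) * Polygamma 3 z" if "0 < u" "u < v" for u v :: real
  proof (rule GMVT')
    show "isCont (Polygamma 2) z" "isCont (Polygamma 1) z" if "u \<le> z" for z
      using \<open>0 < u\<close> that by (auto intro!: continuous_intros)
    show "DERIV (Polygamma 1) z :> Polygamma 2 z" "DERIV (Polygamma 2) z :> Polygamma 3 z"
      if "u < z" for z
      using has_field_derivative_Polygamma[of z 1 UNIV] has_field_derivative_Polygamma[of z 2 UNIV]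
        \<open>0 < u\<close> that unfolding e by simp_all
  qed (use that in auto)
  obtain z1 where z1: "x < z1" "z1 < x + \<alpha>"
    "(Polygamma 2 (x + \<alpha>) - Polygamma 2 x) * Polygamma 2 z1 = (Polygamma 1 (x + \<alpha>) - Polygamma 1 x) * Polygamma 3 z1"
    using gmvt[of x "x + \<alpha>"] x pos by auto
  obtain z2 where z2: "x + \<alpha> < z2" "z2 < x + \<alpha> + \<beta>"
    "(Polygamma 2 (x + \<alpha> + \<beta>) - Polygamma 2 (x + \<alpha>)) * Polygamma 2 z2
      = (Polygamma 1 (x + \<alpha> + \<beta>) - Polygamma 1 (x + \<alpha>)) * Polygamma 3 z2"
    using gmvt[of "x + \<alpha>" "x + \<alpha> + \<beta>"] x pos by auto
  have n: "Polygamma 2 z1 < 0" "Polygamma 2 z2 < 0"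
    using Polygamma_real_even_neg[of z1 2] Polygamma_real_even_neg[of z2 2] x z1 z2 pos by auto
  have E1: "?E1 x = ?D1 x * (Polygamma 3 z1 / Polygamma 2 z1)"
    using z1(3) n(1) by (simp add: field_simps)
  have E2: "?E2 x = ?D2 x * (Polygamma 3 z2 / Polygamma 2 z2)"
    using z2(3) n(2) by (simp add: field_simps)
  have "Polygamma 3 z1 / Polygamma 2 z1 < Polygamma 3 z2 / Polygamma 2 z2"
    using Polygamma_quotient_strict_mono[of z1 z2] x z1 z2 by simp
  then have "?D1 x * ?D2 x * (Polygamma 3 z1 / Polygamma 2 z1) < ?D1 x * ?D2 x * (Polygamma 3 z2 / Polygamma 2 z2)"
    using p by (intro mult_strict_left_mono) auto
  then have "?E1 x * ?D2 x - ?D1 x * ?E2 x < 0"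
    unfolding E1 E2 by (simp add: mult_ac)
  then have "(?E1 x * ?D2 x - ?D1 x * ?E2 x) / (?D2 x * ?D2 x) < 0"
    using p by (intro divide_neg_pos) auto
  moreover have "(trigamma_ratio has_real_derivative (?E1 x * ?D2 x - ?D1 x * ?E2 x) / (?D2 x * ?D2 x)) (at x)"
    unfolding trigamma_ratio_def[abs_def] using p by (intro DERIV_divide d1 d2) auto
  ultimately show "\<exists>y. DERIV trigamma_ratio x :> y \<and> y < 0" by blast
qed

text \<open>The intermediate points lie in adjacent intervals. Their order gives the lower bound on
  the ratio, the outer endpoints give the upper bound.\<close>

lemma trigamma_ratio_mvt:
  assumes l: "l > 0"
  obtains z1 z2 where "l < z1" "z1 < l + \<alpha>" "l + \<alpha> < z2" "z2 < l + \<alpha> + \<beta>"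
    "trigamma_ratio l = \<alpha> * (- Polygamma 2 z1) / (\<beta> * (- Polygamma 2 z2))"
proof -
  have e: "Suc 1 = 2" by simp
  have mvt: "\<exists>z. u < z \<and> z < v \<and> Polygamma 1 v - Polygamma 1 u = (v - u) * Polygamma 2 z"
    if "0 < u" "u < v" for u v :: real
    using that has_field_derivative_Polygamma[of "z :: real" 1 UNIV for z] unfolding e
    by (intro MVT2) auto
  obtain z1 where z1: "l < z1" "z1 < l + \<alpha>" "Polygamma 1 (l + \<alpha>) - Polygamma 1 l = \<alpha> * Polygamma 2 z1"
    using mvt[of l "l + \<alpha>"] l pos by auto
  obtain z2 where z2: "l + \<alpha> < z2" "z2 < l + \<alpha> + \<beta>"
    "Polygamma 1 (l + \<alpha> + \<beta>) - Polygamma 1 (l + \<alpha>) = \<beta> * Polygamma 2 z2"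
    using mvt[of "l + \<alpha>" "l + \<alpha> + \<beta>"] l pos by auto
  have "trigamma_ratio l = (Polygamma 1 (l + \<alpha>) - Polygamma 1 l) / (Polygamma 1 (l + \<alpha> + \<beta>) - Polygamma 1 (l + \<alpha>))"
    unfolding trigamma_ratio_def by (metis minus_diff_eq minus_divide_divide)
  then show ?thesis
    using that[OF z1(1,2) z2(1,2)] unfolding z1(3) z2(3) by simp
qed

text \<open>The number \<alpha> / \<beta> is the slope s / t of the law of large numbers direction.
  It lies below all values of the ratio, so that direction has no critical parameter.\<close>

lemma trigamma_ratio_gt:
  assumes l: "l > 0"
  shows "\<alpha> / \<beta> < trigamma_ratio l"
proof -
  from trigamma_ratio_mvt[OF l] obtain z1 z2 where z: "l < z1" "z1 < l + \<alpha>" "l + \<alpha> < z2" "z2 < l + \<alpha> + \<beta>"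
    "trigamma_ratio l = \<alpha> * (- Polygamma 2 z1) / (\<beta> * (- Polygamma 2 z2))" .
  have "Polygamma 2 z1 < Polygamma 2 z2" "Polygamma 2 z2 < 0"
    using Polygamma_real_strict_mono[of z1 z2 2] Polygamma_real_even_neg[of z2 2] z l by auto
  then have "\<alpha> * (- Polygamma 2 z2) / (\<beta> * (- Polygamma 2 z2)) < \<alpha> * (- Polygamma 2 z1) / (\<beta> * (- Polygamma 2 z2))"
    using pos by (intro divide_strict_right_mono mult_strict_left_mono mult_pos_pos) auto
  then show ?thesis
    unfolding z(5) using \<open>Polygamma 2 z2 < 0\<close> by simp
qed

lemma trigamma_ratio_le:
  assumes l: "l > 1"
  shows "trigamma_ratio l \<le> \<alpha> / \<beta> * ((l + \<alpha> + \<beta>)\<^sup>2 / (l - 1)\<^sup>2)"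
proof -
  from trigamma_ratio_mvt[of l] l obtain z1 z2 where z: "l < z1" "z1 < l + \<alpha>" "l + \<alpha> < z2" "z2 < l + \<alpha> + \<beta>"
    "trigamma_ratio l = \<alpha> * (- Polygamma 2 z1) / (\<beta> * (- Polygamma 2 z2))" by auto
  have "- Polygamma 2 z1 \<le> 1 / (l - 1)\<^sup>2"
    using Polygamma_real_strict_mono[of l z1 2] Polygamma_2_bounds(2)[of "l - 1"] z l by auto
  moreover have "1 / (l + \<alpha> + \<beta>)\<^sup>2 \<le> - Polygamma 2 z2"
    using Polygamma_real_strict_mono[of z2 "l + \<alpha> + \<beta>" 2] Polygamma_2_bounds(1)[of "l + \<alpha> + \<beta>"] z l pos by auto
  ultimately have "\<alpha> * (- Polygamma 2 z1) / (\<beta> * (- Polygamma 2 z2)) \<le> \<alpha> * (1 / (l - 1)\<^sup>2) / (\<beta> * (1 / (l + \<alpha> + \<beta>)\<^sup>2))"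
    using pos l by (intro frac_le mult_left_mono mult_pos_pos) auto
  then show ?thesis unfolding z(5) by (simp add: mult.commute)
qed

lemma rate'_altdef:
  assumes "l > 0"
  shows "rate' \<alpha> \<beta> l s t = (Polygamma 1 (l + \<alpha>) - Polygamma 1 (l + \<alpha> + \<beta>)) * (t * trigamma_ratio l - s)"
  using trigamma_diff_pos[OF assms] by (simp add: rate'_def trigamma_ratio_def field_simps)

lemma rate_strict_mono_if:
  assumes "0 < l" "l < m" "\<And>x. l < x \<Longrightarrow> x < m \<Longrightarrow> t * trigamma_ratio x > s"
  shows "rate \<alpha> \<beta> l s t < rate \<alpha> \<beta> m s t"
proof (rule DERIV_pos_imp_increasing_open[OF \<open>l < m\<close>])
  fix x assume x: "l < x" "x < m"
  then have "x > 0" using assms by simp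
  then show "\<exists>y. DERIV (\<lambda>l. rate \<alpha> \<beta> l s t) x :> y \<and> 0 < y"
    using rate_has_derivative[of x s t] rate'_altdef[of x s t] trigamma_diff_pos(2)[of x] assms(3)[OF x]
    by (intro exI[of _ "rate' \<alpha> \<beta> x s t"]) simp
next
  show "continuous_on {l..m} (\<lambda>l. rate \<alpha> \<beta> l s t)"
    using assms(1) by (intro continuous_at_imp_continuous_on ballI DERIV_isCont[OF rate_has_derivative]) auto
qed

lemma rate_strict_antimono_if:
  assumes "0 < l" "l < m" "\<And>x. l < x \<Longrightarrow> x < m \<Longrightarrow> t * trigamma_ratio x < s"
  shows "rate \<alpha> \<beta> m s t < rate \<alpha> \<beta> l s t"
proof (rule DERIV_neg_imp_decreasing_open[OF \<open>l < m\<close>])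
  fix x assume x: "l < x" "x < m"
  then have "x > 0" using assms by simp
  then show "\<exists>y. DERIV (\<lambda>l. rate \<alpha> \<beta> l s t) x :> y \<and> y < 0"
    using rate_has_derivative[of x s t] rate'_altdef[of x s t] trigamma_diff_pos(2)[of x] assms(3)[OF x]
    by (intro exI[of _ "rate' \<alpha> \<beta> x s t"]) (simp add: mult_pos_neg)
next
  show "continuous_on {l..m} (\<lambda>l. rate \<alpha> \<beta> l s t)"
    using assms(1) by (intro continuous_at_imp_continuous_on ballI DERIV_isCont[OF rate_has_derivative]) auto
qed

text \<open>These are the rate comparisons in the two coordinate directions. They make the
  difference of the rates for two parameters monotone in each coordinate of the end point.\<close>

lemma rate_increments_strict_mono:
  assumes "0 < l" "l < m"
  shows "Digamma l - Digamma (l + \<alpha>) < Digamma m - Digamma (m + \<alpha>)"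
    and "Digamma (l + \<alpha>) - Digamma (l + \<alpha> + \<beta>) < Digamma (m + \<alpha>) - Digamma (m + \<alpha> + \<beta>)"
proof -
  have "0 < trigamma_ratio x" if "l < x" for x
    using trigamma_ratio_gt[of x] divide_pos_pos[OF pos] that assms by simp
  then show "Digamma l - Digamma (l + \<alpha>) < Digamma m - Digamma (m + \<alpha>)"
    using rate_strict_mono_if[OF assms, of 0 1] by (simp add: rate_def)
  show "Digamma (l + \<alpha>) - Digamma (l + \<alpha> + \<beta>) < Digamma (m + \<alpha>) - Digamma (m + \<alpha> + \<beta>)"
    using rate_strict_antimono_if[OF assms, of 0 1] by (simp add: rate_def)
qed

lemma rate_strict_mono_lln:
  assumes "s > 0" "t > 0" "s * \<beta> = t * \<alpha>" "0 < l" "l < m"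
  shows "rate \<alpha> \<beta> l s t < rate \<alpha> \<beta> m s t"
proof (rule rate_strict_mono_if[OF assms(4,5)])
  have s_eq: "s = t * (\<alpha> / \<beta>)" using assms(3) pos by (simp add: field_simps)
  fix x assume "l < x"
  then show "s < t * trigamma_ratio x"
    using mult_strict_left_mono[OF trigamma_ratio_gt[of x] \<open>t > 0\<close>] assms(4) s_eq by simp
qed

text \<open>The intermediate value theorem yields \<open>c\<close>: the ratio exceeds s / t near 0,
  where \<open>Polygamma 1\<close> blows up, and is below s / t for large parameters, where it
  approaches \<alpha> / \<beta>.\<close>

lemma rate_unimodal:
  assumes "s > 0" "t > 0" "s * \<beta> > t * \<alpha>"
  obtains c where "c > 0"
    "\<And>l m. 0 < l \<Longrightarrow> l < m \<Longrightarrow> m \<le> c \<Longrightarrow> rate \<alpha> \<beta> l s t < rate \<alpha> \<beta> m s t"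
    "\<And>l m. c \<le> l \<Longrightarrow> l < m \<Longrightarrow> rate \<alpha> \<beta> m s t < rate \<alpha> \<beta> l s t"
proof -
  have "((\<lambda>l. \<alpha> / \<beta> * ((l + \<alpha> + \<beta>)\<^sup>2 / (l - 1)\<^sup>2)) \<longlongrightarrow> \<alpha> / \<beta>) at_top"
    using pos by real_asymp
  moreover have "\<alpha> / \<beta> < s / t" using assms pos by (simp add: field_simps)
  ultimately have "eventually (\<lambda>l. \<alpha> / \<beta> * ((l + \<alpha> + \<beta>)\<^sup>2 / (l - 1)\<^sup>2) < s / t) at_top"
    by (rule order_tendstoD(2))
  then have "eventually (\<lambda>l. \<alpha> / \<beta> * ((l + \<alpha> + \<beta>)\<^sup>2 / (l - 1)\<^sup>2) < s / t \<and> l > 1) at_top"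
    using eventually_gt_at_top[of 1] by (rule eventually_conj)
  then obtain b where b: "\<alpha> / \<beta> * ((b + \<alpha> + \<beta>)\<^sup>2 / (b - 1)\<^sup>2) < s / t" "b > 1"
    by (auto dest: eventually_happens simp: trivial_limit_at_top_linorder)
  have Rb: "trigamma_ratio b < s / t" using trigamma_ratio_le[OF b(2)] b(1) by linarith
  \<comment> \<open>If \<open>Polygamma 1 a\<close> exceeds \<open>K\<close>, then
    \<open>rate'\<close> is positive at \<open>a\<close>. Since
    \<open>Polygamma 1 a \<ge> 1 / a\<^sup>2\<close>, it suffices that
    \<open>1 / a\<^sup>2 \<ge> 2 * K\<close>. The cap 1 in \<open>a\<close> keeps it below
    \<open>b\<close>.\<close>
  define K where "K = (s + t) * Polygamma 1 \<alpha> / t"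
  have K: "K > 0" using assms Polygamma_real_odd_pos[of \<alpha> 1] pos by (simp add: K_def)
  define a where "a = min 1 (1 / sqrt (2 * K))"
  have a: "a > 0" "a \<le> 1" using K by (auto simp: a_def)
  have "a\<^sup>2 \<le> (1 / sqrt (2 * K))\<^sup>2"
    using a by (intro power_mono) (auto simp: a_def)
  also have "\<dots> = 1 / (2 * K)" using K by (simp add: power_divide)
  finally have aK: "K < 1 / a\<^sup>2" using a K
    by (simp add: field_simps)
  have "Polygamma 1 a \<ge> 1 / a\<^sup>2"
    using Polygamma_plus1[of a 1] a Polygamma_real_odd_pos[of "a + 1" 1] by (simp add: eval_nat_numeral)
  then have "t * K < t * Polygamma 1 a"
    using aK assms(2) by (intro mult_strict_left_mono) auto
  then have "t * Polygamma 1 a > (s + t) * Polygamma 1 \<alpha>"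
    using assms(2) by (simp add: K_def)
  moreover have "Polygamma 1 (a + \<alpha>) < Polygamma 1 \<alpha>"
    using Polygamma_real_strict_antimono[of \<alpha> "a + \<alpha>" 1] a pos by simp
  then have "(s + t) * Polygamma 1 (a + \<alpha>) < (s + t) * Polygamma 1 \<alpha>"
    using assms by simp
  moreover have "s * Polygamma 1 (a + \<alpha> + \<beta>) > 0"
    using Polygamma_real_odd_pos[of "a + \<alpha> + \<beta>" 1] a pos assms by simp
  ultimately have "rate' \<alpha> \<beta> a s t > 0"
    by (simp add: rate'_def algebra_simps)
  then have "t * trigamma_ratio a - s > 0"
    using rate'_altdef[OF a(1), of s t] trigamma_diff_pos(2)[OF a(1)] by (simp add: zero_less_mult_iff)
  then have Ra: "trigamma_ratio a > s / t" using assms by (simp add: field_simps)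
  have ab: "a \<le> b" using a b by simp
  have "continuous_on {a..b} trigamma_ratio"
  proof (intro continuous_at_imp_continuous_on ballI)
    fix x assume "x \<in> {a..b}"
    then have "x > 0" using a by simp
    then show "isCont trigamma_ratio x"
      unfolding trigamma_ratio_def[abs_def]
      using pos trigamma_diff_pos(2)[of x] by (intro continuous_intros) auto
  qed
  then obtain c where c: "a \<le> c" "c \<le> b" "trigamma_ratio c = s / t"
    using IVT2'[of trigamma_ratio b "s / t" a] Ra Rb ab by (auto simp: less_imp_le)
  show ?thesis
  proof (rule that[of c])
    show "c > 0" using a c by simp
    show "rate \<alpha> \<beta> l s t < rate \<alpha> \<beta> m s t" if "0 < l" "l < m" "m \<le> c" for l m
    proof (rule rate_strict_mono_if[OF that(1,2)])
      fix x assume "l < x" "x < m"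
      then show "s < t * trigamma_ratio x"
        using trigamma_ratio_strict_antimono[of x c] that c assms by (simp add: field_simps)
    qed
    show "rate \<alpha> \<beta> m s t < rate \<alpha> \<beta> l s t" if "c \<le> l" "l < m" for l m
    proof (rule rate_strict_antimono_if[OF _ that(2)])
      show "0 < l" using a c that by simp
      fix x assume "l < x" "x < m"
      then show "t * trigamma_ratio x < s"
        using trigamma_ratio_strict_antimono[of c x] that c assms a by (simp add: field_simps)
    qed
  qed
qed

end

subsection \<open>Beta distributions\<close>

text \<open>The maps applied to the coordinates below are arithmetic and leave the unit interval on
  null sets. With the law carried to the whole line they need only be Borel measurable.\<close>

definition beta_real :: "real \<Rightarrow> real \<Rightarrow> real measure" where
  "beta_real a b = distr (beta_law a b) borel (\<lambda>t. t)"

lemma measurable_beta_law_borel: "(\<lambda>t. t) \<in> borel_measurable (beta_law a b)"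
  by (simp add: measurable_restrict_space1 cong: measurable_cong_sets[OF sets_beta_law refl])

lemma sets_beta_real [simp, measurable_cong]: "sets (beta_real a b) = sets borel"
  and space_beta_real [simp]: "space (beta_real a b) = UNIV"
  by (simp_all add: beta_real_def)

lemma Beta_real_pos: "a > 0 \<Longrightarrow> b > 0 \<Longrightarrow> Beta a b > (0::real)"
  by (simp add: Beta_def Gamma_real_pos)

lemma prob_space_beta_real: "a > 0 \<Longrightarrow> b > 0 \<Longrightarrow> prob_space (beta_real a b)"
  unfolding beta_real_def by (intro prob_space.prob_space_distr prob_space_beta_law measurable_beta_law_borel)

lemma nn_integral_beta_real:
  assumes [measurable]: "f \<in> borel_measurable borel" and "a > 0" "b > 0"
  shows "(\<integral>\<^sup>+t. f t \<partial>beta_real a b)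
    = (\<integral>\<^sup>+t. ennreal (t powr (a - 1) * (1 - t) powr (b - 1) / Beta a b) * f t * indicator {0..1} t \<partial>lborel)"
proof -
  have "(\<integral>\<^sup>+t. f t \<partial>beta_real a b) = (\<integral>\<^sup>+t. f t \<partial>beta_law a b)"
    unfolding beta_real_def by (simp add: nn_integral_distr measurable_beta_law_borel)
  also have "\<dots> = (\<integral>\<^sup>+t. ennreal (t powr (a - 1) * (1 - t) powr (b - 1) / Beta a b) * f t \<partial>restrict_space lborel {0..1})"
    unfolding beta_law_def by (intro nn_integral_density) (auto intro!: measurable_restrict_space1)
  finally show ?thesis
    by (subst (asm) nn_integral_restrict_space) auto
qed

lemma AE_beta_real:
  assumes "a > 0" "b > 0"
  shows "AE t in beta_real a b. 0 < t \<and> t < 1"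
proof (rule AE_I)
  show "{t \<in> space (beta_real a b). \<not> (0 < t \<and> t < 1)} \<subseteq> {..0} \<union> {1..}" by auto
  have "emeasure (beta_real a b) ({..0} \<union> {1..}) = (\<integral>\<^sup>+t. indicator ({..0} \<union> {1..}) t \<partial>beta_real a b)"
    by (simp add: nn_integral_indicator)
  also have "\<dots> = (\<integral>\<^sup>+t. ennreal (t powr (a - 1) * (1 - t) powr (b - 1) / Beta a b) * indicator ({..0} \<union> {1..}) t * indicator {0..1} t \<partial>lborel)"
    using assms by (intro nn_integral_beta_real) auto
  also have "\<dots> = (\<integral>\<^sup>+(t::real). 0 \<partial>lborel)"
    by (intro nn_integral_cong) (auto split: split_indicator)
  finally show "emeasure (beta_real a b) ({..0} \<union> {1..}) = 0" by simp
qed simp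

lemma beta_real_moment:
  assumes "a > 0" "b > 0" "a + s > 0" "b + u > 0"
  shows "(\<integral>\<^sup>+t. ennreal (t powr s * (1 - t) powr u) \<partial>beta_real a b) = ennreal (Beta (a + s) (b + u) / Beta a b)"
proof -
  have B: "Beta a b > 0" using assms by (intro Beta_real_pos)
  have "(\<integral>\<^sup>+t. ennreal (t powr s * (1 - t) powr u) \<partial>beta_real a b)
      = (\<integral>\<^sup>+t. ennreal (t powr (a + s - 1) * (1 - t) powr (b + u - 1) / Beta a b * indicator {0..1} t) \<partial>lborel)"
    using B by (subst nn_integral_beta_real[OF _ assms(1,2)])
      (auto intro!: nn_integral_cong simp: ennreal_mult[symmetric] powr_add[symmetric] algebra_simps split: split_indicator)
  also have "\<dots> = ennreal (Beta (a + s) (b + u) / Beta a b)"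
  proof (rule nn_integral_has_integral_lborel)
    have "((\<lambda>t. t powr (a + s - 1) * (1 - t) powr (b + u - 1) / Beta a b) has_integral Beta (a + s) (b + u) / Beta a b) {0..1}"
      using assms by (intro has_integral_divide has_integral_Beta_real) auto
    moreover have "(\<lambda>t. t powr (a + s - 1) * (1 - t) powr (b + u - 1) / Beta a b * indicator {0..1} t)
        = (\<lambda>t. if t \<in> {0..1} then t powr (a + s - 1) * (1 - t) powr (b + u - 1) / Beta a b else 0)"
      by (auto simp: fun_eq_iff)
    ultimately show "((\<lambda>t. t powr (a + s - 1) * (1 - t) powr (b + u - 1) / Beta a b * indicator {0..1} t)
        has_integral Beta (a + s) (b + u) / Beta a b) UNIV"
      by (simp only: has_integral_restrict_UNIV)
  qed (use B in auto)
  finally show ?thesis .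
qed

lemma beta_real_integral:
  assumes "a > 0" "b > 0"
  shows "(\<integral>t. t ^ m * (1 - t) ^ k \<partial>beta_real a b) = Beta (a + real m) (b + real k) / Beta a b"
    and "integrable (beta_real a b) (\<lambda>t. t ^ m * (1 - t) ^ k)"
proof -
  have nn: "(\<integral>\<^sup>+t. ennreal (t ^ m * (1 - t) ^ k) \<partial>beta_real a b) = ennreal (Beta (a + real m) (b + real k) / Beta a b)"
    (is "?L = _")
  proof -
    \<comment> \<open>\<open>0 powr 0\<close> is 0 whereas \<open>0 ^ 0\<close> is 1, so powers and
      \<open>powr\<close> are identified only away from the end points.\<close>
    have "?L = (\<integral>\<^sup>+t. ennreal (t powr real m * (1 - t) powr real k) \<partial>beta_real a b)"
      using AE_beta_real[OF assms] by (intro nn_integral_cong_AE) (auto simp: powr_realpow)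
    then show ?thesis using assms by (simp add: beta_real_moment)
  qed
  have p: "0 \<le> Beta (a + real m) (b + real k) / Beta a b"
    using assms by (intro divide_nonneg_nonneg less_imp_le[OF Beta_real_pos]) auto
  have ae: "AE t in beta_real a b. 0 \<le> t ^ m * (1 - t) ^ k"
    using AE_beta_real[OF assms] by eventually_elim auto
  show "integrable (beta_real a b) (\<lambda>t. t ^ m * (1 - t) ^ k)"
    using nn ae by (intro integrableI_nonneg) (auto simp: measurable_cong_sets[OF sets_beta_real refl])
  show "(\<integral>t. t ^ m * (1 - t) ^ k \<partial>beta_real a b) = Beta (a + real m) (b + real k) / Beta a b"
    using nn ae p by (intro integral_eq_nn_integral[THEN trans]) (auto simp: measurable_cong_sets[OF sets_beta_real refl])
qed

lemma beta_real_mean: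
  assumes "a > 0" "b > 0"
  shows "(\<integral>\<^sup>+t. ennreal t \<partial>beta_real a b) = ennreal (a / (a + b))"
proof -
  have "(\<integral>\<^sup>+t. ennreal t \<partial>beta_real a b) = (\<integral>\<^sup>+t. ennreal (t powr 1 * (1 - t) powr 0) \<partial>beta_real a b)"
    using AE_beta_real[OF assms] by (intro nn_integral_cong_AE) auto
  also have "\<dots> = ennreal (Beta (a + 1) b / Beta a b)"
    using assms by (subst beta_real_moment) auto
  also have "Beta (a + 1) b / Beta a b = a / (a + b)"
    using Beta_plus1_left[of a b] assms Beta_real_pos[OF assms]
    by (simp add: field_simps)
  finally show ?thesis .
qed

text \<open>The logarithmic moment generating function of a beta variable has derivative \<open>Digamma a - Digamma (a + b)\<close> at 0.\<close>

lemma beta_real_exponential_moments: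
  assumes ab: "a > 0" "b > 0" and e: "\<epsilon> > 0"
  obtains \<theta> where "\<theta> > 0"
    "(\<integral>\<^sup>+t. ennreal (t powr \<theta>) \<partial>beta_real a b) \<le> ennreal (exp (\<theta> * (Digamma a - Digamma (a + b) + \<epsilon>)))"
    "(\<integral>\<^sup>+t. ennreal (t powr (- \<theta>)) \<partial>beta_real a b) \<le> ennreal (exp (- \<theta> * (Digamma a - Digamma (a + b) - \<epsilon>)))"
proof -
  define m where "m = Digamma a - Digamma (a + b)"
  \<comment> \<open>The cumulant generating function of the logarithm of the beta variable, with
    \<open>g 0 = 0\<close>.\<close>
  define g where "g \<theta> = ln_Gamma (a + \<theta>) - ln_Gamma (a + b + \<theta>) - (ln_Gamma a - ln_Gamma (a + b))" for \<theta>
  have "(g has_real_derivative m) (at 0)"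
    unfolding g_def[abs_def] m_def using ab by (auto intro!: derivative_eq_intros)
  then have "((\<lambda>h. (g (0 + h) - g 0) / h) \<longlongrightarrow> m) (at 0)"
    unfolding DERIV_def .
  then have "\<forall>\<^sub>F h in at 0. dist (g h / h) m < \<epsilon>"
    using tendstoD[OF _ e] by (fastforce simp: g_def)
  then obtain d where d: "d > 0" "\<And>h. h \<noteq> 0 \<Longrightarrow> \<bar>h\<bar> < d \<Longrightarrow> \<bar>g h / h - m\<bar> < \<epsilon>"
    unfolding eventually_at by (auto simp: dist_real_def)
  \<comment> \<open>The bound \<open>d / 2\<close> stays where the difference quotient of
    \<open>g\<close> is within \<epsilon> of \<open>m\<close>; the bound \<open>a / 2\<close> keeps
    the moment of order \<open>- \<theta>\<close> finite.\<close>
  define \<theta> where "\<theta> = min (d / 2) (a / 2)"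
  have th: "\<theta> > 0" "\<theta> < d" "\<theta> < a" using d(1) ab by (auto simp: \<theta>_def)
  have M: "(\<integral>\<^sup>+t. ennreal (t powr h) \<partial>beta_real a b) = ennreal (exp (g h))" if "\<bar>h\<bar> < a" for h
  proof -
    have h: "a + h > 0" using that by linarith
    have "(\<integral>\<^sup>+t. ennreal (t powr h) \<partial>beta_real a b) = (\<integral>\<^sup>+t. ennreal (t powr h * (1 - t) powr 0) \<partial>beta_real a b)"
      using AE_beta_real[OF ab] by (intro nn_integral_cong_AE) auto
    also have "\<dots> = ennreal (Beta (a + h) b / Beta a b)"
      using ab h by (subst beta_real_moment) auto
    also have "Beta (a + h) b / Beta a b = exp (g h)"
      using ab h by (simp add: Beta_def g_def Gamma_real_pos_exp exp_diff add_ac)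
    finally show ?thesis .
  qed
  have "g \<theta> \<le> \<theta> * (m + \<epsilon>)" using d(2)[of \<theta>] th by (simp add: abs_less_iff field_simps)
  moreover have "g (- \<theta>) \<le> - \<theta> * (m - \<epsilon>)" using d(2)[of "- \<theta>"] th by (simp add: abs_less_iff field_simps)
  ultimately show ?thesis
    using that[of \<theta>] th M[of \<theta>] M[of "- \<theta>"] by (simp add: m_def)
qed

section \<open>The moment problem on the unit interval and the unit square\<close>

text \<open>Plain moments give the integrals of x^k (1 - x)^j and hence of Bernstein polynomials,
  which approximate continuous functions uniformly on the unit interval. Continuous ramps then
  approximate indicators of half lines.\<close>

lemma moments_determine_real:
  fixes M N :: "real measure"
  assumes sets [measurable_cong]: "sets M = sets borel" "sets N = sets borel"
    and fin: "finite_measure M" "finite_measure N"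
    and ae: "AE x in M. 0 \<le> x \<and> x \<le> 1" "AE x in N. 0 \<le> x \<and> x \<le> 1"
    and mom: "\<And>k. (\<integral>x. x ^ k \<partial>M) = (\<integral>x. x ^ k \<partial>N)"
  shows "M = N"
proof -
  interpret M: finite_measure M by fact
  interpret N: finite_measure N by fact
  have bdd: "\<bar>x ^ k * (1 - x) ^ j\<bar> \<le> 1" if "0 \<le> x \<and> x \<le> 1" for x :: real and k j
    using that by (simp add: abs_mult power_abs) (intro mult_le_one power_le_one; simp)
  have intM: "integrable M (\<lambda>x. x ^ k * (1 - x) ^ j)" for k j
  proof (rule M.integrable_const_bound[of _ 1])
    show "AE x in M. norm (x ^ k * (1 - x) ^ j) \<le> 1"
      using ae(1) by eventually_elim (simp only: real_norm_def bdd)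
  qed measurable
  have intN: "integrable N (\<lambda>x. x ^ k * (1 - x) ^ j)" for k j
  proof (rule N.integrable_const_bound[of _ 1])
    show "AE x in N. norm (x ^ k * (1 - x) ^ j) \<le> 1"
      using ae(2) by eventually_elim (simp only: real_norm_def bdd)
  qed measurable
  have mix: "(\<integral>x. x ^ k * (1 - x) ^ j \<partial>M) = (\<integral>x. x ^ k * (1 - x) ^ j \<partial>N)" for k j
  proof (induction j arbitrary: k)
    case 0
    then show ?case using mom by simp
  next
    case (Suc j)
    have eq: "x ^ k * (1 - x) ^ Suc j = x ^ k * (1 - x) ^ j - x ^ Suc k * (1 - x) ^ j" for x :: real
      by (simp add: algebra_simps)
    show ?case
      unfolding eq Bochner_Integration.integral_diff[OF intM intM] Bochner_Integration.integral_diff[OF intN intN] Suc.IH ..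
  qed
  have cont: "(\<integral>x. f x \<partial>M) = (\<integral>x. f x \<partial>N)"
    if f: "continuous_on UNIV f" "\<And>x. 0 \<le> f x \<and> f x \<le> 1" for f :: "real \<Rightarrow> real"
  proof -
    have fm [measurable]: "f \<in> borel_measurable borel" using f(1) by (rule borel_measurable_continuous_onI)
    define C where "C = measure M (space M) + measure N (space N)"
    have C: "C \<ge> 0" by (simp add: C_def)
    have "\<bar>(\<integral>x. f x \<partial>M) - (\<integral>x. f x \<partial>N)\<bar> \<le> e * C" if e: "e > 0" for e
    proof -
      have "continuous_on {0..1} f" using f(1) continuous_on_subset by blast
      from Bernstein_Weierstrass[OF this e] obtain n where
        n: "\<And>x. x \<in> {0..1} \<Longrightarrow> \<bar>f x - (\<Sum>k\<le>n. f (real k / real n) * Bernstein n k x)\<bar> < e" by blast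
      define p where "p x = (\<Sum>k\<le>n. f (real k / real n) * Bernstein n k x)" for x
      have p: "p = (\<lambda>x. \<Sum>k\<le>n. (f (real k / real n) * real (n choose k)) * (x ^ k * (1 - x) ^ (n - k)))"
        by (simp add: p_def fun_eq_iff Bernstein_def mult_ac)
      have ipM: "integrable M p" and ipN: "integrable N p"
        unfolding p by (intro Bochner_Integration.integrable_sum integrable_mult_right intM intN)+
      have ifM: "integrable M f" and ifN: "integrable N f"
        using f(2) by (auto intro!: M.integrable_const_bound[of _ 1] N.integrable_const_bound[of _ 1] simp: abs_le_iff)
      have pp: "(\<integral>x. p x \<partial>M) = (\<integral>x. p x \<partial>N)"
        unfolding p by (simp add: Bochner_Integration.integral_sum integrable_mult_right intM intN mix)
      have "\<bar>(\<integral>x. f x \<partial>K) - (\<integral>x. p x \<partial>K)\<bar> \<le> (\<integral>x. e \<partial>K)"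
        if K: "finite_measure K" "integrable K f" "integrable K p" "AE x in K. 0 \<le> x \<and> x \<le> 1" for K
      proof -
        interpret K: finite_measure K by fact
        have "\<bar>(\<integral>x. f x \<partial>K) - (\<integral>x. p x \<partial>K)\<bar> = norm (\<integral>x. f x - p x \<partial>K)"
          using K by simp
        also have "\<dots> \<le> (\<integral>x. norm (f x - p x) \<partial>K)" by (rule integral_norm_bound)
        also have "\<dots> \<le> (\<integral>x. e \<partial>K)"
        proof (rule integral_mono_AE)
          show "AE x in K. norm (f x - p x) \<le> e"
            using K(4) by eventually_elim (use n in \<open>auto simp: p_def less_imp_le\<close>)
        qed (use K in auto)
        finally show ?thesis .
      qed
      from this[OF fin(1) ifM ipM ae(1)] this[OF fin(2) ifN ipN ae(2)]
      have "\<bar>(\<integral>x. f x \<partial>M) - (\<integral>x. p x \<partial>M)\<bar> \<le> (\<integral>x. e \<partial>M)"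
        "\<bar>(\<integral>x. f x \<partial>N) - (\<integral>x. p x \<partial>N)\<bar> \<le> (\<integral>x. e \<partial>N)" .
      then show ?thesis
        unfolding pp by (simp add: C_def algebra_simps)
    qed
    note bound = this
    have "\<bar>(\<integral>x. f x \<partial>M) - (\<integral>x. f x \<partial>N)\<bar> \<le> 0 + e" if "e > 0" for e
    proof (cases "C = 0")
      case False
      then show ?thesis using bound[of "e / C"] C that by simp
    qed (use bound[of 1] that in simp)
    then have "\<bar>(\<integral>x. f x \<partial>M) - (\<integral>x. f x \<partial>N)\<bar> \<le> 0" by (rule field_le_epsilon)
    then show ?thesis by simp
  qed
  show ?thesis
  proof (rule measure_eqI_lessThan[OF sets])
    fix c :: real
    show "emeasure M {c<..} < \<infinity>" by (simp add: M.emeasure_eq_measure)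
    \<comment> \<open>A ramp that rises from 0 at \<open>c\<close> with slope n, so the pointwise
      limit is the indicator of the open half line.\<close>
    define g where "g n x = min 1 (max 0 (real n * (x - c)))" for n x
    have g: "continuous_on UNIV (g n)" "0 \<le> g n x \<and> g n x \<le> 1" for n x
      unfolding g_def by (auto intro!: continuous_intros)
    have lim: "(\<lambda>n. g n x) \<longlonglongrightarrow> indicator {c<..} x" for x
    proof (cases "c < x")
      case True
      then have "eventually (\<lambda>n. real n * (x - c) \<ge> 1) sequentially"
        by (auto simp: field_simps intro!: eventually_ge_at_top[of "nat \<lceil>1 / (x - c)\<rceil>", THEN eventually_mono])
      then have "eventually (\<lambda>n. g n x = 1) sequentially"
        by eventually_elim (simp add: g_def)
      then show ?thesis using True by (simp add: tendsto_eventually)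
    next
      case False
      then have "g n x = 0" for n by (simp add: g_def mult_nonneg_nonpos)
      then show ?thesis using False by simp
    qed
    have [measurable]: "g n \<in> borel_measurable borel" for n using g(1) by (rule borel_measurable_continuous_onI)
    have nb: "norm (g n x) \<le> 1" for n x using g(2)[of n x] by simp
    have "(\<lambda>n. \<integral>x. g n x \<partial>M) \<longlonglongrightarrow> (\<integral>x. indicator {c<..} x \<partial>M)"
      using lim nb by (intro integral_dominated_convergence[where w = "\<lambda>_. 1"]) auto
    moreover have "(\<lambda>n. \<integral>x. g n x \<partial>N) \<longlonglongrightarrow> (\<integral>x. indicator {c<..} x \<partial>N)"
      using lim nb by (intro integral_dominated_convergence[where w = "\<lambda>_. 1"]) auto
    ultimately have "(\<integral>x. indicator {c<..} x \<partial>M) = (\<integral>x. indicator {c<..} x \<partial>N :: real)"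
      unfolding cont[OF g] by (rule LIMSEQ_unique)
    then show "emeasure M {c<..} = emeasure N {c<..}"
      using sets_eq_imp_space_eq[OF sets(1)] sets_eq_imp_space_eq[OF sets(2)]
      by (simp add: M.emeasure_eq_measure N.emeasure_eq_measure)
  qed
qed

text \<open>The weight is absorbed as a density before pushing forward by \<open>X\<close>; the
  finite measures so obtained have equal moments. This allows one coordinate of a pair to be treated
  while the other is held as a weight.\<close>

lemma weighted_moments_determine:
  fixes M N :: "'a measure" and g X :: "'a \<Rightarrow> real"
  assumes sets: "sets M = sets N" and fin: "finite_measure M" "finite_measure N"
    and gm: "g \<in> borel_measurable M" and Xm: "X \<in> borel_measurable M"
    and g: "AE z in M. 0 \<le> g z \<and> g z \<le> 1" "AE z in N. 0 \<le> g z \<and> g z \<le> 1"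
    and X: "AE z in M. 0 \<le> X z \<and> X z \<le> 1" "AE z in N. 0 \<le> X z \<and> X z \<le> 1"
    and mom: "\<And>k. (\<integral>z. g z * X z ^ k \<partial>M) = (\<integral>z. g z * X z ^ k \<partial>N)"
    and A: "A \<in> sets borel"
  shows "(\<integral>z. g z * indicator A (X z) \<partial>M) = (\<integral>z. g z * indicator A (X z) \<partial>N)"
proof -
  define D where "D K = distr (density K (\<lambda>z. ennreal (g z))) borel X" for K
  have gN: "g \<in> borel_measurable N" and XN: "X \<in> borel_measurable N"
    using gm Xm by (simp_all add: measurable_cong_sets[OF sets refl])
  have int: "(\<integral>x. f x \<partial>D K) = (\<integral>z. g z * f (X z) \<partial>K)"
    if "f \<in> borel_measurable borel" "g \<in> borel_measurable K" "X \<in> borel_measurable K"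
      "AE z in K. 0 \<le> g z \<and> g z \<le> 1" for f :: "real \<Rightarrow> real" and K
  proof -
    have [measurable]: "f \<in> borel_measurable borel" "g \<in> borel_measurable K" "X \<in> borel_measurable K" by fact+
    show ?thesis
      unfolding D_def using that(4)
      by (subst integral_distr) (auto simp: integral_density)
  qed
  have fD: "finite_measure (D K)" if "finite_measure K" "g \<in> borel_measurable K" "X \<in> borel_measurable K"
      "AE z in K. 0 \<le> g z \<and> g z \<le> 1" for K
  proof -
    have [measurable]: "g \<in> borel_measurable K" "X \<in> borel_measurable K" by fact+
    interpret K: finite_measure K by fact
    have "emeasure (density K (\<lambda>z. ennreal (g z))) (space K) \<le> (\<integral>\<^sup>+z. 1 \<partial>K)"
    proof (subst emeasure_density)
      show "(\<integral>\<^sup>+z. ennreal (g z) * indicator (space K) z \<partial>K) \<le> (\<integral>\<^sup>+z. 1 \<partial>K)"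
        using that(4) by (intro nn_integral_mono_AE, eventually_elim) (auto split: split_indicator)
    qed auto
    also have "\<dots> < \<infinity>" by (simp add: K.emeasure_eq_measure)
    finally have "finite_measure (density K (\<lambda>z. ennreal (g z)))" by (intro finite_measureI) auto
    then show ?thesis unfolding D_def by (intro finite_measure.finite_measure_distr) auto
  qed
  have aeD: "AE x in D K. 0 \<le> x \<and> x \<le> 1" if "g \<in> borel_measurable K" "X \<in> borel_measurable K"
      "AE z in K. 0 \<le> X z \<and> X z \<le> 1" for K
  proof -
    have [measurable]: "g \<in> borel_measurable K" "X \<in> borel_measurable K" by fact+
    have "AE z in density K (\<lambda>z. ennreal (g z)). 0 \<le> X z \<and> X z \<le> 1"
      by (subst AE_density, measurable, rule eventually_mono[OF that(3)]) auto
    then show ?thesis unfolding D_def by (subst AE_distr_iff) auto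
  qed
  have "D M = D N"
  proof (rule moments_determine_real[OF _ _ fD[OF fin(1) gm Xm g(1)] fD[OF fin(2) gN XN g(2)] aeD[OF gm Xm X(1)] aeD[OF gN XN X(2)]])
    show "(\<integral>x. x ^ k \<partial>D M) = (\<integral>x. x ^ k \<partial>D N)" for k
      using int[of "\<lambda>x. x ^ k" M, OF _ gm Xm g(1)] int[of "\<lambda>x. x ^ k" N, OF _ gN XN g(2)] mom by simp
  qed (simp_all add: D_def)
  then show ?thesis
    using int[of "indicator A" M, OF _ gm Xm g(1)] int[of "indicator A" N, OF _ gN XN g(2)] A by simp
qed

text \<open>The one-dimensional result is used twice: with weight \<open>snd z ^ m\<close> the
  moments of the first coordinate give its indicators, then with an indicator of the first
  coordinate as weight the moments of the second give its indicators. Rectangles generate.\<close>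

lemma moments_determine_pair:
  fixes M N :: "(real \<times> real) measure"
  assumes sets: "sets M = sets (borel \<Otimes>\<^sub>M borel)" "sets N = sets (borel \<Otimes>\<^sub>M borel)"
    and fin: "finite_measure M" "finite_measure N"
    and ae: "AE z in M. fst z \<in> {0..1} \<and> snd z \<in> {0..1}" "AE z in N. fst z \<in> {0..1} \<and> snd z \<in> {0..1}"
    and mom: "\<And>k m. (\<integral>z. fst z ^ k * snd z ^ m \<partial>M) = (\<integral>z. fst z ^ k * snd z ^ m \<partial>N)"
  shows "M = N"
proof -
  interpret M: finite_measure M by fact
  interpret N: finite_measure N by fact
  have sMN: "sets M = sets N" using sets by simp
  have [measurable_cong]: "sets M = sets (borel \<Otimes>\<^sub>M borel)" by fact
  have fm: "fst \<in> borel_measurable M" and sm: "snd \<in> borel_measurable M"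
    by measurable
  have aeS: "AE z in M. 0 \<le> snd z ^ m \<and> snd z ^ m \<le> 1" "AE z in N. 0 \<le> snd z ^ m \<and> snd z ^ m \<le> 1" for m
    by (rule eventually_mono[OF ae(1)], simp add: power_le_one, rule eventually_mono[OF ae(2)], simp add: power_le_one)
  have 1: "(\<integral>z. snd z ^ m * indicator A (fst z) \<partial>M) = (\<integral>z. snd z ^ m * indicator A (fst z) \<partial>N)"
    if "A \<in> sets borel" for m A
  proof (rule weighted_moments_determine[OF sMN fin])
    show "AE z in M. 0 \<le> fst z \<and> fst z \<le> 1" "AE z in N. 0 \<le> fst z \<and> fst z \<le> 1"
      by (rule eventually_mono[OF ae(1)], simp, rule eventually_mono[OF ae(2)], simp)
    show "(\<integral>z. snd z ^ m * fst z ^ k \<partial>M) = (\<integral>z. snd z ^ m * fst z ^ k \<partial>N)" for k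
      using mom[of k m] by (simp add: mult.commute)
  qed (use that aeS fm sm in auto)
  have 2: "(\<integral>z. indicator A (fst z) * indicator B (snd z) \<partial>M) = (\<integral>z. indicator A (fst z) * indicator B (snd z) \<partial>N :: real)"
    if A: "A \<in> sets borel" and B: "B \<in> sets borel" for A B
  proof (rule weighted_moments_determine[OF sMN fin, where g = "\<lambda>z. indicator A (fst z)"])
    show "AE z in M. 0 \<le> snd z \<and> snd z \<le> 1" "AE z in N. 0 \<le> snd z \<and> snd z \<le> 1"
      by (rule eventually_mono[OF ae(1)], simp, rule eventually_mono[OF ae(2)], simp)
    show "(\<integral>z. indicator A (fst z) * snd z ^ k \<partial>M) = (\<integral>z. indicator A (fst z) * snd z ^ k \<partial>N)" for k
      using 1[OF A, of k] by (simp add: mult.commute)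
    show "(\<lambda>z. indicator A (fst z) :: real) \<in> borel_measurable M" using A by measurable
  qed (use B sm in \<open>auto split: split_indicator\<close>)
  have sp: "space M = UNIV" "space N = UNIV"
    using sets_eq_imp_space_eq[OF sets(1)] sets_eq_imp_space_eq[OF sets(2)] by (simp_all add: space_pair_measure)
  show ?thesis
  proof (rule measure_eqI_generator_eq[OF Int_stable_pair_measure_generator[of "borel :: real measure" "borel :: real measure"]])
    show "{a \<times> b |a b. a \<in> sets (borel :: real measure) \<and> b \<in> sets (borel :: real measure)} \<subseteq> Pow UNIV" by simp
    show "sets M = sigma_sets UNIV {a \<times> b |a b. a \<in> sets (borel :: real measure) \<and> b \<in> sets (borel :: real measure)}"
      "sets N = sigma_sets UNIV {a \<times> b |a b. a \<in> sets (borel :: real measure) \<and> b \<in> sets (borel :: real measure)}"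
      unfolding sets sets_pair_measure by simp_all
    show "range (\<lambda>i::nat. UNIV) \<subseteq> {a \<times> b |a b. a \<in> sets (borel :: real measure) \<and> b \<in> sets (borel :: real measure)}"
      by (auto intro!: exI[of _ UNIV])
    fix E assume "E \<in> {a \<times> b |a b. a \<in> sets (borel :: real measure) \<and> b \<in> sets (borel :: real measure)}"
    then obtain A B where E: "E = A \<times> B" "A \<in> sets borel" "B \<in> sets borel" by auto
    then have Em: "E \<in> sets M" "E \<in> sets N" unfolding sets by auto
    have "(\<lambda>z. indicator A (fst z) * indicator B (snd z) :: real) = indicator E"
      by (auto simp: E fun_eq_iff split: split_indicator)
    then have "(\<integral>z. indicator E z \<partial>M) = (\<integral>z. (indicator E z :: real) \<partial>N)"
      using 2[OF E(2,3)] by simp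
    then show "emeasure M E = emeasure N E"
      using Em by (simp add: M.emeasure_eq_measure N.emeasure_eq_measure sp)
  qed (simp_all add: M.emeasure_eq_measure)
qed

lemma integral_pair_mult:
  fixes f g :: "real \<Rightarrow> real"
  assumes "prob_space M" "prob_space N" and f: "integrable M f" and g: "integrable N g"
  shows "(\<integral>z. f (fst z) * g (snd z) \<partial>(M \<Otimes>\<^sub>M N)) = (\<integral>x. f x \<partial>M) * (\<integral>x. g x \<partial>N)"
proof -
  interpret M: prob_space M by fact
  interpret N: prob_space N by fact
  interpret pair_prob_space M N ..
  have [measurable]: "f \<in> borel_measurable M" "g \<in> borel_measurable N" using f g by auto
  have "integrable (M \<Otimes>\<^sub>M N) (\<lambda>z. f (fst z) * g (snd z))"
    by (rule Fubini_integrable) (use f g in \<open>auto simp: abs_mult\<close>)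
  then show ?thesis using integral_fst'[symmetric, of "\<lambda>z. f (fst z) * g (snd z)"] by simp
qed

lemma AE_pair_prob:
  assumes "prob_space M" "prob_space N" and P: "AE x in M. P x" and Q: "AE y in N. Q y"
  shows "AE z in M \<Otimes>\<^sub>M N. P (fst z) \<and> Q (snd z)"
proof -
  interpret M: prob_space M by fact
  interpret N: prob_space N by fact
  obtain A where A: "{x \<in> space M. \<not> P x} \<subseteq> A" "A \<in> null_sets M" using P unfolding eventually_ae_filter by auto
  obtain B where B: "{x \<in> space N. \<not> Q x} \<subseteq> B" "B \<in> null_sets N" using Q unfolding eventually_ae_filter by auto
  have "A \<times> space N \<union> space M \<times> B \<in> null_sets (M \<Otimes>\<^sub>M N)"
    using A B by (intro null_sets.Un) (auto simp: null_sets_def N.emeasure_pair_measure_Times)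
  then show ?thesis
    by (rule AE_I') (use A B in \<open>auto simp: space_pair_measure\<close>)
qed

section \<open>Beta-gamma algebra\<close>

lemma Gamma_real_neq_0: "x > 0 \<Longrightarrow> Gamma (x::real) \<noteq> 0"
  by (metis Gamma_real_pos less_irrefl)

text \<open>
  With \<open>P = V W\<close> and \<open>1 - V = (1 - \<omega>) (1 - P)\<close>, the independent pairs \<open>(V, W)\<close> and \<open>(P, \<omega>)\<close> of beta variables below
  determine each other.  This is the beta-gamma algebra behind the stationarity of the increments.
\<close>

lemma beta_product_identity:
  assumes abl: "a > 0" "b > 0" "l > 0"
  shows "distr (beta_real (l + a) b \<Otimes>\<^sub>M beta_real l a) (borel \<Otimes>\<^sub>M borel) (\<lambda>(v, w). (v * w, 1 - v))
       = distr (beta_real l (a + b) \<Otimes>\<^sub>M beta_real a b) (borel \<Otimes>\<^sub>M borel) (\<lambda>(p, u). (p, (1 - u) * (1 - p)))"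
    (is "distr ?M _ ?F = distr ?N _ ?G")
proof -
  interpret V: prob_space "beta_real (l + a) b" using abl by (intro prob_space_beta_real) auto
  interpret W: prob_space "beta_real l a" using abl by (intro prob_space_beta_real) auto
  interpret P: prob_space "beta_real l (a + b)" using abl by (intro prob_space_beta_real) auto
  interpret U: prob_space "beta_real a b" using abl by (intro prob_space_beta_real) auto
  interpret VW: pair_prob_space "beta_real (l + a) b" "beta_real l a" ..
  interpret PU: pair_prob_space "beta_real l (a + b)" "beta_real a b" ..
  have F [measurable]: "?F \<in> ?M \<rightarrow>\<^sub>M borel \<Otimes>\<^sub>M borel" by measurable
  have G [measurable]: "?G \<in> ?N \<rightarrow>\<^sub>M borel \<Otimes>\<^sub>M borel" by measurable
  have sM: "sets ?M = sets (borel \<Otimes>\<^sub>M borel)" and sN: "sets ?N = sets (borel \<Otimes>\<^sub>M borel)"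
    by (intro sets_pair_measure_cong; simp)+
  have aeM: "AE z in ?M. fst z \<in> {0<..<1} \<and> snd z \<in> {0<..<1}"
    using AE_beta_real[of "l + a" b] AE_beta_real[of l a] abl
    by (intro AE_pair_prob[where P = "\<lambda>x. x \<in> {0<..<1}" and Q = "\<lambda>x. x \<in> {0<..<1}"]) (auto simp: V.prob_space_axioms W.prob_space_axioms)
  have aeN: "AE z in ?N. fst z \<in> {0<..<1} \<and> snd z \<in> {0<..<1}"
    using AE_beta_real[of l "a + b"] AE_beta_real[of a b] abl
    by (intro AE_pair_prob[where P = "\<lambda>x. x \<in> {0<..<1}" and Q = "\<lambda>x. x \<in> {0<..<1}"]) (auto simp: P.prob_space_axioms U.prob_space_axioms)
  show ?thesis
  proof (rule moments_determine_pair)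
    show "finite_measure (distr ?M (borel \<Otimes>\<^sub>M borel) ?F)"
      by (intro VW.finite_measure_distr) measurable
    show "finite_measure (distr ?N (borel \<Otimes>\<^sub>M borel) ?G)"
      by (intro PU.finite_measure_distr) measurable
    show "AE z in distr ?M (borel \<Otimes>\<^sub>M borel) ?F. fst z \<in> {0..1} \<and> snd z \<in> {0..1}"
      by (subst AE_distr_iff, measurable, rule eventually_mono[OF aeM]) (auto intro!: mult_le_one)
    show "AE z in distr ?N (borel \<Otimes>\<^sub>M borel) ?G. fst z \<in> {0..1} \<and> snd z \<in> {0..1}"
      by (subst AE_distr_iff, measurable, rule eventually_mono[OF aeN]) (auto intro!: mult_le_one)
    fix k m
    have "(\<integral>z. fst z ^ k * snd z ^ m \<partial>distr ?M (borel \<Otimes>\<^sub>M borel) ?F)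
        = (\<integral>z. (fst z ^ k * (1 - fst z) ^ m) * (snd z ^ k * (1 - snd z) ^ 0) \<partial>?M)"
      by (subst integral_distr) (auto intro!: Bochner_Integration.integral_cong simp: power_mult_distrib split_beta)
    also have "\<dots> = Beta (l + a + real k) (b + real m) / Beta (l + a) b * (Beta (l + real k) (a + real 0) / Beta l a)"
      using abl
      by (subst integral_pair_mult[OF V.prob_space_axioms W.prob_space_axioms beta_real_integral(2) beta_real_integral(2)])
        (simp_all only: beta_real_integral(1) add_pos_pos)
    \<comment> \<open>On the left the factors Gamma(l + a + k) and Gamma(l + a) cancel, on the right
      Gamma(a + b + m) and Gamma(a + b). Both sides become Gamma(l + k) Gamma(b + m) Gamma(l + a +
      b) / (Gamma(l) Gamma(b) Gamma(l + a + b + k + m)).\<close>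
    also have "\<dots> = Beta (l + real k) (a + b + real m) / Beta l (a + b) * (Beta (a + real 0) (b + real m) / Beta a b)"
    proof -
      have G: "Gamma (l + a) \<noteq> 0" "Gamma (l + a + real k) \<noteq> 0" "Gamma (a + b) \<noteq> 0" "Gamma (a + b + real m) \<noteq> 0"
        "Gamma (l + a + b + real k + real m) \<noteq> 0" "Gamma (l + a + b) \<noteq> 0" "Gamma l \<noteq> 0" "Gamma a \<noteq> 0" "Gamma b \<noteq> 0"
        using abl by (auto intro!: Gamma_real_neq_0)
      have e: "l + a + real k + (b + real m) = l + a + b + real k + real m"
        "l + real k + (a + b + real m) = l + a + b + real k + real m" "l + (a + b) = l + a + b"
        "a + (b + real m) = a + b + real m" "l + real k + a = l + a + real k" by simp_all
      show ?thesis
        unfolding Beta_def of_nat_0 add_0_right e using G by (simp add: field_simps)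
    qed
    also have "\<dots> = (\<integral>z. (fst z ^ k * (1 - fst z) ^ m) * (snd z ^ 0 * (1 - snd z) ^ m) \<partial>?N)"
      using abl
      by (subst integral_pair_mult[OF P.prob_space_axioms U.prob_space_axioms beta_real_integral(2) beta_real_integral(2)])
        (simp_all only: beta_real_integral(1) add_pos_pos)
    also have "\<dots> = (\<integral>z. fst z ^ k * snd z ^ m \<partial>distr ?N (borel \<Otimes>\<^sub>M borel) ?G)"
      by (subst integral_distr) (auto intro!: Bochner_Integration.integral_cong simp: power_mult_distrib split_beta)
    finally show "(\<integral>z. fst z ^ k * snd z ^ m \<partial>distr ?M (borel \<Otimes>\<^sub>M borel) ?F)
        = (\<integral>z. fst z ^ k * snd z ^ m \<partial>distr ?N (borel \<Otimes>\<^sub>M borel) ?G)" .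
  qed simp_all
qed

lemma distr_cong_comp:
  assumes "f \<in> M \<rightarrow>\<^sub>M N" "g \<in> N \<rightarrow>\<^sub>M L" "h \<in> M \<rightarrow>\<^sub>M L" "AE x in M. g (f x) = h x"
  shows "distr (distr M N f) L g = distr M L h"
  using assms by (subst distr_distr) (auto intro!: distr_cong_AE)

context
  fixes a b l :: real
  assumes abl: "a > 0" "b > 0" "l > 0"
begin

text \<open>The map \<open>?G\<close> is inverted by \<open>u = 1 - y / (1 - p)\<close>; applied to
  both sides of \<open>beta_product_identity\<close> this isolates an independent pair. Its second
  component is the environment weight of a cell with increments \<open>v\<close> and
  \<open>w\<close>.\<close>

lemma beta_pair_forward:
  "distr (beta_real (l + a) b \<Otimes>\<^sub>M beta_real l a) (borel \<Otimes>\<^sub>M borel) (\<lambda>(v, w). (v * w, (v - v * w) / (1 - v * w)))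
     = beta_real l (a + b) \<Otimes>\<^sub>M beta_real a b" (is "distr ?M _ ?f = ?N")
proof -
  let ?F = "\<lambda>(v, w). (v * w, 1 - v)" and ?G = "\<lambda>(p, u). (p, (1 - u) * (1 - p))"
  let ?g = "\<lambda>(p, y). (p, 1 - y / (1 - p))"
  have pr: "prob_space (beta_real (l + a) b)" "prob_space (beta_real l a)"
    "prob_space (beta_real l (a + b))" "prob_space (beta_real a b)"
    using abl by (auto intro!: prob_space_beta_real)
  have aeM: "AE z in ?M. (0 < fst z \<and> fst z < 1) \<and> (0 < snd z \<and> snd z < 1)"
    using abl by (intro AE_pair_prob pr AE_beta_real) auto
  have aeN: "AE z in ?N. (0 < fst z \<and> fst z < 1) \<and> (0 < snd z \<and> snd z < 1)"
    using abl by (intro AE_pair_prob pr AE_beta_real) auto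
  have sN: "sets ?N = sets (borel \<Otimes>\<^sub>M borel)" by (intro sets_pair_measure_cong) simp_all
  have "distr ?M (borel \<Otimes>\<^sub>M borel) ?f = distr (distr ?M (borel \<Otimes>\<^sub>M borel) ?F) (borel \<Otimes>\<^sub>M borel) ?g"
  proof (rule distr_cong_comp[symmetric])
    show "AE z in ?M. ?g (?F z) = ?f z"
    proof (rule eventually_mono[OF aeM])
      fix z :: "real \<times> real" assume z: "(0 < fst z \<and> fst z < 1) \<and> (0 < snd z \<and> snd z < 1)"
      then have "fst z * snd z < 1 * 1" by (intro mult_strict_mono) auto
      then show "?g (?F z) = ?f z" by (auto simp: split_beta field_simps)
    qed
  qed measurable
  also have "\<dots> = distr (distr ?N (borel \<Otimes>\<^sub>M borel) ?G) (borel \<Otimes>\<^sub>M borel) ?g"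
    unfolding beta_product_identity[OF abl] ..
  also have "\<dots> = distr ?N (borel \<Otimes>\<^sub>M borel) (\<lambda>z. z)"
  proof (rule distr_cong_comp)
    show "AE z in ?N. ?g (?G z) = z"
      by (rule eventually_mono[OF aeN]) (auto simp: split_beta prod_eq_iff)
  qed measurable
  also have "\<dots> = ?N"
    by (rule distr_id2[OF sN[symmetric]])
  finally show ?thesis .
qed

text \<open>Here \<open>?F\<close> is inverted instead, by \<open>v = 1 - y\<close> and
  \<open>w = p / (1 - y)\<close>, where 1 - (1 - u) (1 - p) = u + (1 - u) p. A fresh weight
  \<open>u\<close> thus produces new increments with the old law.\<close>

lemma beta_pair_backward:
  "distr (beta_real l (a + b) \<Otimes>\<^sub>M beta_real a b) (borel \<Otimes>\<^sub>M borel) (\<lambda>(p, u). (u + (1 - u) * p, p / (u + (1 - u) * p)))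
     = beta_real (l + a) b \<Otimes>\<^sub>M beta_real l a" (is "distr ?N _ ?f = ?M")
proof -
  let ?F = "\<lambda>(v, w). (v * w, 1 - v)" and ?G = "\<lambda>(p, u). (p, (1 - u) * (1 - p))"
  let ?g = "\<lambda>(p, y). (1 - y, p / (1 - y))"
  have pr: "prob_space (beta_real (l + a) b)" "prob_space (beta_real l a)"
    using abl by (auto intro!: prob_space_beta_real)
  have aeM: "AE z in ?M. (0 < fst z \<and> fst z < 1) \<and> (0 < snd z \<and> snd z < 1)"
    using abl by (intro AE_pair_prob pr AE_beta_real) auto
  have sM: "sets ?M = sets (borel \<Otimes>\<^sub>M borel)" by (intro sets_pair_measure_cong) simp_all
  have "distr ?N (borel \<Otimes>\<^sub>M borel) ?f = distr (distr ?N (borel \<Otimes>\<^sub>M borel) ?G) (borel \<Otimes>\<^sub>M borel) ?g"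
  proof (rule distr_cong_comp[symmetric])
    have "?g (?G z) = ?f z" for z :: "real \<times> real" by (simp add: split_beta algebra_simps)
    then show "AE z in ?N. ?g (?G z) = ?f z" by (intro AE_I2)
  qed measurable
  also have "\<dots> = distr (distr ?M (borel \<Otimes>\<^sub>M borel) ?F) (borel \<Otimes>\<^sub>M borel) ?g"
    unfolding beta_product_identity[OF abl] ..
  also have "\<dots> = distr ?M (borel \<Otimes>\<^sub>M borel) (\<lambda>z. z)"
  proof (rule distr_cong_comp)
    show "AE z in ?M. ?g (?F z) = z"
      by (rule eventually_mono[OF aeM]) (auto simp: split_beta prod_eq_iff)
  qed measurable
  also have "\<dots> = ?M"
    by (rule distr_id2[OF sM[symmetric]])
  finally show ?thesis .
qed

end

section \<open>Changing two coordinates of an infinite product measure\<close>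

text \<open>Independence of two coordinates from the rest, checked on finite cylinders. The padded
  sets \<open>A'\<close> are everything outside \<open>J\<close>, so \<open>i\<close> and
  \<open>j\<close> may be adjoined to any finite index set without changing the product.\<close>

lemma distr_pair_update_PiM:
  fixes M :: "'i \<Rightarrow> real measure"
  assumes M: "\<And>i. prob_space (M i)" "\<And>i. sets (M i) = sets borel" and ij: "i \<noteq> j"
  shows "distr ((M i \<Otimes>\<^sub>M M j) \<Otimes>\<^sub>M PiM (- {i, j}) M) (PiM UNIV (\<lambda>_. borel)) (\<lambda>(z, X). X(j := snd z, i := fst z))
    = PiM UNIV M" (is "distr ?P _ ?u = _")
proof -
  interpret product_prob_space M UNIV
    using M(1) by (auto simp: product_prob_space_def product_prob_space_axioms_def product_sigma_finite_def
        intro: prob_space_imp_sigma_finite)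
  have sP: "sets (PiM UNIV (\<lambda>_. borel)) = sets (PiM UNIV M)"
    by (intro sets_PiM_cong refl M(2)[symmetric])
  interpret Mi: prob_space "M i" by (rule M)
  interpret Mj: prob_space "M j" by (rule M)
  interpret R: prob_space "PiM (- {i, j}) M" by (intro prob_space_PiM M)
  interpret Mij: pair_prob_space "M i" "M j" ..
  have u: "?u \<in> ?P \<rightarrow>\<^sub>M PiM UNIV M"
  proof (rule measurable_PiM_single')
    fix k :: 'i
    show "(\<lambda>z. ?u z k) \<in> ?P \<rightarrow>\<^sub>M M k"
    proof -
      consider "k = i" | "k = j" | "k \<in> - {i, j}" by auto
      then show ?thesis
        by cases (auto simp: split_beta ij ij[symmetric] intro!: measurable_compose[OF measurable_snd])
    qed
  qed (use M(2)[THEN sets_eq_imp_space_eq] in auto)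
  then have u' [measurable]: "?u \<in> ?P \<rightarrow>\<^sub>M PiM UNIV (\<lambda>_. borel)"
    by (simp add: measurable_cong_sets[OF refl sP])
  show ?thesis
  proof (rule PiM_eq)
    fix J and A :: "'i \<Rightarrow> real set"
    assume J: "finite J" "J \<subseteq> UNIV" and A: "\<And>j. j \<in> J \<Longrightarrow> A j \<in> sets (M j)"
    define A' where "A' k = (if k \<in> J then A k else UNIV)" for k
    have A'[measurable]: "A' k \<in> sets (M k)" for k
      using A M(2)[THEN sets_eq_imp_space_eq, of k] by (auto simp: A'_def M(2))
    define J' where "J' = J - {i, j}"
    have spR: "space (PiM (- {i, j}) M) = extensional (- {i, j})"
      using M(2)[THEN sets_eq_imp_space_eq] by (simp add: space_PiM PiE_def)
    have "?u -` (prod_emb UNIV M J (Pi\<^sub>E J A)) \<inter> space ?P = (A' i \<times> A' j) \<times> prod_emb (- {i, j}) M J' (Pi\<^sub>E J' A)"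
      using ij M(2)[THEN sets_eq_imp_space_eq]
      by (auto simp: prod_emb_def A'_def J'_def space_pair_measure space_PiM PiE_iff Ball_def split: if_splits)
    then have "emeasure (distr ?P (PiM UNIV (\<lambda>_. borel)) ?u) (prod_emb UNIV M J (Pi\<^sub>E J A))
        = emeasure ?P ((A' i \<times> A' j) \<times> prod_emb (- {i, j}) M J' (Pi\<^sub>E J' A))"
      using J A sP by (subst emeasure_distr) (auto intro!: sets_PiM_I)
    also have "\<dots> = (emeasure (M i) (A' i) * emeasure (M j) (A' j)) * emeasure (PiM (- {i, j}) M) (prod_emb (- {i, j}) M J' (Pi\<^sub>E J' A))"
      using J A by (subst R.emeasure_pair_measure_Times)
        (auto simp: M.emeasure_pair_measure_Times J'_def intro!: sets_PiM_I)
    also have "emeasure (PiM (- {i, j}) M) (prod_emb (- {i, j}) M J' (Pi\<^sub>E J' A)) = (\<Prod>k\<in>J'. emeasure (M k) (A k))"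
      using J A by (intro Infinite_Product_Measure.emeasure_PiM_emb M) (auto simp: J'_def)
    also have "(\<Prod>k\<in>J'. emeasure (M k) (A k)) = (\<Prod>k\<in>J'. emeasure (M k) (A' k))"
      by (intro prod.cong) (auto simp: A'_def J'_def)
    also have "emeasure (M i) (A' i) * emeasure (M j) (A' j) * (\<Prod>k\<in>J'. emeasure (M k) (A' k))
        = (\<Prod>k\<in>insert i (insert j J'). emeasure (M k) (A' k))"
      using ij J by (simp add: J'_def mult.assoc)
    also have "insert i (insert j J') = J \<union> {i, j}" by (auto simp: J'_def)
    also have "(\<Prod>k\<in>J \<union> {i, j}. emeasure (M k) (A' k)) = (\<Prod>k\<in>J. emeasure (M k) (A' k))"
      using J M(1)[THEN prob_space.emeasure_space_1] M(2)[THEN sets_eq_imp_space_eq]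
      by (intro prod.mono_neutral_right) (auto simp: A'_def)
    also have "\<dots> = (\<Prod>k\<in>J. emeasure (M k) (A k))"
      by (intro prod.cong) (auto simp: A'_def)
    finally show "emeasure (distr ?P (PiM UNIV (\<lambda>_. borel)) ?u) (prod_emb UNIV M J (Pi\<^sub>E J A)) = (\<Prod>k\<in>J. emeasure (M k) (A k))" .
  qed (simp add: sP)
qed

text \<open>Lifts an identity in law for two coordinates to the whole product: split off the pair,
  transform it, reassemble. The flips of single cells are built from such maps.\<close>

lemma distr_PiM_update2:
  fixes M M' :: "'i \<Rightarrow> real measure" and F :: "real \<times> real \<Rightarrow> real \<times> real"
  assumes M: "\<And>i. prob_space (M i)" "\<And>i. sets (M i) = sets borel"
    and M': "\<And>i. prob_space (M' i)" "\<And>i. sets (M' i) = sets borel"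
    and ij: "i \<noteq> j" and eq: "\<And>k. k \<noteq> i \<Longrightarrow> k \<noteq> j \<Longrightarrow> M' k = M k"
    and F [measurable]: "F \<in> borel \<Otimes>\<^sub>M borel \<rightarrow>\<^sub>M borel \<Otimes>\<^sub>M borel"
    and dF: "distr (M i \<Otimes>\<^sub>M M j) (borel \<Otimes>\<^sub>M borel) F = M' i \<Otimes>\<^sub>M M' j"
  shows "distr (PiM UNIV M) (PiM UNIV (\<lambda>_. borel)) (\<lambda>\<eta>. \<eta>(j := snd (F (\<eta> i, \<eta> j)), i := fst (F (\<eta> i, \<eta> j))))
    = PiM UNIV M'" (is "distr _ _ ?\<phi> = _")
proof -
  let ?R = "PiM (- {i, j}) M" and ?B = "PiM UNIV (\<lambda>_. borel) :: ('i \<Rightarrow> real) measure"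
  let ?u = "\<lambda>(z, X). X(j := snd z, i := fst z) :: 'i \<Rightarrow> real"
  interpret R: prob_space ?R by (intro prob_space_PiM M)
  have sij: "sets (M i \<Otimes>\<^sub>M M j) = sets (borel \<Otimes>\<^sub>M borel)" by (intro sets_pair_measure_cong M)
  have Fm: "F \<in> M i \<Otimes>\<^sub>M M j \<rightarrow>\<^sub>M borel \<Otimes>\<^sub>M borel"
    using F by (simp add: measurable_cong_sets[OF sij refl])
  have sR: "sets ?R = sets (PiM (- {i, j}) (\<lambda>_. borel))" by (intro sets_PiM_cong refl M)
  have u: "?u \<in> (borel \<Otimes>\<^sub>M borel) \<Otimes>\<^sub>M PiM (- {i, j}) (\<lambda>_. borel) \<rightarrow>\<^sub>M ?B"
  proof (rule measurable_PiM_single')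
    fix k :: 'i
    show "(\<lambda>z. ?u z k) \<in> (borel \<Otimes>\<^sub>M borel) \<Otimes>\<^sub>M PiM (- {i, j}) (\<lambda>_. borel) \<rightarrow>\<^sub>M borel"
    proof -
      consider "k = i" | "k = j" | "k \<in> - {i, j}" by auto
      then show ?thesis
        by cases (auto simp: split_beta ij ij[symmetric] intro!: measurable_compose[OF measurable_snd])
    qed
  qed auto
  have R': "PiM (- {i, j}) M' = ?R" by (intro PiM_cong) (auto simp: eq)
  have \<phi>: "?\<phi> \<in> ?B \<rightarrow>\<^sub>M ?B"
    by (rule measurable_PiM_single') (auto simp: fun_upd_def)
  have sP: "sets ((M i \<Otimes>\<^sub>M M j) \<Otimes>\<^sub>M ?R) = sets ((borel \<Otimes>\<^sub>M borel) \<Otimes>\<^sub>M PiM (- {i, j}) (\<lambda>_. borel))"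
    by (intro sets_pair_measure_cong sij sR)
  have "distr (PiM UNIV M) ?B ?\<phi> = distr (distr ((M i \<Otimes>\<^sub>M M j) \<Otimes>\<^sub>M ?R) ?B ?u) ?B ?\<phi>"
    by (subst distr_pair_update_PiM[OF M ij]) (rule refl)
  also have "\<dots> = distr ((M i \<Otimes>\<^sub>M M j) \<Otimes>\<^sub>M ?R) ?B (\<lambda>x. ?u ((\<lambda>(z, X). (F z, X)) x))"
    by (subst distr_distr[OF \<phi>]) (use u ij in \<open>auto simp: measurable_cong_sets[OF sP refl] o_def split_beta intro!: distr_cong\<close>)
  also have "\<dots> = distr (distr ((M i \<Otimes>\<^sub>M M j) \<Otimes>\<^sub>M ?R) ((borel \<Otimes>\<^sub>M borel) \<Otimes>\<^sub>M ?R) (\<lambda>(z, X). (F z, X))) ?B ?u"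
  proof (subst distr_distr)
    show "?u \<in> (borel \<Otimes>\<^sub>M borel) \<Otimes>\<^sub>M ?R \<rightarrow>\<^sub>M ?B"
      using u by (simp add: measurable_cong_sets[OF sets_pair_measure_cong[OF refl sR] refl])
  qed (use Fm in \<open>auto simp: o_def\<close>)
  also have "distr ((M i \<Otimes>\<^sub>M M j) \<Otimes>\<^sub>M ?R) ((borel \<Otimes>\<^sub>M borel) \<Otimes>\<^sub>M ?R) (\<lambda>(z, X). (F z, X))
      = distr (M i \<Otimes>\<^sub>M M j) (borel \<Otimes>\<^sub>M borel) F \<Otimes>\<^sub>M distr ?R ?R (\<lambda>X. X)"
    using Fm by (intro pair_measure_distr[symmetric])
      (auto simp: distr_id2 intro: R.sigma_finite_measure_axioms)
  also have "\<dots> = (M' i \<Otimes>\<^sub>M M' j) \<Otimes>\<^sub>M PiM (- {i, j}) M'"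
    unfolding dF R' by (simp add: distr_id2)
  also have "distr \<dots> ?B ?u = PiM UNIV M'"
    by (rule distr_pair_update_PiM[OF M' ij])
  finally show ?thesis .
qed

subsection \<open>Hitting probabilities and planarity\<close>

text \<open>\<open>hit w i j a b\<close> is the probability that the walk in environment \<open>w\<close> started at \<open>(a, b)\<close> visits \<open>(a + i, b + j)\<close>.\<close>

fun hit :: "(nat \<times> nat \<Rightarrow> real) \<Rightarrow> nat \<Rightarrow> nat \<Rightarrow> nat \<Rightarrow> nat \<Rightarrow> real" where
  "hit w 0 0 a b = 1"
| "hit w (Suc i) 0 a b = w (a, b) * hit w i 0 (Suc a) b"
| "hit w 0 (Suc j) a b = (1 - w (a, b)) * hit w 0 j a (Suc b)"
| "hit w (Suc i) (Suc j) a b = w (a, b) * hit w i (Suc j) (Suc a) b + (1 - w (a, b)) * hit w (Suc i) j a (Suc b)"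

lemma hit_pos:
  assumes "\<And>x. 0 < w x \<and> w x < 1"
  shows "0 < hit w i j a b"
proof -
  have "0 < hit v i j a b" if "v = w" for v
    using that by (induction v i j a b rule: hit.induct) (use assms in \<open>auto intro!: add_pos_pos mult_pos_pos\<close>)
  then show ?thesis by blast
qed

lemma hit_transpose: "hit (\<lambda>(a, b). 1 - w (b, a)) j i b a = hit w i j a b"
  by (induction w i j a b rule: hit.induct) auto

definition harmonic :: "(nat \<times> nat \<Rightarrow> real) \<Rightarrow> (nat \<Rightarrow> nat \<Rightarrow> real) \<Rightarrow> bool" where
  "harmonic w H \<longleftrightarrow> (\<forall>a b. H a b = w (a, b) * H (Suc a) b + (1 - w (a, b)) * H a (Suc b))"

lemma harmonic_transpose:
  assumes "harmonic w H"
  shows "harmonic (\<lambda>(a, b). 1 - w (b, a)) (\<lambda>a b. H b a)"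
  unfolding harmonic_def
proof (intro allI)
  fix a b
  show "H b a = (case (a, b) of (a, b) \<Rightarrow> 1 - w (b, a)) * H b (Suc a)
      + (1 - (case (a, b) of (a, b) \<Rightarrow> 1 - w (b, a))) * H (Suc b) a"
    using assms[unfolded harmonic_def, rule_format, of b a] by simp
qed

text \<open>This is the only place where the planarity of the walk enters.\<close>

lemma antidiagonal_ratio_mono:
  fixes g h r :: "nat \<Rightarrow> nat \<Rightarrow> real"
  assumes r: "\<And>k l. 0 < r k l \<and> r k l < 1"
    and h: "\<And>k l. k < K \<Longrightarrow> l < L \<Longrightarrow> h (Suc k) (Suc l) = r k l * h k (Suc l) + (1 - r k l) * h (Suc k) l"
    and g: "\<And>k l. k < K \<Longrightarrow> l < L \<Longrightarrow> g (Suc k) (Suc l) = r k l * g k (Suc l) + (1 - r k l) * g (Suc k) l"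
    and hpos: "\<And>k l. 0 < h k l" and gnn: "\<And>k l. k \<le> K \<Longrightarrow> l \<le> L \<Longrightarrow> 0 \<le> g k l"
    and col: "\<And>l. l \<le> L \<Longrightarrow> g 0 l = 0"
    and row: "\<And>k. k < K \<Longrightarrow> h (Suc k) 0 * g k 0 \<le> g (Suc k) 0 * h k 0"
  shows "k < K \<Longrightarrow> l < L \<Longrightarrow> h (Suc k) l * g k (Suc l) \<le> g (Suc k) l * h k (Suc l)"
proof (induction "k + l" arbitrary: k l rule: less_induct)
  case less
  \<comment> \<open>Expanding both values in row \<open>Suc l'\<close> by harmonicity, the terms
    with factor \<open>r k l'\<close> cancel. What is left is the claim on an earlier antidiagonal,
    times \<open>1 - r k l'\<close>. The vertical inequality \<open>ver\<close> arises in the same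
    way.\<close>
  have hor: "h (Suc k) l * g k l \<le> g (Suc k) l * h k l"
  proof (cases l)
    case 0
    then show ?thesis using row less.prems by simp
  next
    case (Suc l')
    have "h (Suc k) l' * g k (Suc l') \<le> g (Suc k) l' * h k (Suc l')"
      using less Suc by simp
    then have "(1 - r k l') * (h (Suc k) l' * g k (Suc l')) \<le> (1 - r k l') * (g (Suc k) l' * h k (Suc l'))"
      using r[of k l'] by (intro mult_left_mono) auto
    then show ?thesis
      using less.prems Suc by (simp add: h g algebra_simps)
  qed
  have ver: "g k (Suc l) * h k l \<le> h k (Suc l) * g k l"
  proof (cases k)
    case 0
    then show ?thesis using col less.prems hpos[of 0 "Suc l"] gnn[of 0 l] by simp
  next
    case (Suc k')
    have "h (Suc k') l * g k' (Suc l) \<le> g (Suc k') l * h k' (Suc l)"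
      using less Suc by simp
    then have "r k' l * (h (Suc k') l * g k' (Suc l)) \<le> r k' l * (g (Suc k') l * h k' (Suc l))"
      using r[of k' l] by (intro mult_left_mono) auto
    then show ?thesis
      using less.prems Suc by (simp add: h g algebra_simps)
  qed
  have nn: "0 \<le> g k l" "0 \<le> g k (Suc l)" "0 \<le> g (Suc k) l"
    using less.prems gnn by auto
  \<comment> \<open>Multiply \<open>hor\<close> and \<open>ver\<close> and cancel
    \<open>g k l * h k l\<close>. If \<open>g k l\<close> vanishes, \<open>ver\<close> forces
    \<open>g k (Suc l)\<close> to vanish too.\<close>
  show ?case
  proof (cases "g k l = 0")
    case True
    then have "g k (Suc l) = 0"
      using ver nn hpos[of k l] by (simp add: mult_le_0_iff)
    then show ?thesis using nn hpos[of k "Suc l"] by simp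
  next
    case False
    then have p: "0 < g k l * h k l" using nn hpos[of k l] by simp
    have "(h (Suc k) l * g k l) * (g k (Suc l) * h k l) \<le> (g (Suc k) l * h k l) * (h k (Suc l) * g k l)"
      by (rule mult_mono[OF hor ver]) (use nn hpos[of k l] in auto)
    then have "(h (Suc k) l * g k (Suc l)) * (g k l * h k l) \<le> (g (Suc k) l * h k (Suc l)) * (g k l * h k l)"
      by (simp add: mult_ac)
    then show ?thesis using p by (rule mult_right_le_imp_le)
  qed
qed

text \<open>
  The part of a harmonic function carried by the walks that leave the box with upper right corner \<open>(Z, Z')\<close> through its right
  side, in coordinates measured from that corner.
\<close>

fun exit_right :: "(nat \<times> nat \<Rightarrow> real) \<Rightarrow> (nat \<Rightarrow> nat \<Rightarrow> real) \<Rightarrow> nat \<Rightarrow> nat \<Rightarrow> nat \<Rightarrow> nat \<Rightarrow> real" where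
  "exit_right w H Z Z' 0 l = H Z (Z' - l)"
| "exit_right w H Z Z' (Suc k) 0 = 0"
| "exit_right w H Z Z' (Suc k) (Suc l) = w (Z - Suc k, Z' - Suc l) * exit_right w H Z Z' k (Suc l)
     + (1 - w (Z - Suc k, Z' - Suc l)) * exit_right w H Z Z' (Suc k) l"

section \<open>Comparing a positive harmonic function with hitting probabilities\<close>

locale positive_harmonic =
  fixes w :: "nat \<times> nat \<Rightarrow> real" and H :: "nat \<Rightarrow> nat \<Rightarrow> real"
  assumes w: "\<And>x. 0 < w x \<and> w x < 1" and harm: "harmonic w H" and pos: "\<And>a b. 0 < H a b"
begin

lemma H_eq: "H a b = w (a, b) * H (Suc a) b + (1 - w (a, b)) * H a (Suc b)"
  using harm unfolding harmonic_def by blast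

lemma w_pos: "0 < w x" and w_lt_1: "w x < 1"
  using w by auto

text \<open>The value of \<open>H\<close> along the walk is a martingale, and the walks through
  \<open>(a + i, b + j)\<close> carry only part of \<open>H a b\<close>. This is how a harmonic
  function bounds hitting probabilities from above.\<close>

lemma hit_le: "hit w i j a b * H (a + i) (b + j) \<le> H a b"
proof -
  have le1: "w (a, b) * H (Suc a) b \<le> H a b" and le2: "(1 - w (a, b)) * H a (Suc b) \<le> H a b" for a b
    using H_eq[of a b] w_pos[of "(a, b)"] w_lt_1[of "(a, b)"] pos[of "Suc a" b] pos[of a "Suc b"]
    by (auto intro!: mult_nonneg_nonneg less_imp_le)
  have "hit v i j a b * H (a + i) (b + j) \<le> H a b" if "v = w" for v
    using that
  proof (induction v i j a b rule: hit.induct)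
    case (2 v i a b)
    have "hit v (Suc i) 0 a b * H (a + Suc i) (b + 0) = w (a, b) * (hit w i 0 (Suc a) b * H (Suc a + i) (b + 0))"
      using 2 by simp
    also have "\<dots> \<le> w (a, b) * H (Suc a) b"
      using 2 w_pos[of "(a, b)"] by (intro mult_left_mono) auto
    finally show ?case using le1[of a b] by simp
  next
    case (3 v j a b)
    have "hit v 0 (Suc j) a b * H (a + 0) (b + Suc j) = (1 - w (a, b)) * (hit w 0 j a (Suc b) * H (a + 0) (Suc b + j))"
      using 3 by simp
    also have "\<dots> \<le> (1 - w (a, b)) * H a (Suc b)"
      using 3 w_lt_1[of "(a, b)"] by (intro mult_left_mono) auto
    finally show ?case using le2[of a b] by simp
  next
    case (4 v i j a b)
    have "hit v (Suc i) (Suc j) a b * H (a + Suc i) (b + Suc j)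
        = w (a, b) * (hit w i (Suc j) (Suc a) b * H (Suc a + i) (b + Suc j))
          + (1 - w (a, b)) * (hit w (Suc i) j a (Suc b) * H (a + Suc i) (Suc b + j))"
      using 4 by (simp add: algebra_simps)
    also have "\<dots> \<le> w (a, b) * H (Suc a) b + (1 - w (a, b)) * H a (Suc b)"
      using 4 w_pos[of "(a, b)"] w_lt_1[of "(a, b)"] by (intro add_mono mult_left_mono) auto
    finally show ?case using H_eq[of a b] by simp
  qed simp
  then show ?thesis by blast
qed

lemma exit_right_nonneg: "0 \<le> exit_right w H Z Z' k l"
proof -
  have "0 \<le> exit_right v G Z Z' k l" if "v = w" "G = H" for v G
    using that
    by (induction v G Z Z' k l rule: exit_right.induct)
      (auto simp: pos less_imp_le w_pos w_lt_1 intro!: add_nonneg_nonneg mult_nonneg_nonneg)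
  then show ?thesis by blast
qed

lemma exit_right_le: "k \<le> Z \<Longrightarrow> l \<le> Z' \<Longrightarrow> exit_right w H Z Z' k l \<le> H (Z - k) (Z' - l)"
proof -
  have "k \<le> Z \<Longrightarrow> l \<le> Z' \<Longrightarrow> exit_right v G Z Z' k l \<le> H (Z - k) (Z' - l)" if "v = w" "G = H" for v G
    using that
  proof (induction v G Z Z' k l rule: exit_right.induct)
    case (3 v G Z Z' k l)
    let ?x = "(Z - Suc k, Z' - Suc l)"
    have "exit_right v G Z Z' (Suc k) (Suc l) \<le> w ?x * H (Z - k) (Z' - Suc l) + (1 - w ?x) * H (Z - Suc k) (Z' - l)"
      using 3 w_pos[of ?x] w_lt_1[of ?x] by (auto intro!: add_mono mult_left_mono)
    also have "\<dots> = H (Z - Suc k) (Z' - Suc l)"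
      using H_eq[of "Z - Suc k" "Z' - Suc l"] 3 by (simp add: Suc_diff_Suc)
    finally show ?case .
  qed (simp_all add: pos less_imp_le)
  then show "k \<le> Z \<Longrightarrow> l \<le> Z' \<Longrightarrow> exit_right w H Z Z' k l \<le> H (Z - k) (Z' - l)" by blast
qed

text \<open>A union bound over the points of the right side: every visited point is counted, not
  only the first. The sum stops short of the corner, \<open>y = l\<close>, which is why the start
  must differ from the corner.\<close>

lemma exit_right_le_hit:
  assumes "k \<le> Z" "l \<le> Z'" "k + l > 0"
  shows "exit_right w H Z Z' k l \<le> (\<Sum>y<l. hit w k y (Z - k) (Z' - l) * H Z (Z' - l + y))"
proof -
  have "exit_right v G Z Z' k l \<le> (\<Sum>y<l. hit w k y (Z - k) (Z' - l) * H Z (Z' - l + y))"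
    if "v = w" "G = H" "k \<le> Z" "l \<le> Z'" "k + l > 0" for v G
    using that
  proof (induction v G Z Z' k l rule: exit_right.induct)
    case (1 v G Z Z' l)
    then have l: "l > 0" by simp
    have "H Z (Z' - l) = (\<Sum>y\<in>{0}. hit w 0 y Z (Z' - l) * H Z (Z' - l + y))" by simp
    also have "\<dots> \<le> (\<Sum>y<l. hit w 0 y Z (Z' - l) * H Z (Z' - l + y))"
      using l by (intro sum_mono2) (auto intro!: mult_nonneg_nonneg less_imp_le[OF pos] less_imp_le[OF hit_pos] w)
    finally show ?case using 1 by simp
  next
    case (3 v G Z Z' k l)
    let ?x = "(Z - Suc k, Z' - Suc l)"
    have IH1: "exit_right w H Z Z' k (Suc l) \<le> (\<Sum>y<Suc l. hit w k y (Z - k) (Z' - Suc l) * H Z (Z' - Suc l + y))"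
      using 3 by simp
    have IH2: "exit_right w H Z Z' (Suc k) l \<le> (\<Sum>y<l. hit w (Suc k) y (Z - Suc k) (Z' - l) * H Z (Z' - l + y))"
      using 3 by simp
    have S: "Suc (Z - Suc k) = Z - k" "Suc (Z' - Suc l) = Z' - l" using 3 by auto
    have "(\<Sum>y<Suc l. hit w (Suc k) y (Z - Suc k) (Z' - Suc l) * H Z (Z' - Suc l + y))
        = w ?x * (\<Sum>y<Suc l. hit w k y (Z - k) (Z' - Suc l) * H Z (Z' - Suc l + y))
          + (1 - w ?x) * (\<Sum>y<l. hit w (Suc k) y (Z - Suc k) (Z' - l) * H Z (Z' - l + y))"
      unfolding sum.lessThan_Suc_shift
      by (simp add: S sum_distrib_left sum.distrib[symmetric] distrib_left)
        (intro sum.cong refl, simp add: S[symmetric] algebra_simps)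
    moreover have "exit_right v G Z Z' (Suc k) (Suc l)
        \<le> w ?x * (\<Sum>y<Suc l. hit w k y (Z - k) (Z' - Suc l) * H Z (Z' - Suc l + y))
          + (1 - w ?x) * (\<Sum>y<l. hit w (Suc k) y (Z - Suc k) (Z' - l) * H Z (Z' - l + y))"
      using 3(3,4) w_pos[of ?x] w_lt_1[of ?x]
      by (simp del: sum.lessThan_Suc) (intro add_mono mult_left_mono IH1 IH2; simp)
    ultimately show ?case by simp
  qed simp
  then show ?thesis using assms by blast
qed

text \<open>The part \<open>?g\<close> of \<open>H\<close> that leaves through the top vanishes on
  the right side, so it is less inclined to the right than the walk conditioned to hit the corner.
  The quantity \<open>\<rho>\<close> bounds the discarded part.\<close>

lemma hit_ratio_lower:
  fixes m n :: nat
  defines "\<rho> \<equiv> (\<Sum>y<Suc n. hit w (Suc m) y 0 0 * H (Suc m) y)"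
  shows "H 1 0 / H 0 0 - \<rho> / (w (0, 0) * H 0 0) \<le> hit w m (Suc n) 1 0 / hit w (Suc m) (Suc n) 0 0"
proof -
  let ?Z = "Suc m" and ?Z' = "Suc n"
  let ?h = "\<lambda>k l. hit w k l (?Z - k) (?Z' - l)"
  let ?e = "exit_right w H ?Z ?Z'"
  let ?g = "\<lambda>k l. H (?Z - k) (?Z' - l) - ?e k l"
  let ?r = "\<lambda>k l. w (?Z - Suc k, ?Z' - Suc l)"
  have "?h (Suc m) n * ?g m (Suc n) \<le> ?g (Suc m) n * ?h m (Suc n)"
  proof (rule antidiagonal_ratio_mono[where r = ?r and K = ?Z and L = ?Z'])
    show "0 < ?r k l \<and> ?r k l < 1" for k l using w by blast
    show "?h (Suc k) (Suc l) = ?r k l * ?h k (Suc l) + (1 - ?r k l) * ?h (Suc k) l" if "k < ?Z" "l < ?Z'" for k l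
      using that by (simp add: Suc_diff_le)
    show "?g (Suc k) (Suc l) = ?r k l * ?g k (Suc l) + (1 - ?r k l) * ?g (Suc k) l" if "k < ?Z" "l < ?Z'" for k l
      using that H_eq[of "m - k" "n - l"] by (simp add: Suc_diff_le algebra_simps)
    show "0 < ?h k l" for k l by (rule hit_pos[OF w])
    show "0 \<le> ?g k l" if "k \<le> ?Z" "l \<le> ?Z'" for k l using exit_right_le[OF that] by simp
    show "?g 0 l = 0" for l by simp
    \<comment> \<open>On the top row the corner is reached by horizontal steps only, so
      \<open>?h (Suc k) 0\<close> is one weight times \<open>?h k 0\<close>, and that weight times
      \<open>H\<close> at the right neighbour is at most \<open>H\<close>. At the corner itself
      \<open>?g\<close> is 0.\<close>
    show "?h (Suc k) 0 * ?g k 0 \<le> ?g (Suc k) 0 * ?h k 0" if "k < ?Z" for k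
    proof (cases k)
      case 0
      then show ?thesis by (simp add: pos less_imp_le)
    next
      case (Suc k')
      have "w (m - k, ?Z') * H (Suc m - k) ?Z' \<le> H (m - k) ?Z'"
        using H_eq[of "m - k" ?Z'] that w_lt_1[of "(m - k, ?Z')"] pos[of "m - k" "Suc ?Z'"]
        by (simp add: Suc_diff_le)
      then have "hit w k 0 (Suc m - k) ?Z' * (w (m - k, ?Z') * H (Suc m - k) ?Z')
          \<le> hit w k 0 (Suc m - k) ?Z' * H (m - k) ?Z'"
        using hit_pos[of w k 0 "Suc m - k" ?Z', OF w] by (intro mult_left_mono) auto
      then show ?thesis
        using that Suc Suc_diff_Suc[of k' m] by (simp add: Suc_diff_le mult_ac)
    qed
  qed simp_all
  then have c: "hit w (Suc m) n 0 1 * (H 1 0 - ?e m (Suc n)) \<le> (H 0 1 - ?e (Suc m) n) * hit w m (Suc n) 1 0"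
    by simp
  define h0 h1 h2 where "h0 = hit w (Suc m) (Suc n) 0 0" and "h1 = hit w m (Suc n) 1 0" and "h2 = hit w (Suc m) n 0 1"
  have hp: "h0 > 0" "h1 > 0" "h2 > 0" unfolding h0_def h1_def h2_def by (intro hit_pos[OF w])+
  define p where "p = w (0, 0)"
  have p: "0 < p" "p < 1" using w[of "(0, 0)"] by (auto simp: p_def)
  have h0: "h0 = p * h1 + (1 - p) * h2" by (simp add: h0_def h1_def h2_def p_def)
  have H0: "H 0 0 = p * H 1 0 + (1 - p) * H 0 1" using H_eq[of 0 0] by (simp add: p_def)
  \<comment> \<open>\<open>E\<close> is the discarded mass seen from \<open>(1, 0)\<close>. A first
    step to the right has probability \<open>p\<close>, so \<open>p * E\<close> is at most the
    discarded mass seen from the origin.\<close>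
  define E where "E = ?e m (Suc n)"
  have E0: "E \<ge> 0" unfolding E_def by (rule exit_right_nonneg)
  have "p * E \<le> ?e (Suc m) (Suc n)"
    using exit_right_nonneg[of ?Z ?Z' "Suc m" n] p by (simp add: E_def p_def)
  also have "\<dots> \<le> \<rho>"
    using exit_right_le_hit[of ?Z ?Z ?Z' ?Z'] by (simp add: \<rho>_def)
  finally have E: "p * E \<le> \<rho>" .
  have "- (h2 * E) \<le> H 0 1 * h1 - h2 * H 1 0"
    using c exit_right_nonneg[of ?Z ?Z' "Suc m" n] hp
    unfolding h1_def[symmetric] h2_def[symmetric] E_def[symmetric]
    by (simp add: algebra_simps) (smt (verit) mult_nonneg_nonneg)
  then have "(1 - p) * (- (h2 * E)) \<le> (1 - p) * (H 0 1 * h1 - h2 * H 1 0)"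
    using p by (intro mult_left_mono) auto
  also have "\<dots> = h1 * H 0 0 - h0 * H 1 0"
    unfolding h0 H0 by (simp add: algebra_simps)
  finally have 1: "h0 * H 1 0 - (1 - p) * h2 * E \<le> h1 * H 0 0" by simp
  have "(1 - p) * h2 * E \<le> h0 * E"
    using h0 hp p E0 by (intro mult_right_mono) auto
  also have "\<dots> \<le> h0 * (\<rho> / p)"
    using E p hp by (intro mult_left_mono) (auto simp: field_simps)
  finally have "h0 * (H 1 0 - \<rho> / p) \<le> h1 * H 0 0" using 1 by (simp add: algebra_simps)
  then have "(H 1 0 - \<rho> / p) / H 0 0 \<le> h1 / h0"
    using hp pos[of 0 0] by (simp add: field_simps)
  then show ?thesis
    unfolding h0_def[symmetric] h1_def[symmetric] p_def[symmetric]
    by (simp add: diff_divide_distrib)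
qed


text \<open>Exchanging the axes turns the lower bound into one for the vertical ratio, with the top
  side in place of the right side. Since the weighted horizontal and vertical ratios add up to 1,
  for \<open>H\<close> and for the hitting probability alike, this bounds the horizontal ratio from
  above.\<close>

lemma hit_ratio_upper:
  fixes m n :: nat
  defines "\<rho> \<equiv> (\<Sum>x<Suc m. hit w x (Suc n) 0 0 * H x (Suc n))"
  shows "hit w m (Suc n) 1 0 / hit w (Suc m) (Suc n) 0 0 \<le> H 1 0 / H 0 0 + \<rho> / (w (0, 0) * H 0 0)"
proof -
  let ?w = "\<lambda>(a, b). 1 - w (b, a)"
  interpret T: positive_harmonic ?w "\<lambda>a b. H b a"
    using w pos by unfold_locales (auto intro: harmonic_transpose[OF harm])
  define p where "p = w (0, 0)"
  have p: "0 < p" "p < 1" using w[of "(0, 0)"] by (auto simp: p_def)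
  define h0 h1 h2 where "h0 = hit w (Suc m) (Suc n) 0 0" and "h1 = hit w m (Suc n) 1 0" and "h2 = hit w (Suc m) n 0 1"
  have hp: "h0 > 0" unfolding h0_def by (rule hit_pos[OF w])
  have h0: "h0 = p * h1 + (1 - p) * h2" by (simp add: h0_def h1_def h2_def p_def)
  have H0: "H 0 0 = p * H 1 0 + (1 - p) * H 0 1" using H_eq[of 0 0] by (simp add: p_def)
  have "H 0 1 / H 0 0 - \<rho> / ((1 - p) * H 0 0) \<le> h2 / h0"
    using T.hit_ratio_lower[of n m] unfolding hit_transpose
    by (simp add: \<rho>_def p_def h0_def h2_def del: hit.simps sum.lessThan_Suc)
  then have "(1 - p) * (H 0 1 / H 0 0 - \<rho> / ((1 - p) * H 0 0)) \<le> (1 - p) * (h2 / h0)"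
    using p by (intro mult_left_mono) auto
  also have "(1 - p) * (h2 / h0) = 1 - p * (h1 / h0)"
    using h0 hp by (simp add: field_simps)
  also have "(1 - p) * (H 0 1 / H 0 0 - \<rho> / ((1 - p) * H 0 0)) = (1 - p) * (H 0 1 / H 0 0) - \<rho> / H 0 0"
    using p by (simp add: right_diff_distrib)
  also have "(1 - p) * (H 0 1 / H 0 0) = 1 - p * (H 1 0 / H 0 0)"
    using H0 pos[of 0 0] by (simp add: field_simps)
  finally have "p * (h1 / h0) \<le> p * (H 1 0 / H 0 0 + \<rho> / (p * H 0 0))"
    using p by (simp add: field_simps)
  then have "h1 / h0 \<le> H 1 0 / H 0 0 + \<rho> / (p * H 0 0)"
    using p(1) by (simp only: mult_le_cancel_left_pos)
  then show ?thesis
    by (simp only: h0_def h1_def p_def)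
qed

end

subsection \<open>Stationary harmonic functions on a quadrant\<close>

text \<open>One index type for all sources of randomness, so that passing a cell is a map of a
  single product space into itself.\<close>

datatype slot = Bottom nat | Left nat | Cell nat nat

text \<open>
  \<open>increment \<eta> True i j\<close> stands for \<open>H (i, j) / H (i + 1, j)\<close> and \<open>increment \<eta> False i j\<close> for \<open>H (i, j + 1) / H (i, j)\<close>.
  The bottom and left axes carry boundary data, and the cells carry the auxiliary weights that produce \<open>dual_env\<close>.
\<close>

function increment :: "(slot \<Rightarrow> real) \<Rightarrow> bool \<Rightarrow> nat \<Rightarrow> nat \<Rightarrow> real" where
  "increment \<eta> True i 0 = \<eta> (Bottom i)"
| "increment \<eta> False 0 j = \<eta> (Left j)"
| "increment \<eta> True i (Suc j) = \<eta> (Cell i j) + (1 - \<eta> (Cell i j)) * (increment \<eta> True i j * increment \<eta> False i j)"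
| "increment \<eta> False (Suc i) j = increment \<eta> True i j * increment \<eta> False i j
     / (\<eta> (Cell i j) + (1 - \<eta> (Cell i j)) * (increment \<eta> True i j * increment \<eta> False i j))"
  by pat_completeness auto
termination by (relation "Wellfounded.measure (\<lambda>(\<eta>, c, i, j). i + j)") auto

abbreviation "hinc \<eta> i j \<equiv> increment \<eta> True i j"
abbreviation "vinc \<eta> i j \<equiv> increment \<eta> False i j"

text \<open>The solution u of u / v + (1 - u) w = 1, with v and w the increments at the cell: the
  weight for which these increments belong to a harmonic function.\<close>

definition dual_env :: "(slot \<Rightarrow> real) \<Rightarrow> nat \<times> nat \<Rightarrow> real" where
  "dual_env \<eta> = (\<lambda>(i, j). (hinc \<eta> i j - hinc \<eta> i j * vinc \<eta> i j) / (1 - hinc \<eta> i j * vinc \<eta> i j))"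

text \<open>Both products stand for H (i, j + 1) / H (i + 1, j), computed along the two ways around
  the cell. This closed loop condition is what makes H well defined.\<close>

lemma hinc_mult_vinc:
  assumes "hinc \<eta> i (Suc j) \<noteq> 0"
  shows "hinc \<eta> i (Suc j) * vinc \<eta> (Suc i) j = hinc \<eta> i j * vinc \<eta> i j"
  using assms by simp

definition stat_harm :: "(slot \<Rightarrow> real) \<Rightarrow> nat \<Rightarrow> nat \<Rightarrow> real" where
  "stat_harm \<eta> i j = (\<Prod>k<i. 1 / hinc \<eta> k 0) * (\<Prod>k<j. vinc \<eta> i k)"

text \<open>The passage through one cell: increments enter on its lower and left sides and leave on
  its upper and right sides, in the same two slots. The auxiliary weight is replaced by the
  environment weight of the cell.\<close>

definition flip :: "nat \<Rightarrow> nat \<Rightarrow> (slot \<Rightarrow> real) \<Rightarrow> slot \<Rightarrow> real" where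
  "flip i j \<eta> = (let p = \<eta> (Bottom i) * \<eta> (Left j); v = \<eta> (Cell i j) + (1 - \<eta> (Cell i j)) * p in
     \<eta>(Cell i j := (\<eta> (Bottom i) - p) / (1 - p), Left j := p / v, Bottom i := v))"

text \<open>
  The increments along the outer boundary of a Young diagram \<open>D\<close>, together with the environment inside \<open>D\<close> and the auxiliary
  weights, not yet used, outside.  Adding a corner to \<open>D\<close> amounts to one \<open>flip\<close>.
\<close>

definition slots :: "(nat \<times> nat) set \<Rightarrow> (slot \<Rightarrow> real) \<Rightarrow> slot \<Rightarrow> real" where
  "slots D \<eta> k = (case k of
     Bottom i \<Rightarrow> hinc \<eta> i (card {j. (i, j) \<in> D})
   | Left j \<Rightarrow> vinc \<eta> (card {i. (i, j) \<in> D}) j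
   | Cell i j \<Rightarrow> if (i, j) \<in> D then dual_env \<eta> (i, j) else \<eta> k)"

definition young :: "(nat \<times> nat) set \<Rightarrow> bool" where
  "young D \<longleftrightarrow> finite D \<and> (\<forall>i j i' j'. (i, j) \<in> D \<longrightarrow> i' \<le> i \<longrightarrow> j' \<le> j \<longrightarrow> (i', j') \<in> D)"

lemma young_rect: "young ({..<m} \<times> {..<n})"
  by (auto simp: young_def)

lemma slots_empty: "slots {} \<eta> = \<eta>"
  by (auto simp: slots_def fun_eq_iff split: slot.split)

text \<open>If \<open>(i, j)\<close> can be adjoined, the cells of \<open>D\<close> with first
  coordinate \<open>i\<close> are those below height \<open>j\<close>, and those with second
  coordinate \<open>j\<close> are those left of \<open>i\<close>. So \<open>Bottom i\<close> and
  \<open>Left j\<close> hold just the increments on the lower and left sides of the new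
  cell.\<close>

lemma slots_insert:
  assumes D: "young D" and D': "young (insert (i, j) D)" and ij: "(i, j) \<notin> D"
  shows "slots (insert (i, j) D) \<eta> = flip i j (slots D \<eta>)"
proof -
  have row: "{j'. (i, j') \<in> D} = {..<j}"
  proof (intro equalityI subsetI)
    fix j' assume "j' \<in> {j'. (i, j') \<in> D}"
    then show "j' \<in> {..<j}" using D ij unfolding young_def by (metis lessThan_iff mem_Collect_eq not_less order_refl)
  next
    fix j' assume "j' \<in> {..<j}"
    then have "(i, j') \<in> insert (i, j) D"
      using D' unfolding young_def by (metis insertI1 less_imp_le lessThan_iff order_refl)
    then show "j' \<in> {j'. (i, j') \<in> D}" using \<open>j' \<in> {..<j}\<close> by auto
  qed
  have col: "{i'. (i', j) \<in> D} = {..<i}"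
  proof (intro equalityI subsetI)
    fix i' assume "i' \<in> {i'. (i', j) \<in> D}"
    then show "i' \<in> {..<i}" using D ij unfolding young_def by (metis lessThan_iff mem_Collect_eq not_less order_refl)
  next
    fix i' assume "i' \<in> {..<i}"
    then have "(i', j) \<in> insert (i, j) D"
      using D' unfolding young_def by (metis insertI1 less_imp_le lessThan_iff order_refl)
    then show "i' \<in> {i'. (i', j) \<in> D}" using \<open>i' \<in> {..<i}\<close> by auto
  qed
  have "{j'. j' = j \<or> (i, j') \<in> D} = insert j {j'. (i, j') \<in> D}"
    "{i'. i' = i \<or> (i', j) \<in> D} = insert i {i'. (i', j) \<in> D}" by auto
  then have row': "{j'. j' = j \<or> (i, j') \<in> D} = {..j}" and col': "{i'. i' = i \<or> (i', j) \<in> D} = {..i}"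
    unfolding row col by auto
  show ?thesis
  proof
    fix k
    show "slots (insert (i, j) D) \<eta> k = flip i j (slots D \<eta>) k"
    proof (cases k)
      case (Bottom i')
      then show ?thesis
        by (cases "i' = i") (simp_all add: slots_def flip_def Let_def row row' col ij)
    next
      case (Left j')
      then show ?thesis
        by (cases "j' = j") (simp_all add: slots_def flip_def Let_def row col col' ij)
    next
      case (Cell i' j')
      then show ?thesis
        by (cases "(i', j') = (i, j)") (auto simp: slots_def flip_def Let_def row col ij dual_env_def)
    qed
  qed
qed

text \<open>A cell with maximal coordinate sum is a corner, and its removal leaves a Young
  diagram.\<close>

lemma young_induct [consumes 1, case_names empty insert]:
  assumes "young D" and "P {}"
    and "\<And>i j D. young D \<Longrightarrow> young (insert (i, j) D) \<Longrightarrow> (i, j) \<notin> D \<Longrightarrow> P D \<Longrightarrow> P (insert (i, j) D)"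
  shows "P D"
  using assms(1)
proof (induction "card D" arbitrary: D)
  case 0
  then have "D = {}" by (simp add: young_def)
  then show ?case using assms(2) by simp
next
  case (Suc n)
  then have fin: "finite D" and ne: "D \<noteq> {}" by (auto simp: young_def)
  define f where "f y = fst y + snd y" for y :: "nat \<times> nat"
  have "Max (f ` D) \<in> f ` D" using fin ne by (intro Max_in) auto
  then obtain x where x: "x \<in> D" and "f x = Max (f ` D)" by auto
  then have max: "f y \<le> f x" if "y \<in> D" for y using that fin by simp
  obtain i j where ij: "x = (i, j)" by (cases x)
  have "young (D - {x})"
    unfolding young_def
  proof (intro conjI allI impI)
    fix i1 j1 i2 j2 assume 1: "(i1, j1) \<in> D - {x}" "i2 \<le> i1" "j2 \<le> j1"
    then have "(i2, j2) \<in> D" using Suc.prems unfolding young_def by blast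
    moreover have "(i2, j2) \<noteq> x"
      using max[of "(i1, j1)"] 1 ij by (auto simp: f_def)
    ultimately show "(i2, j2) \<in> D - {x}" by simp
  qed (use fin in simp)
  moreover have "insert x (D - {x}) = D" using x by auto
  ultimately show ?case
    using assms(3)[of "D - {x}" i j] Suc x fin ij by simp
qed

abbreviation (input) borelP :: "('i \<Rightarrow> real) measure" where "borelP \<equiv> PiM UNIV (\<lambda>_. borel)"

lemma measurable_increment [measurable]: "(\<lambda>\<eta>. increment \<eta> c i j) \<in> borel_measurable borelP"
proof (induction "i + j" arbitrary: c i j rule: less_induct)
  case less
  show ?case
  proof (cases c)
    case True
    show ?thesis
    proof (cases j)
      case (Suc j')
      have [measurable]: "(\<lambda>\<eta>. increment \<eta> c' i j') \<in> borel_measurable borelP" for c'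
        using less[of i j' c'] Suc by simp
      show ?thesis using True by (simp add: Suc)
    qed (simp add: True)
  next
    case False
    show ?thesis
    proof (cases i)
      case (Suc i')
      have [measurable]: "(\<lambda>\<eta>. increment \<eta> c' i' j) \<in> borel_measurable borelP" for c'
        using less[of i' j c'] Suc by simp
      show ?thesis using False by (simp add: Suc)
    qed (use False in simp)
  qed
qed

lemma measurable_dual_env [measurable]: "(\<lambda>\<eta>. dual_env \<eta> x) \<in> borel_measurable borelP"
  by (cases x) (simp add: dual_env_def)

lemma measurable_slots: "slots D \<in> borelP \<rightarrow>\<^sub>M borelP"
proof (rule measurable_PiM_single')
  show "(\<lambda>\<eta>. slots D \<eta> k) \<in> borel_measurable borelP" for k
    by (cases k) (auto simp: slots_def)
qed simp

lemma measurable_flip: "flip i j \<in> borelP \<rightarrow>\<^sub>M borelP"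
proof (rule measurable_PiM_single')
  show "(\<lambda>\<eta>. flip i j \<eta> k) \<in> borel_measurable borelP" for k
  proof -
    consider "k = Bottom i" | "k = Left j" | "k = Cell i j" | "k \<noteq> Bottom i" "k \<noteq> Left j" "k \<noteq> Cell i j" by blast
    then show ?thesis unfolding flip_def Let_def by cases auto
  qed
qed simp

lemma measurable_stat_harm [measurable]: "(\<lambda>\<eta>. stat_harm \<eta> i j) \<in> borel_measurable borelP"
  unfolding stat_harm_def by measurable

section \<open>Invariance of the slot law and the law of the dual environment\<close>

locale stationary =
  fixes a b l :: real
  assumes abl: "a > 0" "b > 0" "l > 0"
begin

text \<open>The bottom and left laws are those of \<open>v\<close> and \<open>w\<close> in
  \<open>beta_product_identity\<close>, and the cell law is that of \<open>u\<close>; with this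
  choice the law survives a flip.\<close>

definition law :: "slot \<Rightarrow> real measure" where
  "law k = (case k of Bottom _ \<Rightarrow> beta_real (l + a) b | Left _ \<Rightarrow> beta_real l a | Cell _ _ \<Rightarrow> beta_real a b)"

lemma prob_law: "prob_space (law k)" and sets_law [measurable_cong, simp]: "sets (law k) = sets borel"
  and space_law [simp]: "space (law k) = UNIV"
  using abl by (auto simp: law_def intro: prob_space_beta_real split: slot.split)

definition slotM :: "(slot \<Rightarrow> real) measure" where "slotM = PiM UNIV law"

lemma sets_slotM [measurable_cong, simp]: "sets slotM = sets borelP"
  unfolding slotM_def by (intro sets_PiM_cong) auto

lemma space_slotM [simp]: "space slotM = UNIV"
  unfolding slotM_def by (simp add: space_PiM)

sublocale slotM: prob_space slotM
  unfolding slotM_def by (intro prob_space_PiM prob_law)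

text \<open>The flip factors through the law \<open>law'\<close>. The map \<open>?f\<close> turns
  the two increments into their product and the environment weight, \<open>?s\<close> exchanges that
  weight with the fresh one in the cell, which has the same law, and \<open>?g\<close> makes new
  increments from the product and the fresh weight.\<close>

lemma distr_flip: "distr slotM borelP (flip i j) = slotM"
proof -
  let ?t = "Bottom i" and ?r = "Left j" and ?c = "Cell i j"
  let ?F = "\<lambda>(v, w). (v * w, (v - v * w) / (1 - v * w)) :: real \<times> real"
  let ?G = "\<lambda>(p, u). (u + (1 - u) * p, p / (u + (1 - u) * p)) :: real \<times> real"
  define law' where "law' = law(?t := beta_real l (a + b), ?r := beta_real a b)"
  have pl': "prob_space (law' k)" and sl': "sets (law' k) = sets borel" for k
    using abl by (auto simp: law'_def prob_law intro: prob_space_beta_real)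
  let ?f = "\<lambda>\<eta>. \<eta>(?r := snd (?F (\<eta> ?t, \<eta> ?r)), ?t := fst (?F (\<eta> ?t, \<eta> ?r)))"
  let ?g = "\<lambda>\<eta>. \<eta>(?r := snd (?G (\<eta> ?t, \<eta> ?r)), ?t := fst (?G (\<eta> ?t, \<eta> ?r)))"
  let ?s = "\<lambda>\<eta>. \<lambda>n\<in>UNIV. \<eta> (Transposition.transpose ?r ?c n)"
  have f: "distr (PiM UNIV law) borelP ?f = PiM UNIV law'"
  proof (rule distr_PiM_update2)
    show "distr (law ?t \<Otimes>\<^sub>M law ?r) (borel \<Otimes>\<^sub>M borel) ?F = law' ?t \<Otimes>\<^sub>M law' ?r"
      using beta_pair_forward[OF abl] by (simp add: law_def law'_def)
  qed (use pl' sl' in \<open>auto simp: prob_law law'_def\<close>)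
  have g: "distr (PiM UNIV law') borelP ?g = PiM UNIV law"
  proof (rule distr_PiM_update2)
    show "distr (law' ?t \<Otimes>\<^sub>M law' ?r) (borel \<Otimes>\<^sub>M borel) ?G = law ?t \<Otimes>\<^sub>M law ?r"
      using beta_pair_backward[OF abl] by (simp add: law_def law'_def)
  qed (use pl' sl' in \<open>auto simp: prob_law law'_def\<close>)
  have inv: "law' (Transposition.transpose ?r ?c n) = law' n" for n
    by (simp add: Transposition.transpose_def law'_def law_def)
  have s: "distr (PiM UNIV law') borelP ?s = PiM UNIV law'"
  proof -
    have "distr (PiM UNIV law') (PiM UNIV law') ?s = PiM UNIV law'"
      using distr_PiM_reindex[of UNIV law' "Transposition.transpose ?r ?c" UNIV, OF pl'] by (simp add: inv)
    moreover have "distr (PiM UNIV law') borelP ?s = distr (PiM UNIV law') (PiM UNIV law') ?s"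
      by (intro distr_cong refl sets_PiM_cong) (auto simp: sl')
    ultimately show ?thesis by simp
  qed
  have slb: "sets (PiM UNIV law) = sets borelP" and slb': "sets (PiM UNIV law') = sets borelP"
    by (intro sets_PiM_cong; simp add: sl')+
  have fm: "?f \<in> borelP \<rightarrow>\<^sub>M borelP" and gm: "?g \<in> borelP \<rightarrow>\<^sub>M borelP"
    by (rule measurable_PiM_single'; auto simp: fun_upd_def)+
  have sm: "?s \<in> borelP \<rightarrow>\<^sub>M borelP" by measurable
  have "slotM = distr (distr (distr slotM borelP ?f) borelP ?s) borelP ?g"
    unfolding slotM_def f s g ..
  also have "\<dots> = distr slotM borelP (?g \<circ> (?s \<circ> ?f))"
    using fm gm sm
    by (simp add: distr_distr measurable_cong_sets[OF sets_slotM refl] measurable_comp o_assoc)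
  also have "?g \<circ> (?s \<circ> ?f) = flip i j"
    by (auto simp: fun_eq_iff flip_def Let_def Transposition.transpose_def)
  finally show ?thesis ..
qed

text \<open>The Burke property: along the outer boundary of any Young diagram, the increments are
  independent of each other and of the environment inside, with the laws of the boundary
  data.\<close>

lemma distr_slots:
  assumes "young D"
  shows "distr slotM borelP (slots D) = slotM"
  using assms
proof (induction rule: young_induct)
  case empty
  then show ?case by (simp add: slots_empty[abs_def] distr_id2)
next
  case (insert i j D)
  have "slots (insert (i, j) D) = flip i j \<circ> slots D"
    using slots_insert[OF insert(1-3)] by (auto simp: fun_eq_iff)
  then have "distr slotM borelP (slots (insert (i, j) D)) = distr (distr slotM borelP (slots D)) borelP (flip i j)"
    by (simp add: distr_distr measurable_flip measurable_slots measurable_cong_sets[OF sets_slotM refl])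
  then show ?case unfolding insert.IH distr_flip .
qed

lemma product_slotM: "product_prob_space law"
  by (simp add: product_prob_space_def product_prob_space_axioms_def product_sigma_finite_def
      prob_law prob_space_imp_sigma_finite)

lemma AE_law: "AE x in law k. 0 < x \<and> x < 1"
  using abl by (cases k; simp only: law_def slot.case; intro AE_beta_real; simp)

lemma AE_slot: "AE \<eta> in slotM. 0 < \<eta> k \<and> \<eta> k < 1"
  unfolding slotM_def by (rule AE_PiM_component[OF prob_law _ AE_law]) auto

lemma AE_slots:
  assumes "young D"
  shows "AE \<eta> in slotM. 0 < slots D \<eta> k \<and> slots D \<eta> k < 1"
proof -
  have "AE \<zeta> in distr slotM borelP (slots D). 0 < \<zeta> k \<and> \<zeta> k < 1"
    unfolding distr_slots[OF assms] by (rule AE_slot)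
  then show ?thesis
    by (rule AE_distrD[rotated]) (simp add: measurable_slots measurable_cong_sets[OF sets_slotM refl])
qed

definition good :: "(slot \<Rightarrow> real) \<Rightarrow> bool" where
  "good \<eta> \<longleftrightarrow> (\<forall>c i j. 0 < increment \<eta> c i j \<and> increment \<eta> c i j < 1) \<and> (\<forall>x. 0 < dual_env \<eta> x \<and> dual_env \<eta> x < 1)"

lemma slots_rect:
  "i < m \<Longrightarrow> slots ({..<m} \<times> {..<n}) \<eta> (Bottom i) = hinc \<eta> i n"
  "j < n \<Longrightarrow> slots ({..<m} \<times> {..<n}) \<eta> (Left j) = vinc \<eta> m j"
  "i < m \<Longrightarrow> j < n \<Longrightarrow> slots ({..<m} \<times> {..<n}) \<eta> (Cell i j) = dual_env \<eta> (i, j)"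
  by (simp_all add: slots_def lessThan_def[symmetric])

text \<open>Every increment and every weight occurs as a slot of a suitable rectangle, hence is a
  beta variable; countably many null sets are discarded.\<close>

lemma AE_good: "AE \<eta> in slotM. good \<eta>"
proof -
  have V: "AE \<eta> in slotM. 0 < hinc \<eta> i j \<and> hinc \<eta> i j < 1" for i j
    using AE_slots[OF young_rect, of "Suc i" j "Bottom i"] by (simp only: slots_rect lessI)
  have W: "AE \<eta> in slotM. 0 < vinc \<eta> i j \<and> vinc \<eta> i j < 1" for i j
    using AE_slots[OF young_rect, of i "Suc j" "Left j"] by (simp only: slots_rect lessI)
  have inc: "AE \<eta> in slotM. 0 < increment \<eta> c i j \<and> increment \<eta> c i j < 1" for c i j
    using V W by (cases c) auto
  have env: "AE \<eta> in slotM. 0 < dual_env \<eta> x \<and> dual_env \<eta> x < 1" for x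
    using AE_slots[OF young_rect, of "Suc (fst x)" "Suc (snd x)" "Cell (fst x) (snd x)"]
    by (simp only: slots_rect lessI prod.collapse)
  have "AE \<eta> in slotM. \<forall>c i j. 0 < increment \<eta> c i j \<and> increment \<eta> c i j < 1"
    by (subst AE_all_countable, rule allI)+ (rule inc)
  moreover have "AE \<eta> in slotM. \<forall>x. 0 < dual_env \<eta> x \<and> dual_env \<eta> x < 1"
    by (subst AE_all_countable, rule allI) (rule env)
  ultimately show ?thesis unfolding good_def by (rule AE_conjI)
qed

lemma stat_harm_0_0: "stat_harm \<eta> 0 0 = 1"
  by (simp add: stat_harm_def)

lemma stat_harm_Suc_right: "stat_harm \<eta> i (Suc j) = stat_harm \<eta> i j * vinc \<eta> i j"
  by (simp add: stat_harm_def mult.assoc)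

text \<open>\<open>stat_harm\<close> is defined along the path that follows the bottom axis and then
  goes up. The closed loop condition, one cell at a time, extends its horizontal ratios from the
  axis to all rows.\<close>

lemma stat_harm_Suc_left:
  assumes "good \<eta>"
  shows "stat_harm \<eta> (Suc i) j = stat_harm \<eta> i j / hinc \<eta> i j"
proof (induction j)
  case 0
  then show ?case by (simp add: stat_harm_def)
next
  case (Suc j)
  have p: "0 < hinc \<eta> i (Suc j)" "0 < hinc \<eta> i j" using assms by (auto simp: good_def simp del: increment.simps)
  then have "hinc \<eta> i (Suc j) * vinc \<eta> (Suc i) j = hinc \<eta> i j * vinc \<eta> i j"
    by (intro hinc_mult_vinc) auto
  then have "vinc \<eta> (Suc i) j / hinc \<eta> i j = vinc \<eta> i j / hinc \<eta> i (Suc j)"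
    using p by (simp add: field_simps del: increment.simps)
  then show ?case
    unfolding stat_harm_Suc_right Suc.IH by (metis times_divide_eq_left times_divide_eq_right)
qed

lemma positive_harmonic_stat_harm:
  assumes "good \<eta>"
  shows "positive_harmonic (dual_env \<eta>) (stat_harm \<eta>)"
proof
  show "0 < dual_env \<eta> x \<and> dual_env \<eta> x < 1" for x using assms unfolding good_def by blast
  have inc: "0 < increment \<eta> c i j" "increment \<eta> c i j < 1" for c i j using assms by (auto simp: good_def)
  show "0 < stat_harm \<eta> i j" for i j
    unfolding stat_harm_def by (intro mult_pos_pos prod_pos) (auto simp: inc simp del: increment.simps)
  show "harmonic (dual_env \<eta>) (stat_harm \<eta>)"
    unfolding harmonic_def
  proof (intro allI)
    fix i j
    define v w where "v = hinc \<eta> i j" and "w = vinc \<eta> i j"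
    have vw: "0 < v" "v < 1" "0 < w" "w < 1" using inc by (auto simp: v_def w_def)
    then have "v * w < 1 * 1" by (intro mult_strict_mono) auto
    define d where "d = 1 - v * w"
    have d: "d > 0" using \<open>v * w < 1 * 1\<close> by (simp add: d_def)
    have de: "dual_env \<eta> (i, j) = (v - v * w) / d" by (simp add: dual_env_def v_def w_def d_def)
    have "dual_env \<eta> (i, j) / v = (1 - w) / d" unfolding de using vw d by (simp add: field_simps)
    moreover have "1 - dual_env \<eta> (i, j) = (1 - v) / d" unfolding de using d by (simp add: field_simps d_def)
    ultimately have "dual_env \<eta> (i, j) / v + (1 - dual_env \<eta> (i, j)) * w = ((1 - w) + (1 - v) * w) / d"
      by (simp add: add_divide_distrib)
    also have "(1 - w) + (1 - v) * w = d" by (simp add: d_def algebra_simps)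
    finally have "dual_env \<eta> (i, j) / v + (1 - dual_env \<eta> (i, j)) * w = 1" using d by simp
    then have "stat_harm \<eta> i j * 1 = stat_harm \<eta> i j * (dual_env \<eta> (i, j) / v + (1 - dual_env \<eta> (i, j)) * w)" by simp
    then show "stat_harm \<eta> i j = dual_env \<eta> (i, j) * stat_harm \<eta> (Suc i) j + (1 - dual_env \<eta> (i, j)) * stat_harm \<eta> i (Suc j)"
      unfolding stat_harm_Suc_left[OF assms] stat_harm_Suc_right by (simp add: v_def w_def algebra_simps)
  qed
qed

text \<open>Finitely many cells fit into a square \<open>D\<close>, and there the environment
  weights are slots of \<open>slots D\<close>, whose law is the original product.\<close>

lemma distr_dual_env: "distr slotM borelP dual_env = PiM UNIV (\<lambda>_::nat \<times> nat. beta_real a b)"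
proof -
  interpret B: product_prob_space "\<lambda>_::nat \<times> nat. beta_real a b" UNIV
    using abl by (simp add: product_prob_space_def product_prob_space_axioms_def product_sigma_finite_def
      prob_space_beta_real prob_space_imp_sigma_finite)
  interpret L: product_prob_space law UNIV by (rule product_slotM)
  have sB: "sets borelP = sets (PiM UNIV (\<lambda>_::nat \<times> nat. beta_real a b))"
    by (intro sets_PiM_cong) auto
  have dm: "dual_env \<in> slotM \<rightarrow>\<^sub>M borelP"
    by (rule measurable_PiM_single') (auto simp: measurable_cong_sets[OF sets_slotM refl])
  show ?thesis
  proof (rule B.PiM_eq)
    fix J and A :: "nat \<times> nat \<Rightarrow> real set"
    assume J: "finite J" "J \<subseteq> UNIV" and A: "\<And>j. j \<in> J \<Longrightarrow> A j \<in> sets (beta_real a b)"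
    obtain n where n: "\<And>x. x \<in> J \<Longrightarrow> fst x < n \<and> snd x < n"
    proof -
      have "finite ((\<lambda>x. fst x + snd x) ` J)" using J by simp
      then obtain m where "\<And>k. k \<in> (\<lambda>x. fst x + snd x) ` J \<Longrightarrow> k \<le> m" by (meson finite_nat_set_iff_bounded_le)
      then show ?thesis by (intro that[of "Suc m"]) (fastforce simp: less_Suc_eq_le)
    qed
    define D where "D = {..<n} \<times> {..<n}"
    have D: "young D" unfolding D_def by (rule young_rect)
    have cell: "slots D \<eta> (Cell (fst x) (snd x)) = dual_env \<eta> x" if "x \<in> J" for x \<eta>
      using n[OF that] by (simp add: D_def slots_rect)
    define A' where "A' s = (case s of Cell i j \<Rightarrow> A (i, j) | _ \<Rightarrow> UNIV)" for s
    define J' where "J' = (\<lambda>x. Cell (fst x) (snd x)) ` J"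
    have inj: "inj_on (\<lambda>x. Cell (fst x) (snd x)) J" by (auto simp: inj_on_def prod_eq_iff)
    have A': "A' s \<in> sets (law s)" if "s \<in> J'" for s using that A by (auto simp: A'_def J'_def)
    define B where "B = {\<zeta> \<in> space slotM. \<forall>s\<in>J'. \<zeta> s \<in> A' s}"
    have B: "emeasure slotM B = (\<Prod>s\<in>J'. emeasure (law s) (A' s))"
      unfolding B_def slotM_def using J A' by (intro L.emeasure_PiM_Collect) (auto simp: J'_def)
    have Bs: "B \<in> sets slotM"
      unfolding B_def
    proof (rule sets.sets_Collect_finite_All)
      fix s assume "s \<in> J'"
      moreover have "(\<lambda>\<zeta>. \<zeta> s) \<in> borel_measurable slotM" by measurable
      ultimately show "{\<zeta> \<in> space slotM. \<zeta> s \<in> A' s} \<in> sets slotM"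
        using A'[of s] by (simp add: measurable_def vimage_def)
    qed (use J in \<open>simp add: J'_def\<close>)
    have "dual_env -` (prod_emb UNIV (\<lambda>_. beta_real a b) J (Pi\<^sub>E J A)) \<inter> space slotM = slots D -` B \<inter> space slotM"
      using cell by (auto simp: prod_emb_def B_def J'_def A'_def)
    then have "emeasure (distr slotM borelP dual_env) (prod_emb UNIV (\<lambda>_. beta_real a b) J (Pi\<^sub>E J A))
        = emeasure (distr slotM borelP (slots D)) B"
      using J A sB Bs dm by (subst (1 2) emeasure_distr)
        (auto intro!: sets_PiM_I simp: measurable_slots measurable_cong_sets[OF sets_slotM refl])
    also have "\<dots> = (\<Prod>s\<in>J'. emeasure (law s) (A' s))"
      unfolding distr_slots[OF D] by (rule B)
    also have "\<dots> = (\<Prod>x\<in>J. emeasure (beta_real a b) (A x))"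
      unfolding J'_def by (subst prod.reindex[OF inj]) (simp add: law_def A'_def)
    finally show "emeasure (distr slotM borelP dual_env) (prod_emb UNIV (\<lambda>_. beta_real a b) J (Pi\<^sub>E J A))
        = (\<Prod>x\<in>J. emeasure (beta_real a b) (A x))" .
  qed (simp add: sB)
qed

lemma nn_integral_coordinates:
  fixes f :: "real \<Rightarrow> ennreal"
  assumes f [measurable]: "f \<in> borel_measurable borel" and g: "inj_on g {..<n}" "\<And>k. law (g k) = \<nu>"
  shows "(\<integral>\<^sup>+\<eta>. (\<Prod>k<n. f (\<eta> (g k))) \<partial>slotM) = (\<integral>\<^sup>+x. f x \<partial>\<nu>) ^ n"
proof -
  let ?M = "\<lambda>k::nat. law (g k)"
  interpret product_sigma_finite ?M
    by (simp add: product_sigma_finite_def prob_law prob_space_imp_sigma_finite)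
  have "(\<integral>\<^sup>+\<eta>. (\<Prod>k<n. f (\<eta> (g k))) \<partial>slotM) = (\<integral>\<^sup>+\<eta>. (\<Prod>k<n. f ((\<lambda>k\<in>{..<n}. \<eta> (g k)) k)) \<partial>slotM)"
    by simp
  also have "\<dots> = (\<integral>\<^sup>+\<zeta>. (\<Prod>k<n. f (\<zeta> k)) \<partial>distr slotM (PiM {..<n} ?M) (\<lambda>\<eta>. \<lambda>k\<in>{..<n}. \<eta> (g k)))"
    by (subst nn_integral_distr)
      (auto simp: slotM_def intro!: measurable_restrict measurable_component_singleton borel_measurable_prod_ennreal
        intro: measurable_compose[OF measurable_component_singleton])
  also have "distr slotM (PiM {..<n} ?M) (\<lambda>\<eta>. \<lambda>k\<in>{..<n}. \<eta> (g k)) = PiM {..<n} ?M"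
    unfolding slotM_def by (rule distr_PiM_reindex) (auto simp: prob_law g)
  also have "(\<integral>\<^sup>+\<zeta>. (\<Prod>k<n. f (\<zeta> k)) \<partial>PiM {..<n} ?M) = (\<Prod>k<n. \<integral>\<^sup>+x. f x \<partial>?M k)"
    by (rule product_nn_integral_prod) (auto simp: measurable_cong_sets[OF sets_law refl])
  finally show ?thesis by (simp add: g)
qed

lemma row_moments:
  fixes f :: "real \<Rightarrow> ennreal"
  assumes "f \<in> borel_measurable borel"
  shows "(\<integral>\<^sup>+\<eta>. (\<Prod>k<n. f (hinc \<eta> k 0)) \<partial>slotM) = (\<integral>\<^sup>+x. f x \<partial>beta_real (l + a) b) ^ n"
  using nn_integral_coordinates[OF assms, of Bottom n "beta_real (l + a) b"] by (simp add: law_def inj_on_def)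

text \<open>Vertical increments on the column \<open>m\<close> are not input variables, but they are
  the left slots of the rectangle of width \<open>m\<close>, so by the Burke property they have the
  joint law of those on the axis.\<close>

lemma column_moments:
  fixes f :: "real \<Rightarrow> ennreal"
  assumes [measurable]: "f \<in> borel_measurable borel"
  shows "(\<integral>\<^sup>+\<eta>. (\<Prod>k<n. f (vinc \<eta> m k)) \<partial>slotM) = (\<integral>\<^sup>+x. f x \<partial>beta_real l a) ^ n"
proof -
  let ?D = "{..<m} \<times> {..<n}"
  have "(\<integral>\<^sup>+\<eta>. (\<Prod>k<n. f (vinc \<eta> m k)) \<partial>slotM) = (\<integral>\<^sup>+\<eta>. (\<Prod>k<n. f (slots ?D \<eta> (Left k))) \<partial>slotM)"
    by (intro nn_integral_cong prod.cong refl) (simp add: slots_rect)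
  also have "\<dots> = (\<integral>\<^sup>+\<zeta>. (\<Prod>k<n. f (\<zeta> (Left k))) \<partial>distr slotM borelP (slots ?D))"
    by (subst nn_integral_distr) (auto simp: measurable_slots measurable_cong_sets[OF sets_slotM refl])
  also have "\<dots> = (\<integral>\<^sup>+\<zeta>. (\<Prod>k<n. f (\<zeta> (Left k))) \<partial>slotM)"
    unfolding distr_slots[OF young_rect] ..
  also have "\<dots> = (\<integral>\<^sup>+x. f x \<partial>beta_real l a) ^ n"
    using assms by (intro nn_integral_coordinates) (auto simp: law_def inj_on_def)
  finally show ?thesis .
qed

end

section \<open>Deviation bounds and the growth rate\<close>

text \<open>The deviation is measured on the scale \<open>n\<close>, which dominates the number
  \<open>m\<close> of summands. One of the two \<epsilon> pays for the moment bounds, the other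
  yields the geometric factor. Independence enters through the product moments
  \<open>mom\<close>.\<close>

lemma (in prob_space) chernoff_two_sided:
  fixes Z :: "nat \<Rightarrow> 'a \<Rightarrow> real"
  assumes Z [measurable]: "\<And>k. Z k \<in> borel_measurable M" and pos: "AE x in M. \<forall>k. 0 < Z k x"
    and mom: "\<And>f :: real \<Rightarrow> ennreal. f \<in> borel_measurable borel \<Longrightarrow>
      (\<integral>\<^sup>+x. (\<Prod>k<m. f (Z k x)) \<partial>M) = (\<integral>\<^sup>+t. f t \<partial>\<nu>) ^ m"
    and \<theta>: "\<theta> > 0"
    and up: "(\<integral>\<^sup>+t. ennreal (t powr \<theta>) \<partial>\<nu>) \<le> ennreal (exp (\<theta> * (\<mu> + \<epsilon>)))"
    and lo: "(\<integral>\<^sup>+t. ennreal (t powr (- \<theta>)) \<partial>\<nu>) \<le> ennreal (exp (- \<theta> * (\<mu> - \<epsilon>)))"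
    and n: "m \<le> n" "\<epsilon> > 0"
  shows "prob {x \<in> space M. 2 * \<epsilon> * real n < \<bar>(\<Sum>k<m. ln (Z k x)) - real m * \<mu>\<bar>} \<le> 2 * exp (- \<theta> * \<epsilon>) ^ n"
proof -
  have markov: "emeasure M {x \<in> space M. c \<le> t * (\<Sum>k<m. ln (Z k x))} \<le> ennreal (exp (real m * d - c))"
    if t: "(\<integral>\<^sup>+s. ennreal (s powr t) \<partial>\<nu>) \<le> ennreal (exp d)" for c t d
  proof -
    let ?f = "\<lambda>x. \<Prod>k<m. ennreal (Z k x powr t)"
    have "emeasure M {x \<in> space M. c \<le> t * (\<Sum>k<m. ln (Z k x))} \<le> emeasure M {x \<in> space M. 1 \<le> ennreal (exp (- c)) * ?f x}"
    proof (rule emeasure_mono_AE)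
      show "AE x in M. x \<in> {x \<in> space M. c \<le> t * (\<Sum>k<m. ln (Z k x))} \<longrightarrow> x \<in> {x \<in> space M. 1 \<le> ennreal (exp (- c)) * ?f x}"
        using pos
      proof eventually_elim
        fix x assume x: "\<forall>k. 0 < Z k x"
        have "?f x = ennreal (\<Prod>k<m. exp (t * ln (Z k x)))"
          using x by (simp add: prod_ennreal powr_def less_imp_neq[symmetric])
        also have "(\<Prod>k<m. exp (t * ln (Z k x))) = exp (t * (\<Sum>k<m. ln (Z k x)))"
          by (simp add: exp_sum sum_distrib_left)
        finally show "x \<in> {x \<in> space M. c \<le> t * (\<Sum>k<m. ln (Z k x))} \<longrightarrow> x \<in> {x \<in> space M. 1 \<le> ennreal (exp (- c)) * ?f x}"
          by (auto simp: ennreal_mult[symmetric] exp_add[symmetric])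
      qed
    qed measurable
    also have "\<dots> \<le> ennreal (exp (- c)) * (\<integral>\<^sup>+x. ?f x \<partial>M)"
      using nn_integral_Markov_inequality[of ?f "space M" M "ennreal (exp (- c))"] by simp
    also have "(\<integral>\<^sup>+x. ?f x \<partial>M) = (\<integral>\<^sup>+s. ennreal (s powr t) \<partial>\<nu>) ^ m" by (rule mom) measurable
    also have "ennreal (exp (- c)) * (\<integral>\<^sup>+s. ennreal (s powr t) \<partial>\<nu>) ^ m \<le> ennreal (exp (- c)) * ennreal (exp d) ^ m"
      using t by (intro mult_left_mono power_mono) auto
    also have "\<dots> = ennreal (exp (real m * d - c))"
      by (simp add: ennreal_power ennreal_mult[symmetric] exp_of_nat_mult[symmetric] exp_add[symmetric])
    finally show ?thesis .
  qed
  let ?S = "\<lambda>x. \<Sum>k<m. ln (Z k x)"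
  have e: "exp (- \<theta> * \<epsilon>) ^ n = exp (- \<theta> * \<epsilon> * real n)" by (simp add: exp_of_nat2_mult[symmetric] mult.commute)
  have le: "\<theta> * \<epsilon> * real m \<le> \<theta> * \<epsilon> * real n" using n \<theta> by (intro mult_left_mono) auto
  have "prob {x \<in> space M. \<theta> * (real m * \<mu> + 2 * \<epsilon> * real n) \<le> \<theta> * ?S x} \<le> exp (real m * (\<theta> * (\<mu> + \<epsilon>)) - \<theta> * (real m * \<mu> + 2 * \<epsilon> * real n))"
    using markov[OF up, of "\<theta> * (real m * \<mu> + 2 * \<epsilon> * real n)"] by (simp add: emeasure_eq_measure)
  also have "\<dots> \<le> exp (- \<theta> * \<epsilon>) ^ n"
    unfolding e using le by (simp add: algebra_simps)
  finally have 1: "prob {x \<in> space M. \<theta> * (real m * \<mu> + 2 * \<epsilon> * real n) \<le> \<theta> * ?S x} \<le> exp (- \<theta> * \<epsilon>) ^ n" .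
  have "prob {x \<in> space M. - \<theta> * (real m * \<mu> - 2 * \<epsilon> * real n) \<le> - \<theta> * ?S x} \<le> exp (real m * (- \<theta> * (\<mu> - \<epsilon>)) - (- \<theta> * (real m * \<mu> - 2 * \<epsilon> * real n)))"
    using markov[OF lo, of "- \<theta> * (real m * \<mu> - 2 * \<epsilon> * real n)"] by (simp add: emeasure_eq_measure)
  also have "\<dots> \<le> exp (- \<theta> * \<epsilon>) ^ n"
    unfolding e using le by (simp add: algebra_simps)
  finally have 2: "prob {x \<in> space M. - \<theta> * (real m * \<mu> - 2 * \<epsilon> * real n) \<le> - \<theta> * ?S x} \<le> exp (- \<theta> * \<epsilon>) ^ n" .
  have "prob {x \<in> space M. 2 * \<epsilon> * real n < \<bar>?S x - real m * \<mu>\<bar>}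
      \<le> prob ({x \<in> space M. \<theta> * (real m * \<mu> + 2 * \<epsilon> * real n) \<le> \<theta> * ?S x}
          \<union> {x \<in> space M. - \<theta> * (real m * \<mu> - 2 * \<epsilon> * real n) \<le> - \<theta> * ?S x})"
    using \<theta> by (intro finite_measure_mono) (auto simp: abs_if)
  also have "\<dots> \<le> exp (- \<theta> * \<epsilon>) ^ n + exp (- \<theta> * \<epsilon>) ^ n"
    using 1 2 by (intro measure_Un_le[THEN order_trans] add_mono) auto
  finally show ?thesis by simp
qed

lemma summable_poly_geometric:
  fixes q :: real
  assumes "0 < q" "q < 1"
  shows "summable (\<lambda>n. real (n + 1) * q ^ n)"
proof -
  have "summable (\<lambda>n. diffs (\<lambda>_. 1) n * q ^ n)"
    using assms by (intro termdiff_converges[of _ 1]) (auto intro: summable_geometric)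
  then show ?thesis by (simp add: diffs_def)
qed

context stationary
begin

lemma ln_stat_harm:
  assumes "good \<eta>"
  shows "ln (stat_harm \<eta> i j) = (\<Sum>k<j. ln (vinc \<eta> i k)) - (\<Sum>k<i. ln (hinc \<eta> k 0))"
proof -
  have inc: "0 < increment \<eta> c i j" for c i j using assms by (auto simp: good_def)
  have n: "hinc \<eta> k 0 \<noteq> 0" "vinc \<eta> i k \<noteq> 0" for k using inc by (metis less_irrefl)+
  have "ln (stat_harm \<eta> i j) = ln (\<Prod>k<i. 1 / hinc \<eta> k 0) + ln (\<Prod>k<j. vinc \<eta> i k)"
    unfolding stat_harm_def by (intro ln_mult_pos prod_pos) (simp_all add: inc del: increment.simps)
  also have "ln (\<Prod>k<i. 1 / hinc \<eta> k 0) = (\<Sum>k<i. ln (1 / hinc \<eta> k 0))"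
    by (intro ln_prod) (simp_all add: inc n del: increment.simps)
  also have "(\<Sum>k<i. ln (1 / hinc \<eta> k 0)) = (\<Sum>k<i. - ln (hinc \<eta> k 0))"
    by (intro sum.cong refl) (simp add: ln_div inc n del: increment.simps)
  also have "ln (\<Prod>k<j. vinc \<eta> i k) = (\<Sum>k<j. ln (vinc \<eta> i k))"
    by (intro ln_prod) (simp_all add: inc n del: increment.simps)
  finally show ?thesis by (simp add: sum_negf)
qed

text \<open>A pair with \<open>i + j = n\<close> needs one row sum and one column sum, each allowed
  an error of 2 \<epsilon> n. The n + 1 pairs only add a linear factor to a geometric bound, so
  Borel-Cantelli controls all directions at once.\<close>

lemma AE_stat_harm_rate_eps:
  assumes e: "\<epsilon> > 0"
  shows "AE \<eta> in slotM. \<exists>N. \<forall>i j. N \<le> i + j \<longrightarrow> \<bar>ln (stat_harm \<eta> i j) - rate a b l (real i) (real j)\<bar> \<le> 4 * \<epsilon> * real (i + j)"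
proof -
  define \<mu>1 where "\<mu>1 = Digamma (l + a) - Digamma (l + a + b)"
  define \<mu>2 where "\<mu>2 = Digamma l - Digamma (l + a)"
  obtain \<theta>1 where t1: "\<theta>1 > 0"
    "(\<integral>\<^sup>+t. ennreal (t powr \<theta>1) \<partial>beta_real (l + a) b) \<le> ennreal (exp (\<theta>1 * (\<mu>1 + \<epsilon>)))"
    "(\<integral>\<^sup>+t. ennreal (t powr (- \<theta>1)) \<partial>beta_real (l + a) b) \<le> ennreal (exp (- \<theta>1 * (\<mu>1 - \<epsilon>)))"
    unfolding \<mu>1_def by (rule beta_real_exponential_moments[of "l + a" b \<epsilon>]) (use abl e in auto)
  obtain \<theta>2 where t2: "\<theta>2 > 0"
    "(\<integral>\<^sup>+t. ennreal (t powr \<theta>2) \<partial>beta_real l a) \<le> ennreal (exp (\<theta>2 * (\<mu>2 + \<epsilon>)))"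
    "(\<integral>\<^sup>+t. ennreal (t powr (- \<theta>2)) \<partial>beta_real l a) \<le> ennreal (exp (- \<theta>2 * (\<mu>2 - \<epsilon>)))"
    unfolding \<mu>2_def by (rule beta_real_exponential_moments[of l a \<epsilon>]) (use abl e in auto)
  define X where "X m n = {\<eta> \<in> space slotM. 2 * \<epsilon> * real n < \<bar>(\<Sum>k<m. ln (hinc \<eta> k 0)) - real m * \<mu>1\<bar>}" for m n
  define Y where "Y i m n = {\<eta> \<in> space slotM. 2 * \<epsilon> * real n < \<bar>(\<Sum>k<m. ln (vinc \<eta> i k)) - real m * \<mu>2\<bar>}" for i m n
  have Xm: "X m n \<in> sets slotM" and Ym: "Y i m n \<in> sets slotM" for i m n
    unfolding X_def Y_def by measurable
  have gp: "AE \<eta> in slotM. \<forall>k. 0 < hinc \<eta> k 0" "AE \<eta> in slotM. \<forall>k. 0 < vinc \<eta> i k" for i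
    by (rule eventually_mono[OF AE_good], auto simp: good_def simp del: increment.simps)+
  have Xp: "slotM.prob (X m n) \<le> 2 * exp (- \<theta>1 * \<epsilon>) ^ n" if "m \<le> n" for m n
    unfolding X_def by (rule slotM.chernoff_two_sided[OF _ gp(1) row_moments t1 that e]) measurable
  have Yp: "slotM.prob (Y i m n) \<le> 2 * exp (- \<theta>2 * \<epsilon>) ^ n" if "m \<le> n" for i m n
    unfolding Y_def by (rule slotM.chernoff_two_sided[OF _ gp(2) column_moments t2 that e]) measurable
  define A where "A n = (\<Union>i\<le>n. X i n \<union> Y i (n - i) n)" for n
  have Am: "A n \<in> sets slotM" for n unfolding A_def using Xm Ym by auto
  have Ap: "slotM.prob (A n) \<le> real (n + 1) * (2 * exp (- \<theta>1 * \<epsilon>) ^ n + 2 * exp (- \<theta>2 * \<epsilon>) ^ n)" for n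
  proof -
    have "slotM.prob (A n) \<le> (\<Sum>i\<le>n. slotM.prob (X i n \<union> Y i (n - i) n))"
      unfolding A_def using Xm Ym by (intro slotM.finite_measure_subadditive_finite) auto
    also have "\<dots> \<le> (\<Sum>i\<le>n. 2 * exp (- \<theta>1 * \<epsilon>) ^ n + 2 * exp (- \<theta>2 * \<epsilon>) ^ n)"
      using Xm Ym Xp Yp by (intro sum_mono measure_Un_le[THEN order_trans] add_mono) auto
    finally show ?thesis by simp
  qed
  have "summable (\<lambda>n. 2 * (real (n + 1) * exp (- \<theta>1 * \<epsilon>) ^ n) + 2 * (real (n + 1) * exp (- \<theta>2 * \<epsilon>) ^ n))"
    using t1 t2 e by (intro summable_add summable_mult summable_poly_geometric) auto
  then have "summable (\<lambda>n. real (n + 1) * (2 * exp (- \<theta>1 * \<epsilon>) ^ n + 2 * exp (- \<theta>2 * \<epsilon>) ^ n))"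
    by (simp add: algebra_simps)
  then have "summable (\<lambda>n. slotM.prob (A n))"
    by (rule summable_comparison_test'[where N = 0]) (simp only: real_norm_def abs_of_nonneg[OF measure_nonneg] Ap)
  then have "AE \<eta> in slotM. eventually (\<lambda>n. \<eta> \<in> space slotM - A n) sequentially"
    using Am by (intro borel_cantelli_AE1) (auto simp: slotM.emeasure_eq_measure)
  then show ?thesis
    using AE_good
  proof eventually_elim
    fix \<eta> assume ev: "eventually (\<lambda>n. \<eta> \<in> space slotM - A n) sequentially" and g: "good \<eta>"
    from ev obtain N where N: "\<And>n. N \<le> n \<Longrightarrow> \<eta> \<notin> A n" unfolding eventually_sequentially by auto
    show "\<exists>N. \<forall>i j. N \<le> i + j \<longrightarrow> \<bar>ln (stat_harm \<eta> i j) - rate a b l (real i) (real j)\<bar> \<le> 4 * \<epsilon> * real (i + j)"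
    proof (intro exI[of _ N] allI impI)
      fix i j assume "N \<le> i + j"
      then have "\<eta> \<notin> X i (i + j) \<union> Y i (i + j - i) (i + j)"
        using N[of "i + j"] unfolding A_def UN_iff by (metis atMost_iff le_add1)
      then have "\<bar>(\<Sum>k<i. ln (hinc \<eta> k 0)) - real i * \<mu>1\<bar> \<le> 2 * \<epsilon> * real (i + j)"
        "\<bar>(\<Sum>k<j. ln (vinc \<eta> i k)) - real j * \<mu>2\<bar> \<le> 2 * \<epsilon> * real (i + j)"
        unfolding X_def Y_def by (simp_all add: not_less)
      moreover have "rate a b l (real i) (real j) = real j * \<mu>2 - real i * \<mu>1"
        by (simp add: rate_def \<mu>1_def \<mu>2_def)
      ultimately show "\<bar>ln (stat_harm \<eta> i j) - rate a b l (real i) (real j)\<bar> \<le> 4 * \<epsilon> * real (i + j)"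
        unfolding ln_stat_harm[OF g] by linarith
    qed
  qed
qed

lemma AE_stat_harm_rate:
  "AE \<eta> in slotM. \<forall>\<epsilon>>0. \<exists>N. \<forall>i j. N \<le> i + j \<longrightarrow> \<bar>ln (stat_harm \<eta> i j) - rate a b l (real i) (real j)\<bar> \<le> \<epsilon> * real (i + j)"
proof -
  have "AE \<eta> in slotM. \<forall>n. \<exists>N. \<forall>i j. N \<le> i + j \<longrightarrow>
      \<bar>ln (stat_harm \<eta> i j) - rate a b l (real i) (real j)\<bar> \<le> 4 * (1 / real (Suc n)) * real (i + j)"
    by (subst AE_all_countable, rule allI, rule AE_stat_harm_rate_eps) simp
  then show ?thesis
  proof eventually_elim
    fix \<eta> assume *: "\<forall>n. \<exists>N. \<forall>i j. N \<le> i + j \<longrightarrow>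
      \<bar>ln (stat_harm \<eta> i j) - rate a b l (real i) (real j)\<bar> \<le> 4 * (1 / real (Suc n)) * real (i + j)"
    show "\<forall>\<epsilon>>0. \<exists>N. \<forall>i j. N \<le> i + j \<longrightarrow> \<bar>ln (stat_harm \<eta> i j) - rate a b l (real i) (real j)\<bar> \<le> \<epsilon> * real (i + j)"
    proof (intro allI impI)
      fix \<epsilon> :: real assume "\<epsilon> > 0"
      then obtain n where n: "1 / real (Suc n) < \<epsilon> / 4" using nat_approx_posE[of "\<epsilon> / 4"] by auto
      from * obtain N where N: "\<forall>i j. N \<le> i + j \<longrightarrow>
        \<bar>ln (stat_harm \<eta> i j) - rate a b l (real i) (real j)\<bar> \<le> 4 * (1 / real (Suc n)) * real (i + j)" by blast
      have "4 * (1 / real (Suc n)) * real k \<le> \<epsilon> * real k" for k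
        using n by (intro mult_right_mono) auto
      then show "\<exists>N. \<forall>i j. N \<le> i + j \<longrightarrow> \<bar>ln (stat_harm \<eta> i j) - rate a b l (real i) (real j)\<bar> \<le> \<epsilon> * real (i + j)"
        using N by (meson order_trans)
    qed
  qed
qed

end

subsection \<open>Hitting probabilities in a direction\<close>

text \<open>Far points whose direction is near (s, 1 - s). One integer governs both distance and
  aperture, so the countable decreasing family is a base of \<open>toward s\<close>; countability
  keeps lower and upper limits measurable.\<close>

definition cone :: "real \<Rightarrow> nat \<Rightarrow> (nat \<times> nat) set" where
  "cone s M = {(i, j). Suc M \<le> i + j \<and> \<bar>real i - s * real (i + j)\<bar> \<le> real (i + j) / real (Suc M)}"

lemma cone_antimono:
  assumes "M \<le> N"
  shows "cone s N \<subseteq> cone s M"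
proof -
  have *: "real n / real (Suc N) \<le> real n / real (Suc M)" for n
    using assms by (intro divide_left_mono) auto
  show ?thesis
  proof
    fix z assume "z \<in> cone s N"
    then obtain i j where z: "z = (i, j)" "Suc N \<le> i + j" "\<bar>real i - s * real (i + j)\<bar> \<le> real (i + j) / real (Suc N)"
      unfolding cone_def by blast
    have "\<bar>real i - s * real (i + j)\<bar> \<le> real (i + j) / real (Suc M)"
      using z(3) *[of "i + j"] by (rule order_trans)
    then show "z \<in> cone s M" using z(1,2) assms by (simp add: cone_def)
  qed
qed

definition toward :: "real \<Rightarrow> (nat \<times> nat) filter" where
  "toward s = (INF M. principal (cone s M))"

lemma eventually_toward: "eventually P (toward s) \<longleftrightarrow> (\<exists>M. \<forall>z\<in>cone s M. P z)"
  unfolding toward_def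
proof (subst eventually_INF_base)
  fix M N :: nat
  show "\<exists>K\<in>UNIV. principal (cone s K) \<le> inf (principal (cone s M)) (principal (cone s N))"
    using cone_antimono[of M "max M N" s] cone_antimono[of N "max M N" s] by (intro bexI[of _ "max M N"]) auto
qed (simp_all add: eventually_principal)

lemma eventually_toward_ge:
  assumes "0 < s" "s < 1"
  shows "eventually (\<lambda>(i, j). N \<le> i \<and> N \<le> j) (toward s)"
proof -
  define u where "u = min s (1 - s)"
  have u: "u > 0" "u \<le> s" "u \<le> 1 - s" using assms by (auto simp: u_def)
  \<comment> \<open>So large that the aperture 1 / (M + 1) is below u / 2. Each coordinate is then
    at least u / 2 times the coordinate sum, hence at least N.\<close>
  obtain M where M: "real M \<ge> 2 * (real N + 1) / u" using real_arch_simple by blast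
  have M2: "real (Suc M) > 2 * (real N + 1) / u" using M by linarith
  then have SM: "real (Suc M) * u > 2 * (real N + 1)" using u by (simp add: field_simps)
  show ?thesis
    unfolding eventually_toward
  proof (intro exI[of _ M] ballI)
    fix z assume "z \<in> cone s M"
    then obtain i j where z: "z = (i, j)" and n: "Suc M \<le> i + j" and d: "\<bar>real i - s * real (i + j)\<bar> \<le> real (i + j) / real (Suc M)"
      by (auto simp: cone_def)
    have "1 / real (Suc M) \<le> u / 2"
      using SM u by (simp add: field_simps)
    then have "real (i + j) / real (Suc M) \<le> real (i + j) * (u / 2)"
      using mult_left_mono[of "1 / real (Suc M)" "u / 2" "real (i + j)"] by simp
    then have d': "\<bar>real i - s * real (i + j)\<bar> \<le> real (i + j) * (u / 2)" using d by linarith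
    have big: "real (i + j) * u \<ge> 2 * (real N + 1)"
    proof -
      have "real (Suc M) * u \<le> real (i + j) * u" using n u by (intro mult_right_mono) auto
      then show ?thesis using SM by linarith
    qed
    define T where "T = real (i + j)"
    have T: "T = real i + real j" "T \<ge> 0" by (simp_all add: T_def)
    define p where "p = T * s"
    define q where "q = T * u"
    have q1: "q \<le> p" using u T unfolding p_def q_def by (intro mult_left_mono) auto
    have q2: "q \<le> T - p"
      using mult_left_mono[of u "1 - s" T] u T by (simp add: p_def q_def right_diff_distrib)
    have q3: "real i - p \<le> q / 2" "p - real i \<le> q / 2"
    proof -
      have "real i - s * T \<le> T * (u / 2)" "- (real i - s * T) \<le> T * (u / 2)"
        using d' by (simp_all only: abs_le_iff T_def)
      then show "real i - p \<le> q / 2" "p - real i \<le> q / 2" by (simp_all add: p_def q_def mult.commute)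
    qed
    have q4: "q \<ge> 2 * (real N + 1)" using big by (simp add: q_def T_def)
    have "real N \<le> real i" using q1 q3 q4 by argo
    moreover have "real N \<le> real j" using q2 q3 q4 T(1) by argo
    ultimately show "case z of (i, j) \<Rightarrow> N \<le> i \<and> N \<le> j" by (simp add: z)
  qed
qed

lemma toward_neq_bot:
  assumes "0 < s" "s < 1"
  shows "toward s \<noteq> bot"
proof -
  have "cone s M \<noteq> {}" for M
  proof -
    define n where "n = Suc M"
    define i where "i = nat \<lfloor>s * real n\<rfloor>"
    have "s * real n \<ge> 0" "s * real n \<le> real n" using assms by (auto simp: mult_left_le_one_le)
    then have i: "i \<le> n" "\<bar>real i - s * real n\<bar> \<le> 1"
      by (auto simp: i_def le_nat_iff nat_le_iff floor_le_iff) linarith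
    then have "(i, n - i) \<in> cone s M"
      by (simp add: cone_def n_def)
    then show ?thesis by blast
  qed
  then show ?thesis
    unfolding trivial_limit_def eventually_toward by (auto simp: ex_in_conv[symmetric])
qed

text \<open>Exactly in the direction (s, 1 - s) the exponent is - \<kappa> n with n = i + j. The
  aperture of a thin cone costs at most \<kappa> n / 4 and the allowed slack another \<kappa> n / 4.
  The polynomial factor counts the boundary terms to be summed.\<close>

lemma cone_exponential_decay:
  fixes c1 c2 \<kappa> \<delta> :: real
  assumes \<kappa>: "\<kappa> > 0" "(1 - s) * c2 - s * c1 = - \<kappa>" and \<delta>: "\<delta> > 0"
  shows "eventually (\<lambda>(i, j). real (i + j) * exp (real j * c2 - real i * c1 + \<kappa> / 4 * real (i + j)) \<le> \<delta>) (toward s)"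
proof -
  have "(\<lambda>n::nat. real n * exp (- (\<kappa> / 2) * real n)) \<longlonglongrightarrow> 0"
    using \<kappa> by real_asymp
  then have "eventually (\<lambda>n::nat. real n * exp (- (\<kappa> / 2) * real n) < \<delta>) sequentially"
    using \<delta> by (rule order_tendstoD)
  then obtain N where N: "\<And>n. n \<ge> N \<Longrightarrow> real n * exp (- (\<kappa> / 2) * real n) < \<delta>"
    unfolding eventually_sequentially by auto
  define K where "K = \<bar>c1\<bar> + \<bar>c2\<bar>"
  obtain M0 where M0: "real M0 \<ge> 4 * K / \<kappa>" using real_arch_simple by blast
  define M where "M = max N M0"
  have K: "K / real (Suc M) \<le> \<kappa> / 4"
  proof -
    have "4 * K / \<kappa> \<le> real (Suc M)" using M0 by (simp add: M_def)
    then show ?thesis using \<kappa> by (simp add: field_simps)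
  qed
  show ?thesis
    unfolding eventually_toward
  proof (intro exI[of _ M] ballI)
    fix z assume "z \<in> cone s M"
    then obtain i j where z: "z = (i, j)" and n: "Suc M \<le> i + j" and d: "\<bar>real i - s * real (i + j)\<bar> \<le> real (i + j) / real (Suc M)"
      by (auto simp: cone_def)
    define n where "n = i + j"
    define e where "e = real i - s * real n"
    have e: "\<bar>e\<bar> \<le> real n / real (Suc M)" using d by (simp add: e_def n_def)
    have ij: "real i = s * real n + e" "real j = (1 - s) * real n - e" by (simp_all add: e_def n_def algebra_simps)
    have "real j * c2 - real i * c1 = real n * ((1 - s) * c2 - s * c1) - e * (c1 + c2)"
      unfolding ij by (simp add: algebra_simps)
    also have "\<dots> = - \<kappa> * real n - e * (c1 + c2)" unfolding \<kappa>(2) by simp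
    finally have 1: "real j * c2 - real i * c1 = - \<kappa> * real n - e * (c1 + c2)" .
    have "- e * (c1 + c2) \<le> \<bar>- e * (c1 + c2)\<bar>" by (rule abs_ge_self)
    also have "\<dots> \<le> \<bar>e\<bar> * K" unfolding abs_mult K_def by (intro mult_mono) auto
    also have "\<dots> \<le> real n / real (Suc M) * K" using e by (intro mult_right_mono) (auto simp: K_def)
    also have "\<dots> = real n * (K / real (Suc M))" by simp
    also have "\<dots> \<le> real n * (\<kappa> / 4)" using K by (intro mult_left_mono) auto
    finally have "real j * c2 - real i * c1 + \<kappa> / 4 * real n \<le> - (\<kappa> / 2) * real n" using 1 by (simp add: algebra_simps)
    then have "real n * exp (real j * c2 - real i * c1 + \<kappa> / 4 * real n) \<le> real n * exp (- (\<kappa> / 2) * real n)"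
      by (intro mult_left_mono) auto
    also have "\<dots> \<le> \<delta>"
    proof -
      have "N \<le> n" using n by (simp add: n_def M_def)
      then show ?thesis using N[of n] by simp
    qed
    finally show "case z of (i, j) \<Rightarrow> real (i + j) * exp (real j * c2 - real i * c1 + \<kappa> / 4 * real (i + j)) \<le> \<delta>"
      by (simp add: z n_def)
  qed
qed

section \<open>Almost sure bounds for ratios of hitting probabilities\<close>

text \<open>The subtraction is truncated, so the ratio has its meaning only for
  \<open>0 < fst z\<close>, which holds eventually toward an interior direction.\<close>

definition hratio :: "(nat \<times> nat \<Rightarrow> real) \<Rightarrow> nat \<times> nat \<Rightarrow> real" where
  "hratio w z = hit w (fst z - 1) (snd z) 1 0 / hit w (fst z) (snd z) 0 0"

definition vratio :: "(nat \<times> nat \<Rightarrow> real) \<Rightarrow> nat \<times> nat \<Rightarrow> real" where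
  "vratio w z = hit w (fst z) (snd z - 1) 0 1 / hit w (fst z) (snd z) 0 0"

lemma measurable_hit [measurable]: "(\<lambda>w. hit w i j x y) \<in> borel_measurable borelP"
proof -
  have "(\<lambda>w. hit w i j x y) \<in> borel_measurable borelP" for v :: "nat \<times> nat \<Rightarrow> real"
    by (induction v i j x y rule: hit.induct) simp_all
  then show ?thesis .
qed

lemma measurable_hratio [measurable]: "(\<lambda>w. hratio w z) \<in> borel_measurable borelP"
  unfolding hratio_def by measurable

context stationary
begin

text \<open>This law does not involve \<open>l\<close>, and so connects the probability spaces of
  different parameters.\<close>

definition envM :: "(nat \<times> nat \<Rightarrow> real) measure" where "envM = PiM UNIV (\<lambda>_. beta_real a b)"

lemma sets_envM [measurable_cong, simp]: "sets envM = sets borelP"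
  unfolding envM_def by (intro sets_PiM_cong) auto

lemma space_envM [simp]: "space envM = UNIV"
  unfolding envM_def by (simp add: space_PiM)

lemma measurable_dual_env_slotM [measurable]: "dual_env \<in> slotM \<rightarrow>\<^sub>M borelP"
  by (rule measurable_PiM_single') (auto simp: measurable_cong_sets[OF sets_slotM refl])

lemma envM_eq: "envM = distr slotM borelP dual_env"
  unfolding envM_def distr_dual_env ..

lemma AE_envM_iff:
  assumes "{w. P w} \<in> sets borelP"
  shows "(AE w in envM. P w) \<longleftrightarrow> (AE \<eta> in slotM. P (dual_env \<eta>))"
  unfolding envM_eq using assms by (subst AE_distr_iff) (auto simp: space_PiM)

text \<open>By \<open>hit_le\<close> and the normalisation of \<open>stat_harm\<close> at the
  origin, the hitting probability is at most \<open>1 / stat_harm \<eta> i j\<close>, whose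
  exponential rate is known.\<close>

lemma AE_hit_le_rate:
  assumes "\<epsilon> > 0"
  shows "AE w in envM. \<exists>N. \<forall>i j. N \<le> i + j \<longrightarrow> hit w i j 0 0 \<le> exp (- rate a b l (real i) (real j) + \<epsilon> * real (i + j))"
proof (subst AE_envM_iff)
  show "{w. \<exists>N. \<forall>i j. N \<le> i + j \<longrightarrow> hit w i j 0 0 \<le> exp (- rate a b l (real i) (real j) + \<epsilon> * real (i + j))} \<in> sets borelP"
  proof -
    have "{w \<in> space borelP. \<exists>N. \<forall>i j. N \<le> i + j \<longrightarrow> hit w i j 0 0 \<le> exp (- rate a b l (real i) (real j) + \<epsilon> * real (i + j))} \<in> sets borelP"
      by measurable
    then show ?thesis by (simp add: space_PiM)
  qed
  show "AE \<eta> in slotM. \<exists>N. \<forall>i j. N \<le> i + j \<longrightarrow> hit (dual_env \<eta>) i j 0 0 \<le> exp (- rate a b l (real i) (real j) + \<epsilon> * real (i + j))"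
    using AE_stat_harm_rate AE_good
  proof eventually_elim
    fix \<eta> assume r: "\<forall>\<epsilon>>0. \<exists>N. \<forall>i j. N \<le> i + j \<longrightarrow> \<bar>ln (stat_harm \<eta> i j) - rate a b l (real i) (real j)\<bar> \<le> \<epsilon> * real (i + j)"
      and g: "good \<eta>"
    interpret positive_harmonic "dual_env \<eta>" "stat_harm \<eta>" by (rule positive_harmonic_stat_harm[OF g])
    from r assms obtain N where N: "\<And>i j. N \<le> i + j \<Longrightarrow> \<bar>ln (stat_harm \<eta> i j) - rate a b l (real i) (real j)\<bar> \<le> \<epsilon> * real (i + j)"
      by blast
    show "\<exists>N. \<forall>i j. N \<le> i + j \<longrightarrow> hit (dual_env \<eta>) i j 0 0 \<le> exp (- rate a b l (real i) (real j) + \<epsilon> * real (i + j))"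
    proof (intro exI[of _ N] allI impI)
      fix i j assume ij: "N \<le> i + j"
      have "hit (dual_env \<eta>) i j 0 0 * stat_harm \<eta> i j \<le> 1"
        using hit_le[of i j 0 0] by (simp add: stat_harm_0_0)
      then have "hit (dual_env \<eta>) i j 0 0 \<le> 1 / stat_harm \<eta> i j"
        using pos[of i j] by (simp add: field_simps)
      also have "\<dots> = exp (- ln (stat_harm \<eta> i j))" using pos[of i j] by (simp add: exp_minus inverse_eq_divide)
      also have "\<dots> \<le> exp (- rate a b l (real i) (real j) + \<epsilon> * real (i + j))" using N[OF ij] by simp
      finally show "hit (dual_env \<eta>) i j 0 0 \<le> exp (- rate a b l (real i) (real j) + \<epsilon> * real (i + j))" .
    qed
  qed
qed

text \<open>In the harmonic equation at the origin the vertical term is strictly positive. The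
  strict inequality later keeps the limit of the vertical ratio away from 0.\<close>

lemma env_less_hinc: "good \<eta> \<Longrightarrow> dual_env \<eta> (0, 0) < hinc \<eta> 0 0"
proof -
  assume g: "good \<eta>"
  interpret positive_harmonic "dual_env \<eta>" "stat_harm \<eta>" by (rule positive_harmonic_stat_harm[OF g])
  have v: "hinc \<eta> 0 0 > 0" using g by (auto simp: good_def simp del: increment.simps)
  have "stat_harm \<eta> 0 0 > dual_env \<eta> (0, 0) * stat_harm \<eta> (Suc 0) 0"
    using H_eq[of 0 0] w_lt_1[of "(0, 0)"] pos[of 0 "Suc 0"] by simp
  then show ?thesis
    unfolding stat_harm_Suc_left[OF g] stat_harm_0_0 using v by (simp add: field_simps del: increment.simps)
qed

end

context stationary
begin

text \<open>The bound derived from the parameter \<open>l'\<close> concerns the environment alone,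
  so it holds on the space of the parameter \<open>l\<close> as well.\<close>

lemma AE_hit_le_rate_slotM:
  assumes "l' > 0" "\<epsilon> > 0"
  shows "AE \<eta> in slotM. \<exists>N. \<forall>i j. N \<le> i + j \<longrightarrow>
    hit (dual_env \<eta>) i j 0 0 \<le> exp (- rate a b l' (real i) (real j) + \<epsilon> * real (i + j))"
proof -
  interpret S': stationary a b l' using abl assms by unfold_locales
  show ?thesis
    using S'.AE_hit_le_rate[OF assms(2)] unfolding envM_eq
    by (rule AE_distrD[rotated]) measurable
qed

lemma rate_diff:
  "rate a b l x y - rate a b l' x y = y * ((Digamma l - Digamma (l + a)) - (Digamma l' - Digamma (l' + a)))
     - x * ((Digamma (l + a) - Digamma (l + a + b)) - (Digamma (l' + a) - Digamma (l' + a + b)))"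
  by (simp add: rate_def algebra_simps)

lemma boundary_term_bound:
  assumes h: "h \<le> exp (- rate a b l' x y + \<epsilon> * n)" and H: "\<bar>ln H - rate a b l x y\<bar> \<le> \<epsilon> * n" "H > 0"
    and d: "rate a b l x y - rate a b l' x y \<le> D"
  shows "h * H \<le> exp (D + 2 * \<epsilon> * n)"
proof -
  have "H = exp (ln H)" using H by simp
  also have "\<dots> \<le> exp (rate a b l x y + \<epsilon> * n)" unfolding exp_le_cancel_iff using H(1) by linarith
  finally have "h * H \<le> exp (- rate a b l' x y + \<epsilon> * n) * exp (rate a b l x y + \<epsilon> * n)"
    using h H by (intro mult_mono) auto
  also have "\<dots> \<le> exp (D + 2 * \<epsilon> * n)"
    unfolding exp_add[symmetric] using d by simp
  finally show ?thesis .
qed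

text \<open>The error of \<open>hit_ratio_lower\<close> sums over the right side of the rectangle.
  As \<open>l' < l\<close>, the rate difference increases along that side (\<open>c2 > 0\<close>),
  so each term is bounded by its value at the corner, where the exponent is close to - \<kappa> (i +
  j).\<close>

lemma AE_hratio_lower:
  assumes s: "0 < s" "s < 1" and l': "0 < l'" "l' < l"
    and less: "rate a b l s (1 - s) < rate a b l' s (1 - s)"
  shows "AE \<eta> in slotM. \<forall>\<delta>>0. eventually (\<lambda>z. 1 / hinc \<eta> 0 0 - \<delta> \<le> hratio (dual_env \<eta>) z) (toward s)"
proof -
  define \<kappa> where "\<kappa> = rate a b l' s (1 - s) - rate a b l s (1 - s)"
  define c2 where "c2 = (Digamma l - Digamma (l + a)) - (Digamma l' - Digamma (l' + a))"
  define c1 where "c1 = (Digamma (l + a) - Digamma (l + a + b)) - (Digamma (l' + a) - Digamma (l' + a + b))"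
  have \<kappa>: "\<kappa> > 0" "(1 - s) * c2 - s * c1 = - \<kappa>"
    using less rate_diff[of s "1 - s" l'] by (simp_all add: \<kappa>_def c1_def c2_def)
  \<comment> \<open>The hitting probability and the harmonic function each contribute an error
    \<kappa> / 8, and \<open>boundary_term_bound\<close> doubles it to the \<kappa> / 4 of
    \<open>cone_exponential_decay\<close>.\<close>
  have \<kappa>8: "\<kappa> / 8 > 0" using \<kappa> by simp
  have c2: "c2 > 0" using rate_increments_strict_mono(1)[OF abl(1,2) l'] by (simp add: c2_def)
  show ?thesis
    using AE_hit_le_rate_slotM[OF l'(1) \<kappa>8] AE_stat_harm_rate AE_good
  proof eventually_elim
    case (elim \<eta>)
    note g = elim(3)
    interpret positive_harmonic "dual_env \<eta>" "stat_harm \<eta>" by (rule positive_harmonic_stat_harm[OF g])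
    from elim(1) \<kappa>(1) obtain N1 where N1: "\<And>i j. N1 \<le> i + j \<Longrightarrow>
      hit (dual_env \<eta>) i j 0 0 \<le> exp (- rate a b l' (real i) (real j) + \<kappa> / 8 * real (i + j))" by auto
    from elim(2)[rule_format, of "\<kappa> / 8"] \<kappa>(1) obtain N2 where N2: "\<And>i j. N2 \<le> i + j \<Longrightarrow>
      \<bar>ln (stat_harm \<eta> i j) - rate a b l (real i) (real j)\<bar> \<le> \<kappa> / 8 * real (i + j)" by auto
    define N where "N = max 1 (max N1 N2)"
    show "\<forall>\<delta>>0. eventually (\<lambda>z. 1 / hinc \<eta> 0 0 - \<delta> \<le> hratio (dual_env \<eta>) z) (toward s)"
    proof (intro allI impI)
      fix \<delta> :: real assume "\<delta> > 0"
      then have "\<delta> * dual_env \<eta> (0, 0) > 0" using w_pos by simp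
      from cone_exponential_decay[OF \<kappa> this] eventually_toward_ge[OF s, of N]
      show "eventually (\<lambda>z. 1 / hinc \<eta> 0 0 - \<delta> \<le> hratio (dual_env \<eta>) z) (toward s)"
      proof eventually_elim
        case (elim z)
        obtain i j where z: "z = (i, j)" by (cases z)
        have e: "real (i + j) * exp (real j * c2 - real i * c1 + \<kappa> / 4 * real (i + j)) \<le> \<delta> * dual_env \<eta> (0, 0)"
          and ij: "N \<le> i" "N \<le> j" using elim by (auto simp: z)
        obtain m where m: "i = Suc m" using ij by (cases i) (auto simp: N_def)
        obtain n where n: "j = Suc n" using ij by (cases j) (auto simp: N_def)
        have "(\<Sum>y<j. hit (dual_env \<eta>) i y 0 0 * stat_harm \<eta> i y)
            \<le> (\<Sum>y<j. exp (real j * c2 - real i * c1 + \<kappa> / 4 * real (i + j)))"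
        proof (intro sum_mono)
          fix y assume "y \<in> {..<j}"
          then have y: "y < j" by simp
          \<comment> \<open>Since \<open>i\<close> alone is beyond \<open>N\<close>, both asymptotic
            bounds apply at every height \<open>y\<close>, including 0.\<close>
          have "hit (dual_env \<eta>) i y 0 0 * stat_harm \<eta> i y
              \<le> exp ((real y * c2 - real i * c1) + 2 * (\<kappa> / 8) * real (i + y))"
            using ij by (intro boundary_term_bound[OF N1 N2]) (auto simp: N_def pos rate_diff c1_def c2_def)
          also have "\<dots> \<le> exp (real j * c2 - real i * c1 + \<kappa> / 4 * real (i + j))"
            using y c2 \<kappa>(1) by (auto intro!: add_mono diff_mono mult_mono)
          finally show "hit (dual_env \<eta>) i y 0 0 * stat_harm \<eta> i y \<le> exp (real j * c2 - real i * c1 + \<kappa> / 4 * real (i + j))" .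
        qed
        also have "\<dots> = real j * exp (real j * c2 - real i * c1 + \<kappa> / 4 * real (i + j))" by simp
        also have "\<dots> \<le> real (i + j) * exp (real j * c2 - real i * c1 + \<kappa> / 4 * real (i + j))"
          by (intro mult_right_mono) auto
        also note e
        finally have "(\<Sum>y<j. hit (dual_env \<eta>) i y 0 0 * stat_harm \<eta> i y) / dual_env \<eta> (0, 0) \<le> \<delta>"
          using w_pos[of "(0, 0)"] by (simp add: pos_divide_le_eq)
        then show "1 / hinc \<eta> 0 0 - \<delta> \<le> hratio (dual_env \<eta>) z"
          using hit_ratio_lower[of m n] stat_harm_Suc_left[OF g, of 0 0]
          by (simp add: hratio_def z m n stat_harm_0_0 del: hit.simps sum.lessThan_Suc increment.simps)
      qed
    qed
  qed
qed

text \<open>Now the top side counts. With \<open>l < l'\<close> the sign of \<open>c1\<close> is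
  negative, so along the top the rate difference increases to the right and is again largest at the
  corner.\<close>

lemma AE_hratio_upper:
  assumes s: "0 < s" "s < 1" and l': "l < l'"
    and less: "rate a b l s (1 - s) < rate a b l' s (1 - s)"
  shows "AE \<eta> in slotM. \<forall>\<delta>>0. eventually (\<lambda>z. hratio (dual_env \<eta>) z \<le> 1 / hinc \<eta> 0 0 + \<delta>) (toward s)"
proof -
  define \<kappa> where "\<kappa> = rate a b l' s (1 - s) - rate a b l s (1 - s)"
  define c2 where "c2 = (Digamma l - Digamma (l + a)) - (Digamma l' - Digamma (l' + a))"
  define c1 where "c1 = (Digamma (l + a) - Digamma (l + a + b)) - (Digamma (l' + a) - Digamma (l' + a + b))"
  have \<kappa>: "\<kappa> > 0" "(1 - s) * c2 - s * c1 = - \<kappa>"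
    using less rate_diff[of s "1 - s" l'] by (simp_all add: \<kappa>_def c1_def c2_def)
  have \<kappa>8: "\<kappa> / 8 > 0" using \<kappa> by simp
  have c1: "c1 < 0" using rate_increments_strict_mono(2)[OF abl l'] by (simp add: c1_def)
  have "l' > 0" using abl l' by simp
  show ?thesis
    using AE_hit_le_rate_slotM[OF \<open>l' > 0\<close> \<kappa>8] AE_stat_harm_rate AE_good
  proof eventually_elim
    case (elim \<eta>)
    note g = elim(3)
    interpret positive_harmonic "dual_env \<eta>" "stat_harm \<eta>" by (rule positive_harmonic_stat_harm[OF g])
    from elim(1) \<kappa>(1) obtain N1 where N1: "\<And>i j. N1 \<le> i + j \<Longrightarrow>
      hit (dual_env \<eta>) i j 0 0 \<le> exp (- rate a b l' (real i) (real j) + \<kappa> / 8 * real (i + j))" by auto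
    from elim(2)[rule_format, of "\<kappa> / 8"] \<kappa>(1) obtain N2 where N2: "\<And>i j. N2 \<le> i + j \<Longrightarrow>
      \<bar>ln (stat_harm \<eta> i j) - rate a b l (real i) (real j)\<bar> \<le> \<kappa> / 8 * real (i + j)" by auto
    define N where "N = max 1 (max N1 N2)"
    show "\<forall>\<delta>>0. eventually (\<lambda>z. hratio (dual_env \<eta>) z \<le> 1 / hinc \<eta> 0 0 + \<delta>) (toward s)"
    proof (intro allI impI)
      fix \<delta> :: real assume "\<delta> > 0"
      then have "\<delta> * dual_env \<eta> (0, 0) > 0" using w_pos by simp
      from cone_exponential_decay[OF \<kappa> this] eventually_toward_ge[OF s, of N]
      show "eventually (\<lambda>z. hratio (dual_env \<eta>) z \<le> 1 / hinc \<eta> 0 0 + \<delta>) (toward s)"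
      proof eventually_elim
        case (elim z)
        obtain i j where z: "z = (i, j)" by (cases z)
        have e: "real (i + j) * exp (real j * c2 - real i * c1 + \<kappa> / 4 * real (i + j)) \<le> \<delta> * dual_env \<eta> (0, 0)"
          and ij: "N \<le> i" "N \<le> j" using elim by (auto simp: z)
        obtain m where m: "i = Suc m" using ij by (cases i) (auto simp: N_def)
        obtain n where n: "j = Suc n" using ij by (cases j) (auto simp: N_def)
        have "(\<Sum>x<i. hit (dual_env \<eta>) x j 0 0 * stat_harm \<eta> x j)
            \<le> (\<Sum>x<i. exp (real j * c2 - real i * c1 + \<kappa> / 4 * real (i + j)))"
        proof (intro sum_mono)
          fix x assume "x \<in> {..<i}"
          then have x: "x < i" by simp
          have "hit (dual_env \<eta>) x j 0 0 * stat_harm \<eta> x j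
              \<le> exp ((real j * c2 - real x * c1) + 2 * (\<kappa> / 8) * real (x + j))"
            using ij by (intro boundary_term_bound[OF N1 N2]) (auto simp: N_def pos rate_diff c1_def c2_def)
          also have "\<dots> \<le> exp (real j * c2 - real i * c1 + \<kappa> / 4 * real (i + j))"
            using x c1 \<kappa>(1) by (auto intro!: add_mono diff_mono mult_mono mult_right_mono_neg)
          finally show "hit (dual_env \<eta>) x j 0 0 * stat_harm \<eta> x j \<le> exp (real j * c2 - real i * c1 + \<kappa> / 4 * real (i + j))" .
        qed
        also have "\<dots> = real i * exp (real j * c2 - real i * c1 + \<kappa> / 4 * real (i + j))" by simp
        also have "\<dots> \<le> real (i + j) * exp (real j * c2 - real i * c1 + \<kappa> / 4 * real (i + j))"
          by (intro mult_right_mono) auto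
        also note e
        finally have "(\<Sum>x<i. hit (dual_env \<eta>) x j 0 0 * stat_harm \<eta> x j) / dual_env \<eta> (0, 0) \<le> \<delta>"
          using w_pos[of "(0, 0)"] by (simp add: pos_divide_le_eq)
        then show "hratio (dual_env \<eta>) z \<le> 1 / hinc \<eta> 0 0 + \<delta>"
          using hit_ratio_upper[of m n] stat_harm_Suc_left[OF g, of 0 0]
          by (simp add: hratio_def z m n stat_harm_0_0 del: hit.simps sum.lessThan_Suc increment.simps)
      qed
    qed
  qed
qed

end

section \<open>Lower and upper limits of the ratios as functionals of the environment\<close>

text \<open>The limit inferior of \<open>hratio\<close> along \<open>toward s\<close>, written over
  the countable base. It is extended-real valued so that it can be inverted and integrated without
  knowing that it is finite.\<close>

definition lower_ratio :: "real \<Rightarrow> (nat \<times> nat \<Rightarrow> real) \<Rightarrow> ennreal" where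
  "lower_ratio s w = (SUP M. INF z\<in>cone s M. ennreal (hratio w z))"

definition upper_ratio :: "real \<Rightarrow> (nat \<times> nat \<Rightarrow> real) \<Rightarrow> ennreal" where
  "upper_ratio s w = (INF M. SUP z\<in>cone s M. ennreal (hratio w z))"

lemma measurable_lower_ratio [measurable]: "lower_ratio s \<in> borel_measurable borelP"
  unfolding lower_ratio_def[abs_def] by measurable

lemma measurable_upper_ratio [measurable]: "upper_ratio s \<in> borel_measurable borelP"
  unfolding upper_ratio_def[abs_def] by measurable

lemma lower_ratio_ge:
  assumes "\<And>\<delta>. \<delta> > 0 \<Longrightarrow> eventually (\<lambda>z. c - \<delta> \<le> hratio w z) (toward s)"
  shows "ennreal c \<le> lower_ratio s w"
proof (rule ennreal_le_epsilon)
  fix e :: real assume "0 < e"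
  then obtain M where M: "\<And>z. z \<in> cone s M \<Longrightarrow> c - e \<le> hratio w z"
    using assms[of e] unfolding eventually_toward by auto
  have "ennreal (c - e) \<le> (INF z\<in>cone s M. ennreal (hratio w z))"
    by (intro INF_greatest ennreal_leI M)
  also have "\<dots> \<le> lower_ratio s w" unfolding lower_ratio_def by (rule SUP_upper) simp
  finally have "ennreal (c - e) + ennreal e \<le> lower_ratio s w + ennreal e" by (rule add_right_mono)
  moreover have "ennreal c \<le> ennreal (c - e) + ennreal e"
    using \<open>0 < e\<close> by (cases "c - e \<ge> 0") (simp_all flip: ennreal_plus add: ennreal_leI ennreal_neg)
  ultimately show "ennreal c \<le> lower_ratio s w + ennreal e" by (rule order_trans[rotated])
qed

lemma upper_ratio_le:
  assumes "\<And>\<delta>. \<delta> > 0 \<Longrightarrow> eventually (\<lambda>z. hratio w z \<le> c + \<delta>) (toward s)" and "c \<ge> 0"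
  shows "upper_ratio s w \<le> ennreal c"
proof (rule ennreal_le_epsilon)
  fix e :: real assume "0 < e"
  then obtain M where M: "\<And>z. z \<in> cone s M \<Longrightarrow> hratio w z \<le> c + e"
    using assms(1)[of e] unfolding eventually_toward by auto
  have "upper_ratio s w \<le> (SUP z\<in>cone s M. ennreal (hratio w z))"
    unfolding upper_ratio_def by (rule INF_lower) simp
  also have "\<dots> \<le> ennreal (c + e)" by (intro SUP_least ennreal_leI M)
  also have "\<dots> = ennreal c + ennreal e" using assms(2) \<open>0 < e\<close> by simp
  finally show "upper_ratio s w \<le> ennreal c + ennreal e" .
qed

lemma lower_ratio_le_upper_ratio:
  assumes "0 < s" "s < 1"
  shows "lower_ratio s w \<le> upper_ratio s w"
  unfolding lower_ratio_def upper_ratio_def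
proof (intro SUP_least INF_greatest)
  fix M N :: nat
  have "cone s (max M N) \<noteq> {}"
    using toward_neq_bot[OF assms] unfolding trivial_limit_def eventually_toward by blast
  then obtain z where "z \<in> cone s (max M N)" by blast
  then have z: "z \<in> cone s M" "z \<in> cone s N"
    using cone_antimono[of M "max M N" s] cone_antimono[of N "max M N" s] by auto
  have "(INF z\<in>cone s M. ennreal (hratio w z)) \<le> ennreal (hratio w z)" by (rule INF_lower) (rule z)
  also have "\<dots> \<le> (SUP z\<in>cone s N. ennreal (hratio w z))" by (rule SUP_upper) (rule z)
  finally show "(INF z\<in>cone s M. ennreal (hratio w z)) \<le> (SUP z\<in>cone s N. ennreal (hratio w z))" .
qed

lemma hratio_tendsto:
  assumes "lower_ratio s w \<ge> ennreal c" "upper_ratio s w \<le> ennreal c" "c \<ge> 0" "\<And>z. 0 \<le> hratio w z"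
  shows "(hratio w \<longlongrightarrow> c) (toward s)"
proof -
  have "((\<lambda>z. ennreal (hratio w z)) \<longlongrightarrow> ennreal c) (toward s)"
  proof (rule order_tendstoI)
    fix y assume "y < ennreal c"
    then have "y < lower_ratio s w" using assms(1) by (rule less_le_trans)
    then obtain M where "y < (INF z\<in>cone s M. ennreal (hratio w z))"
      unfolding lower_ratio_def less_SUP_iff by auto
    then have "\<forall>z\<in>cone s M. y < ennreal (hratio w z)" by (auto dest: less_INF_D)
    then show "eventually (\<lambda>z. y < ennreal (hratio w z)) (toward s)" unfolding eventually_toward by blast
  next
    fix y assume "ennreal c < y"
    then have "upper_ratio s w < y" using assms(2) by (rule le_less_trans[rotated])
    then obtain M where "(SUP z\<in>cone s M. ennreal (hratio w z)) < y"
      unfolding upper_ratio_def INF_less_iff by auto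
    then have "\<forall>z\<in>cone s M. ennreal (hratio w z) < y" by (auto dest: SUP_lessD)
    then show "eventually (\<lambda>z. ennreal (hratio w z) < y) (toward s)" unfolding eventually_toward by blast
  qed
  then show ?thesis using assms(3,4) by (intro tendsto_ennrealD) auto
qed

lemma ennreal_inverse_le_iff: "inverse x \<le> inverse y \<longleftrightarrow> y \<le> (x :: ennreal)"
proof (cases "x = 0 \<or> y = 0 \<or> x = top \<or> y = top")
  case True
  then show ?thesis by (auto simp: top_unique)
next
  case False
  then obtain r s where "x = ennreal r" "0 < r" "y = ennreal s" "0 < s"
    by (cases x; cases y) (auto simp: ennreal_eq_0_iff)
  then show ?thesis by (simp add: inverse_ennreal ennreal_le_iff)
qed

lemmas ennreal_inverse_antimono = ennreal_inverse_le_iff[THEN iffD2]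

text \<open>The gap is nonnegative with integral 0. Finiteness of the smaller integral justifies the
  subtraction.\<close>

lemma AE_le_of_nn_integral_le:
  assumes [measurable]: "f \<in> borel_measurable M" "g \<in> borel_measurable M"
    and "AE x in M. f x \<le> g x" "(\<integral>\<^sup>+x. g x \<partial>M) \<le> (\<integral>\<^sup>+x. f x \<partial>M)" "(\<integral>\<^sup>+x. f x \<partial>M) \<noteq> \<infinity>"
  shows "AE x in M. g x \<le> f x"
proof -
  have "(\<integral>\<^sup>+x. g x - f x \<partial>M) = (\<integral>\<^sup>+x. g x \<partial>M) - (\<integral>\<^sup>+x. f x \<partial>M)"
    using assms by (intro nn_integral_diff) auto
  also have "\<dots> = 0" using assms(4,5) by (auto simp: diff_eq_0_iff_ennreal less_top intro: order_le_less_trans)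
  finally have "AE x in M. g x - f x = 0" by (subst (asm) nn_integral_0_iff_AE) auto
  then show ?thesis using assms(3) by eventually_elim (auto simp: diff_eq_0_iff_ennreal)
qed

context stationary
begin

sublocale envM: prob_space envM
  unfolding envM_def using abl by (intro prob_space_PiM prob_space_beta_real) auto

lemma nn_integral_envM:
  assumes "f \<in> borel_measurable borelP"
  shows "(\<integral>\<^sup>+w. f w \<partial>envM) = (\<integral>\<^sup>+\<eta>. f (dual_env \<eta>) \<partial>slotM)"
  unfolding envM_eq using assms by (intro nn_integral_distr) measurable

lemma nn_integral_hinc: "(\<integral>\<^sup>+\<eta>. ennreal (hinc \<eta> 0 0) \<partial>slotM) = ennreal ((l + a) / (l + a + b))"
  using row_moments[of ennreal 1] abl by (simp add: beta_real_mean)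

lemma AE_envM: "AE w in envM. \<forall>x. 0 < w x \<and> w x < 1"
proof (subst AE_all_countable, rule allI)
  show "AE w in envM. 0 < w x \<and> w x < 1" for x
    unfolding envM_def using abl by (intro AE_PiM_component[of _ _ x "\<lambda>t. 0 < t \<and> t < 1"] prob_space_beta_real AE_beta_real) auto
qed

text \<open>The inverse of the lower limit is dominated by \<open>hinc \<eta> 0 0\<close>, a Beta(l
  + a, b) variable with the mean shown. As this variable is below 1, the lower limit is at least 1,
  so no limit of the ratio can be 0.\<close>

lemma lower_ratio_bound:
  assumes s: "0 < s" "s < 1" and l': "0 < l'" "l' < l" "rate a b l s (1 - s) < rate a b l' s (1 - s)"
  shows "(\<integral>\<^sup>+w. inverse (lower_ratio s w) \<partial>envM) \<le> ennreal ((l + a) / (l + a + b))"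
    and "AE w in envM. 1 \<le> lower_ratio s w"
proof -
  have 1: "AE \<eta> in slotM. ennreal (1 / hinc \<eta> 0 0) \<le> lower_ratio s (dual_env \<eta>)"
    using AE_hratio_lower[OF s l'] by eventually_elim (auto intro: lower_ratio_ge)
  have "(\<integral>\<^sup>+w. inverse (lower_ratio s w) \<partial>envM) = (\<integral>\<^sup>+\<eta>. inverse (lower_ratio s (dual_env \<eta>)) \<partial>slotM)"
    by (intro nn_integral_envM) measurable
  also have "\<dots> \<le> (\<integral>\<^sup>+\<eta>. ennreal (hinc \<eta> 0 0) \<partial>slotM)"
  proof (rule nn_integral_mono_AE, use 1 AE_good in eventually_elim)
    case (elim \<eta>)
    have v: "hinc \<eta> 0 0 > 0" using elim(2) by (auto simp: good_def simp del: increment.simps)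
    have "inverse (lower_ratio s (dual_env \<eta>)) \<le> inverse (ennreal (1 / hinc \<eta> 0 0))"
      using elim(1) by (rule ennreal_inverse_antimono)
    then show ?case using v by (simp add: inverse_ennreal del: increment.simps)
  qed
  finally show "(\<integral>\<^sup>+w. inverse (lower_ratio s w) \<partial>envM) \<le> ennreal ((l + a) / (l + a + b))"
    unfolding nn_integral_hinc .
  have "AE \<eta> in slotM. 1 \<le> lower_ratio s (dual_env \<eta>)"
    using 1 AE_good
  proof eventually_elim
    case (elim \<eta>)
    have v: "0 < hinc \<eta> 0 0 \<and> hinc \<eta> 0 0 < 1" using elim(2) by (auto simp: good_def simp del: increment.simps)
    then have "ennreal 1 \<le> ennreal (1 / hinc \<eta> 0 0)" by (intro ennreal_leI) (simp add: field_simps del: increment.simps)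
    then show ?case using elim(1) by (metis ennreal_1 order_trans)
  qed
  then show "AE w in envM. 1 \<le> lower_ratio s w"
  proof (subst AE_envM_iff)
    have "{w \<in> space borelP. 1 \<le> lower_ratio s w} \<in> sets borelP" by measurable
    then show "{w. 1 \<le> lower_ratio s w} \<in> sets borelP" by (simp add: space_PiM)
  qed
qed

text \<open>The reverse comparison with the same beta variable. Since that variable is below 1, the
  inverse may be truncated at 1, which keeps the integral finite. The second claim uses
  \<open>env_less_hinc\<close>.\<close>

lemma upper_ratio_bound:
  assumes s: "0 < s" "s < 1" and l': "l < l'" "rate a b l s (1 - s) < rate a b l' s (1 - s)"
  shows "ennreal ((l + a) / (l + a + b)) \<le> (\<integral>\<^sup>+w. min 1 (inverse (upper_ratio s w)) \<partial>envM)"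
    and "AE w in envM. upper_ratio s w * ennreal (w (0, 0)) < 1"
proof -
  have 1: "AE \<eta> in slotM. upper_ratio s (dual_env \<eta>) \<le> ennreal (1 / hinc \<eta> 0 0)"
    using AE_hratio_upper[OF s l'] AE_good
  proof eventually_elim
    case (elim \<eta>)
    have "0 \<le> 1 / hinc \<eta> 0 0" using elim(2) by (auto simp: good_def less_imp_le simp del: increment.simps)
    then show ?case using elim(1) by (intro upper_ratio_le) auto
  qed
  have "(\<integral>\<^sup>+\<eta>. ennreal (hinc \<eta> 0 0) \<partial>slotM) \<le> (\<integral>\<^sup>+\<eta>. min 1 (inverse (upper_ratio s (dual_env \<eta>))) \<partial>slotM)"
  proof (rule nn_integral_mono_AE, use 1 AE_good in eventually_elim)
    case (elim \<eta>)
    have v: "hinc \<eta> 0 0 > 0" "hinc \<eta> 0 0 < 1" using elim(2) by (auto simp: good_def simp del: increment.simps)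
    have "inverse (ennreal (1 / hinc \<eta> 0 0)) \<le> inverse (upper_ratio s (dual_env \<eta>))"
      using elim(1) by (rule ennreal_inverse_antimono)
    moreover have "ennreal (hinc \<eta> 0 0) \<le> 1" using v by (simp add: ennreal_le_1 del: increment.simps)
    ultimately show ?case using v by (simp add: inverse_ennreal del: increment.simps)
  qed
  also have "\<dots> = (\<integral>\<^sup>+w. min 1 (inverse (upper_ratio s w)) \<partial>envM)"
    by (intro nn_integral_envM[symmetric]) measurable
  finally show "ennreal ((l + a) / (l + a + b)) \<le> (\<integral>\<^sup>+w. min 1 (inverse (upper_ratio s w)) \<partial>envM)"
    unfolding nn_integral_hinc .
  have "AE \<eta> in slotM. upper_ratio s (dual_env \<eta>) * ennreal (dual_env \<eta> (0, 0)) < 1"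
    using 1 AE_good
  proof eventually_elim
    case (elim \<eta>)
    have v: "hinc \<eta> 0 0 > 0" and w: "dual_env \<eta> (0, 0) > 0" using elim(2) by (auto simp: good_def simp del: increment.simps)
    have "upper_ratio s (dual_env \<eta>) * ennreal (dual_env \<eta> (0, 0)) \<le> ennreal (1 / hinc \<eta> 0 0) * ennreal (dual_env \<eta> (0, 0))"
      using elim(1) by (rule mult_right_mono) simp
    also have "\<dots> = ennreal (dual_env \<eta> (0, 0) / hinc \<eta> 0 0)"
      using v w by (simp flip: ennreal_mult del: increment.simps)
    also have "\<dots> < ennreal 1"
      using env_less_hinc[OF elim(2)] v by (intro ennreal_lessI) (auto simp: field_simps simp del: increment.simps)
    finally show ?case by simp
  qed
  then show "AE w in envM. upper_ratio s w * ennreal (w (0, 0)) < 1"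
  proof (subst AE_envM_iff)
    have "{w \<in> space borelP. upper_ratio s w * ennreal (w (0, 0)) < 1} \<in> sets borelP" by measurable
    then show "{w. upper_ratio s w * ennreal (w (0, 0)) < 1} \<in> sets borelP" by (simp add: space_PiM)
  qed
qed

end

lemma stationary_envM_eq: "stationary.envM a b = PiM UNIV (\<lambda>_::nat\<times>nat. beta_real a b)" if "a > 0" "b > 0"
  using stationary.envM_def[of a b 1] that by (simp add: stationary_def)

abbreviation "beta_envN a b \<equiv> PiM UNIV (\<lambda>_::nat \<times> nat. beta_real a b)"

lemma sets_beta_envN: "sets (beta_envN a b) = sets borelP"
  by (intro sets_PiM_cong) auto

lemma hratio_nonneg:
  assumes "\<forall>x. 0 < w x \<and> w x < 1"
  shows "0 \<le> hratio w z"
  unfolding hratio_def using hit_pos[of w] assms by (intro divide_nonneg_pos less_imp_le) auto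

text \<open>Parameters above the critical \<open>k\<close> bound the mean of the inverse lower limit
  by \<open>g l\<close>, those below bound the mean of the inverse upper limit by \<open>g l\<close>
  from the other side. Continuity of \<open>g\<close> at \<open>k\<close> closes the gap. The
  comparison parameter is always \<open>k\<close> itself.\<close>

lemma hratio_convergent_above:
  assumes ab: "a > 0" "b > 0" and s: "0 < s" "s < 1" "s * b > (1 - s) * a"
  shows "AE w in beta_envN a b. \<exists>c>0. c * w (0, 0) < 1 \<and> (hratio w \<longlongrightarrow> c) (toward s)"
proof -
  let ?E = "beta_envN a b"
  have st: "stationary a b l" if "l > 0" for l using ab that by unfold_locales
  have E: "stationary.envM a b = ?E" by (rule stationary_envM_eq[OF ab])
  interpret E: prob_space ?E using ab by (intro prob_space_PiM prob_space_beta_real)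
  obtain k where k: "k > 0"
    "\<And>l m. 0 < l \<Longrightarrow> l < m \<Longrightarrow> m \<le> k \<Longrightarrow> rate a b l s (1 - s) < rate a b m s (1 - s)"
    "\<And>l m. k \<le> l \<Longrightarrow> l < m \<Longrightarrow> rate a b m s (1 - s) < rate a b l s (1 - s)"
    by (rule rate_unimodal[OF ab s(1) _ s(3)]) (use s in auto)
  define g where "g l = (l + a) / (l + a + b)" for l
  have g: "isCont g k" unfolding g_def using k ab by (intro continuous_intros) auto
  have lo: "(\<integral>\<^sup>+w. inverse (lower_ratio s w) \<partial>?E) \<le> ennreal (g l)" "AE w in ?E. 1 \<le> lower_ratio s w" if "l > k" for l
    using stationary.lower_ratio_bound[OF st s(1,2) k(1) that k(3)[OF order_refl that]] k(1) that
    unfolding E g_def by auto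
  have up: "ennreal (g l) \<le> (\<integral>\<^sup>+w. min 1 (inverse (upper_ratio s w)) \<partial>?E)"
    "AE w in ?E. upper_ratio s w * ennreal (w (0, 0)) < 1" if "0 < l" "l < k" for l
    using stationary.upper_ratio_bound[OF st s(1,2) that(2) k(2)[OF that order_refl]] that
    unfolding E g_def by auto
  have "(\<integral>\<^sup>+w. inverse (lower_ratio s w) \<partial>?E) \<le> ennreal (g k)"
  proof (rule LIMSEQ_le_const)
    have "(\<lambda>n. k + 1 / real (Suc n)) \<longlonglongrightarrow> k" by real_asymp
    then show "(\<lambda>n. ennreal (g (k + 1 / real (Suc n)))) \<longlonglongrightarrow> ennreal (g k)"
      by (intro tendsto_ennrealI isCont_tendsto_compose[OF g])
  qed (use lo(1) in auto)
  also have "ennreal (g k) \<le> (\<integral>\<^sup>+w. min 1 (inverse (upper_ratio s w)) \<partial>?E)"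
  proof (rule LIMSEQ_le_const2)
    \<comment> \<open>A sequence approaching \<open>k\<close> from below; two successors keep its
      first term positive.\<close>
    have "(\<lambda>n. k * (1 - 1 / real (Suc (Suc n)))) \<longlonglongrightarrow> k" by real_asymp
    then show "(\<lambda>n. ennreal (g (k * (1 - 1 / real (Suc (Suc n)))))) \<longlonglongrightarrow> ennreal (g k)"
      by (intro tendsto_ennrealI isCont_tendsto_compose[OF g])
    have "0 < k * (1 - 1 / real (Suc (Suc n)))" "k * (1 - 1 / real (Suc (Suc n))) < k" for n
    proof -
      have x: "0 < 1 / real (Suc (Suc n))" "1 / real (Suc (Suc n)) < 1" by simp_all
      show "0 < k * (1 - 1 / real (Suc (Suc n)))" using k(1) x(2) by (intro mult_pos_pos) linarith+
      have "k * (1 - 1 / real (Suc (Suc n))) < k * 1" using k(1) x(1) by (intro mult_strict_left_mono) linarith+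
      then show "k * (1 - 1 / real (Suc (Suc n))) < k" by simp
    qed
    then show "\<exists>N. \<forall>n\<ge>N. ennreal (g (k * (1 - 1 / real (Suc (Suc n))))) \<le> (\<integral>\<^sup>+w. min 1 (inverse (upper_ratio s w)) \<partial>?E)"
      using up(1) by blast
  qed
  finally have int: "(\<integral>\<^sup>+w. inverse (lower_ratio s w) \<partial>?E) \<le> (\<integral>\<^sup>+w. min 1 (inverse (upper_ratio s w)) \<partial>?E)" .
  have m [measurable]: "lower_ratio s \<in> borel_measurable ?E" "upper_ratio s \<in> borel_measurable ?E"
    by (simp_all add: measurable_cong_sets[OF sets_beta_envN refl])
  have "(\<integral>\<^sup>+w. min 1 (inverse (upper_ratio s w)) \<partial>?E) \<le> (\<integral>\<^sup>+w. 1 \<partial>?E)"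
    by (intro nn_integral_mono) (rule min.cobounded1)
  also have "(\<integral>\<^sup>+w. 1 \<partial>?E) = 1" by (simp add: E.emeasure_space_1)
  finally have "(\<integral>\<^sup>+w. min 1 (inverse (upper_ratio s w)) \<partial>?E) \<noteq> \<infinity>"
    by (metis ennreal_one_neq_top infinity_ennreal_def top_unique)
  note fin = this
  \<comment> \<open>The pointwise order is opposite to the order \<open>int\<close> of the
    integrals, so the two inverses coincide almost everywhere.\<close>
  have le: "AE w in ?E. min 1 (inverse (upper_ratio s w)) \<le> inverse (lower_ratio s w)"
    by (intro AE_I2 min.coboundedI2) (simp add: ennreal_inverse_le_iff lower_ratio_le_upper_ratio s)
  have "AE w in ?E. inverse (lower_ratio s w) \<le> min 1 (inverse (upper_ratio s w))"
    by (rule AE_le_of_nn_integral_le[OF _ _ le int fin]) measurable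
  moreover have "AE w in ?E. 1 \<le> lower_ratio s w" using lo(2)[of "k + 1"] by simp
  moreover have "AE w in ?E. upper_ratio s w * ennreal (w (0, 0)) < 1" using up(2)[of "k / 2"] k(1) by simp
  moreover have "AE w in ?E. \<forall>x. 0 < w x \<and> w x < 1" using stationary.AE_envM[OF st[of 1]] unfolding E by simp
  ultimately show ?thesis
  proof eventually_elim
    case (elim w)
    have w: "w (0, 0) > 0" using elim(4) by auto
    have ul: "upper_ratio s w \<le> lower_ratio s w" using elim(1) by (simp add: ennreal_inverse_le_iff)
    have "upper_ratio s w \<noteq> top" using elim(3) w by (auto simp: ennreal_top_mult)
    then obtain c where c: "upper_ratio s w = ennreal c" "c \<ge> 0" by (cases "upper_ratio s w") auto
    have "1 \<le> ennreal c"
      using elim(2) lower_ratio_le_upper_ratio[OF s(1,2), of w] c by (metis order_trans)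
    then have "c \<ge> 1" by (simp add: one_ennreal.rep_eq ennreal_ge_1)
    moreover have "c * w (0, 0) < 1"
      using elim(3) c w by (simp flip: ennreal_mult add: ennreal_less_one_iff)
    moreover have "(hratio w \<longlongrightarrow> c) (toward s)"
      using ul c hratio_nonneg[OF elim(4)] by (intro hratio_tendsto) auto
    ultimately show ?case by (intro exI[of _ c]) auto
  qed
qed

text \<open>The rate increases for all parameters here, so any \<open>l\<close> may be compared with
  \<open>l + 1\<close>, and only upper bounds result. Their means tend to 1 as \<open>l\<close>
  grows, while the truncated inverse is at most 1.\<close>

lemma upper_ratio_lln:
  assumes ab: "a > 0" "b > 0" and s: "0 < s" "s < 1" "s * b = (1 - s) * a"
  shows "AE w in beta_envN a b. upper_ratio s w \<le> 1"
proof -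
  let ?E = "beta_envN a b"
  have st: "stationary a b l" if "l > 0" for l using ab that by unfold_locales
  have E: "stationary.envM a b = ?E" by (rule stationary_envM_eq[OF ab])
  interpret E: prob_space ?E using ab by (intro prob_space_PiM prob_space_beta_real)
  have up: "ennreal ((l + a) / (l + a + b)) \<le> (\<integral>\<^sup>+w. min 1 (inverse (upper_ratio s w)) \<partial>?E)" if "0 < l" for l
    using stationary.upper_ratio_bound(1)[OF st[OF that] s(1,2), of "l + 1"] rate_strict_mono_lln[OF ab s(1) _ s(3) that, of "l + 1"] s
    unfolding E by auto
  have "ennreal 1 \<le> (\<integral>\<^sup>+w. min 1 (inverse (upper_ratio s w)) \<partial>?E)"
  proof (rule LIMSEQ_le_const2)
    have "(\<lambda>n. (real (Suc n) + a) / (real (Suc n) + a + b)) \<longlonglongrightarrow> 1" by real_asymp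
    then show "(\<lambda>n. ennreal ((real (Suc n) + a) / (real (Suc n) + a + b))) \<longlonglongrightarrow> ennreal 1"
      by (intro tendsto_ennrealI)
  qed (use up in auto)
  then have int: "(\<integral>\<^sup>+w. 1 \<partial>?E) \<le> (\<integral>\<^sup>+w. min 1 (inverse (upper_ratio s w)) \<partial>?E)"
    by (simp add: E.emeasure_space_1)
  have m [measurable]: "upper_ratio s \<in> borel_measurable ?E"
    by (simp add: measurable_cong_sets[OF sets_beta_envN refl])
  have "(\<integral>\<^sup>+w. min 1 (inverse (upper_ratio s w)) \<partial>?E) \<le> (\<integral>\<^sup>+w. 1 \<partial>?E)"
    by (intro nn_integral_mono) (rule min.cobounded1)
  also have "(\<integral>\<^sup>+w. 1 \<partial>?E) = 1" by (simp add: E.emeasure_space_1)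
  finally have "(\<integral>\<^sup>+w. min 1 (inverse (upper_ratio s w)) \<partial>?E) \<noteq> \<infinity>"
    by (metis ennreal_one_neq_top infinity_ennreal_def top_unique)
  note fin = this
  have "AE w in ?E. 1 \<le> min 1 (inverse (upper_ratio s w))"
    by (rule AE_le_of_nn_integral_le[OF _ _ AE_I2[OF min.cobounded1] int fin]) measurable
  then show ?thesis
  proof eventually_elim
    case (elim w)
    then have "inverse 1 \<le> inverse (upper_ratio s w)" by simp
    then show ?case by (simp only: ennreal_inverse_le_iff)
  qed
qed

subsection \<open>Reflection of the environment\<close>

lemma distr_beta_real_reflect:
  assumes "a > 0" "b > 0"
  shows "distr (beta_real a b) borel (\<lambda>t. 1 - t) = beta_real b a"
proof (rule moments_determine_real)
  interpret A: prob_space "beta_real a b" using assms by (rule prob_space_beta_real)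
  interpret B: prob_space "beta_real b a" using assms by (intro prob_space_beta_real)
  show "finite_measure (distr (beta_real a b) borel (\<lambda>t. 1 - t))" by (intro A.finite_measure_distr) measurable
  show "finite_measure (beta_real b a)" by unfold_locales
  show "AE t in distr (beta_real a b) borel (\<lambda>t. 1 - t). 0 \<le> t \<and> t \<le> 1"
    by (subst AE_distr_iff, measurable, rule eventually_mono[OF AE_beta_real[OF assms]]) auto
  show "AE t in beta_real b a. 0 \<le> t \<and> t \<le> 1"
    by (rule eventually_mono[OF AE_beta_real[OF assms(2,1)]]) auto
  show "(\<integral>t. t ^ k \<partial>distr (beta_real a b) borel (\<lambda>t. 1 - t)) = (\<integral>t. t ^ k \<partial>beta_real b a)" for k
    using beta_real_integral(1)[OF assms, of 0 k] beta_real_integral(1)[OF assms(2,1), of k 0]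
    by (subst integral_distr) (simp_all add: Beta_commute)
qed simp_all

text \<open>Exchanging the axes makes the vertical weight the horizontal one, hence the
  complement.\<close>

definition transpose_env :: "(nat \<times> nat \<Rightarrow> real) \<Rightarrow> nat \<times> nat \<Rightarrow> real" where
  "transpose_env w = (\<lambda>(i, j). 1 - w (j, i))"

lemma measurable_transpose_env: "transpose_env \<in> borelP \<rightarrow>\<^sub>M borelP"
  by (rule measurable_PiM_single') (auto simp: transpose_env_def split_beta)

lemma distr_transpose_env:
  assumes ab: "a > 0" "b > 0"
  shows "distr (beta_envN a b) borelP transpose_env = beta_envN b a"
proof -
  interpret A: product_prob_space "\<lambda>_::nat \<times> nat. beta_real a b" UNIV
    using ab by (simp add: product_prob_space_def product_prob_space_axioms_def product_sigma_finite_def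
      prob_space_beta_real prob_space_imp_sigma_finite)
  interpret B: product_prob_space "\<lambda>_::nat \<times> nat. beta_real b a" UNIV
    using ab by (simp add: product_prob_space_def product_prob_space_axioms_def product_sigma_finite_def
      prob_space_beta_real prob_space_imp_sigma_finite)
  have tm: "transpose_env \<in> beta_envN a b \<rightarrow>\<^sub>M borelP"
    using measurable_transpose_env by (simp add: measurable_cong_sets[OF sets_beta_envN refl])
  show ?thesis
  proof (rule B.PiM_eq)
    fix J and F :: "nat \<times> nat \<Rightarrow> real set"
    assume J: "finite J" "J \<subseteq> UNIV" and F: "\<And>j. j \<in> J \<Longrightarrow> F j \<in> sets (beta_real b a)"
    define F' where "F' x = (\<lambda>t. 1 - t) -` F (prod.swap x)" for x
    have F': "F' x \<in> sets (beta_real a b)" if "x \<in> prod.swap ` J" for x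
      using that F unfolding F'_def by (auto intro!: measurable_sets_borel[of _ borel])
    have "transpose_env -` (prod_emb UNIV (\<lambda>_. beta_real b a) J (Pi\<^sub>E J F)) \<inter> space (beta_envN a b)
        = {w \<in> space (beta_envN a b). \<forall>x\<in>prod.swap ` J. w x \<in> F' x}"
      by (auto simp: prod_emb_def F'_def transpose_env_def space_PiM PiE_iff split_beta) (drule (1) bspec, simp)+
    then have "emeasure (distr (beta_envN a b) borelP transpose_env) (prod_emb UNIV (\<lambda>_. beta_real b a) J (Pi\<^sub>E J F))
        = emeasure (beta_envN a b) {w \<in> space (beta_envN a b). \<forall>x\<in>prod.swap ` J. w x \<in> F' x}"
      using J F tm by (subst emeasure_distr) (auto simp flip: sets_beta_envN[of b a] intro!: sets_PiM_I)
    also have "\<dots> = (\<Prod>x\<in>prod.swap ` J. emeasure (beta_real a b) (F' x))"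
      using J F' by (intro A.emeasure_PiM_Collect) auto
    also have "\<dots> = (\<Prod>x\<in>J. emeasure (beta_real a b) (F' (prod.swap x)))"
      by (subst prod.reindex) (auto simp: inj_on_def)
    also have "\<dots> = (\<Prod>x\<in>J. emeasure (beta_real b a) (F x))"
    proof (intro prod.cong refl)
      fix x assume "x \<in> J"
      then have Fx: "F x \<in> sets borel" using F by simp
      have "emeasure (beta_real b a) (F x) = emeasure (distr (beta_real a b) borel (\<lambda>t. 1 - t)) (F x)"
        by (simp add: distr_beta_real_reflect[OF ab])
      also have "\<dots> = emeasure (beta_real a b) (F' (prod.swap x))"
        using Fx by (subst emeasure_distr) (auto simp: F'_def)
      finally show "emeasure (beta_real a b) (F' (prod.swap x)) = emeasure (beta_real b a) (F x)" ..
    qed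
    finally show "emeasure (distr (beta_envN a b) borelP transpose_env) (prod_emb UNIV (\<lambda>_. beta_real b a) J (Pi\<^sub>E J F))
        = (\<Prod>x\<in>J. emeasure (beta_real b a) (F x))" .
  qed (simp add: sets_beta_envN)
qed

lemma AE_transpose_env:
  assumes "a > 0" "b > 0" "AE w in beta_envN b a. P w"
  shows "AE w in beta_envN a b. P (transpose_env w)"
  using assms(3) unfolding distr_transpose_env[OF assms(1,2), symmetric]
  by (rule AE_distrD[rotated]) (use measurable_transpose_env in \<open>simp add: measurable_cong_sets[OF sets_beta_envN refl]\<close>)

lemma hratio_transpose_env: "hratio (transpose_env w) (prod.swap z) = vratio w z"
  by (simp add: hratio_def vratio_def transpose_env_def hit_transpose)

lemma filterlim_swap_toward: "filterlim prod.swap (toward (1 - s)) (toward s)"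
proof -
  have "\<bar>real j - (1 - s) * real (j + i)\<bar> = \<bar>real i - s * real (i + j)\<bar>" for i j
    by (simp add: algebra_simps abs_minus_commute)
  then have "(i, j) \<in> cone s M \<Longrightarrow> (j, i) \<in> cone (1 - s) M" for i j M
    by (auto simp: cone_def add.commute)
  then have "\<forall>z\<in>cone s M. prod.swap z \<in> cone (1 - s) M" for M
    by auto
  then show ?thesis
    unfolding filterlim_iff eventually_toward by blast
qed

text \<open>The first step equation divided by the hitting probability from the origin. Through it
  each ratio determines the other.\<close>

lemma hratio_vratio_sum:
  assumes "\<forall>x. 0 < w x \<and> w x < 1" "0 < fst z" "0 < snd z"
  shows "w (0, 0) * hratio w z + (1 - w (0, 0)) * vratio w z = 1"
proof -
  obtain i j where z: "z = (Suc i, Suc j)" using assms(2,3) by (metis gr0_implies_Suc prod.collapse)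
  have "hit w (Suc i) (Suc j) 0 0 > 0" using assms(1) by (intro hit_pos) auto
  then show ?thesis
    unfolding z hratio_def vratio_def by (simp add: add_divide_distrib[symmetric])
qed

lemma upper_ratio_less:
  assumes "upper_ratio s w < ennreal y"
  shows "eventually (\<lambda>z. hratio w z < y) (toward s)"
proof -
  obtain M where "(SUP z\<in>cone s M. ennreal (hratio w z)) < ennreal y"
    using assms unfolding upper_ratio_def INF_less_iff by auto
  then have "\<forall>z\<in>cone s M. ennreal (hratio w z) < ennreal y" by (auto dest: SUP_lessD)
  then have "\<forall>z\<in>cone s M. hratio w z < y" by (meson ennreal_leI leD leI)
  then show ?thesis unfolding eventually_toward by blast
qed

definition ratios_tendsto :: "real \<Rightarrow> (nat \<times> nat \<Rightarrow> real) \<Rightarrow> real \<Rightarrow> real \<Rightarrow> bool" where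
  "ratios_tendsto s w c d \<longleftrightarrow> 0 < c \<and> 0 < d \<and> (hratio w \<longlongrightarrow> c) (toward s) \<and> (vratio w \<longlongrightarrow> d) (toward s)"

text \<open>On one side of the law of large numbers direction the horizontal limit is known and
  gives the vertical one, positive because \<open>c * w (0, 0) < 1\<close>; the other side is its
  mirror image. In that direction itself both upper limits are at most 1, and a weighted mean of the
  ratios equals 1, so both converge to 1.\<close>

lemma AE_ratios_tendsto:
  assumes ab: "a > 0" "b > 0" and s: "0 < s" "s < 1"
  shows "AE w in beta_envN a b. \<exists>c d. ratios_tendsto s w c d \<and> (s * b = (1 - s) * a \<longrightarrow> c = 1 \<and> d = 1)"
proof -
  let ?E = "beta_envN a b"
  have w01: "AE w in ?E. \<forall>x. 0 < w x \<and> w x < 1"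
    using stationary.AE_envM[of a b 1] ab unfolding stationary_envM_eq[OF ab] stationary_def by simp
  have pos: "eventually (\<lambda>z. 0 < fst z \<and> 0 < snd z) (toward s)"
    using eventually_toward_ge[OF s, of 1] by eventually_elim auto
  consider "s * b > (1 - s) * a" | "s * b < (1 - s) * a" | "s * b = (1 - s) * a" by linarith
  then show ?thesis
  proof cases
    case 1
    show ?thesis
      using hratio_convergent_above[OF ab s 1] w01
    proof eventually_elim
      case (elim w)
      define p where "p = w (0, 0)"
      have p: "0 < p" "p < 1" using elim(2) by (auto simp: p_def)
      obtain c where c: "c > 0" "c * p < 1" "(hratio w \<longlongrightarrow> c) (toward s)" using elim(1) by (auto simp: p_def)
      have "((\<lambda>z. (1 - p * hratio w z) / (1 - p)) \<longlongrightarrow> (1 - p * c) / (1 - p)) (toward s)"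
        using p by (intro tendsto_intros c) auto
      moreover have "eventually (\<lambda>z. (1 - p * hratio w z) / (1 - p) = vratio w z) (toward s)"
        using pos
      proof eventually_elim
        case (elim z)
        then show ?case
          using hratio_vratio_sum[OF \<open>\<forall>x. 0 < w x \<and> w x < 1\<close>, of z] p by (simp add: p_def field_simps)
      qed
      ultimately have "(vratio w \<longlongrightarrow> (1 - p * c) / (1 - p)) (toward s)"
        by (rule Lim_transform_eventually)
      moreover have "(1 - p * c) / (1 - p) > 0" using p c by (simp add: mult.commute)
      ultimately show ?case
        using c 1 unfolding ratios_tendsto_def by (intro exI[of _ c] exI[of _ "(1 - p * c) / (1 - p)"]) auto
    qed
  next
    case 2
    have "AE w in ?E. \<exists>c>0. c * transpose_env w (0, 0) < 1 \<and> (hratio (transpose_env w) \<longlongrightarrow> c) (toward (1 - s))"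
      using 2 s ab by (intro AE_transpose_env hratio_convergent_above) auto
    then show ?thesis
      using w01
    proof eventually_elim
      case (elim w)
      define p where "p = w (0, 0)"
      have p: "0 < p" "p < 1" using elim(2) by (auto simp: p_def)
      obtain c where c: "c > 0" "c * (1 - p) < 1" "(hratio (transpose_env w) \<longlongrightarrow> c) (toward (1 - s))"
        using elim(1) by (auto simp: p_def transpose_env_def)
      have v: "(vratio w \<longlongrightarrow> c) (toward s)"
        using filterlim_compose[OF c(3) filterlim_swap_toward] by (simp add: hratio_transpose_env)
      have "((\<lambda>z. (1 - (1 - p) * vratio w z) / p) \<longlongrightarrow> (1 - (1 - p) * c) / p) (toward s)"
        using p by (intro tendsto_intros v) auto
      moreover have "eventually (\<lambda>z. (1 - (1 - p) * vratio w z) / p = hratio w z) (toward s)"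
        using pos
      proof eventually_elim
        case (elim z)
        then show ?case
          using hratio_vratio_sum[OF \<open>\<forall>x. 0 < w x \<and> w x < 1\<close>, of z] p by (simp add: p_def field_simps)
      qed
      ultimately have "(hratio w \<longlongrightarrow> (1 - (1 - p) * c) / p) (toward s)"
        by (rule Lim_transform_eventually)
      moreover have "(1 - (1 - p) * c) / p > 0" using p c by (simp add: mult.commute)
      ultimately show ?case
        using c 2 v unfolding ratios_tendsto_def by (intro exI[of _ "(1 - (1 - p) * c) / p"] exI[of _ c]) auto
    qed
  next
    case 3
    have "AE w in ?E. upper_ratio (1 - s) (transpose_env w) \<le> 1"
      using 3 s ab by (intro AE_transpose_env upper_ratio_lln) auto
    then show ?thesis
      using upper_ratio_lln[OF ab s 3] w01
    proof eventually_elim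
      case (elim w)
      define p where "p = w (0, 0)"
      have p: "0 < p" "p < 1" using elim(3) by (auto simp: p_def)
      then have q: "0 < 1 - p" by simp
      have 1: "1 < ennreal (1 + e)" if "e > 0" for e
        using that ennreal_lessI[of "1 + e" 1] by simp
      have h: "eventually (\<lambda>z. hratio w z < 1 + e) (toward s)" if "e > 0" for e
        using upper_ratio_less[OF le_less_trans[OF elim(2) 1[OF that]]] .
      have v: "eventually (\<lambda>z. vratio w z < 1 + e) (toward s)" if "e > 0" for e
      proof -
        have "eventually (\<lambda>z. hratio (transpose_env w) z < 1 + e) (toward (1 - s))"
          by (rule upper_ratio_less[OF le_less_trans[OF elim(1) 1[OF that]]])
        then have "eventually (\<lambda>z. hratio (transpose_env w) (prod.swap z) < 1 + e) (toward s)"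
          using filterlim_swap_toward[of s] unfolding filterlim_iff by blast
        then show ?thesis by (simp only: hratio_transpose_env)
      qed
      have sum: "eventually (\<lambda>z. p * hratio w z + (1 - p) * vratio w z = 1) (toward s)"
        using pos by eventually_elim (use hratio_vratio_sum[OF elim(3)] in \<open>simp add: p_def\<close>)
      \<comment> \<open>An excess of at most p e in the vertical ratio, weighted by 1 - p, leaves a
        horizontal deficit of at most (1 - p) e, which is below e.\<close>
      have hl: "eventually (\<lambda>z. 1 - e < hratio w z) (toward s)" if "e > 0" for e
        using v[OF mult_pos_pos[OF p(1) that]] sum
      proof eventually_elim
        case (elim z)
        have "0 < p * e" using p that by simp
        then have "(1 - p) * vratio w z < (1 - p) * (1 + p * e)" using elim p that by simp
        also have "\<dots> \<le> 1 - p + p * e" using mult_pos_pos[OF p(1) \<open>0 < p * e\<close>] by (simp add: algebra_simps)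
        finally have "p * (1 - e) < p * hratio w z" using elim(2) by (simp add: algebra_simps)
        then show ?case using p by simp
      qed
      have vl: "eventually (\<lambda>z. 1 - e < vratio w z) (toward s)" if "e > 0" for e
        using h[OF mult_pos_pos[OF q that]] sum
      proof eventually_elim
        case (elim z)
        have "0 < (1 - p) * e" using p that by simp
        then have "p * hratio w z < p * (1 + (1 - p) * e)" using elim p that by simp
        also have "\<dots> \<le> p + (1 - p) * e" using p \<open>0 < (1 - p) * e\<close> by (simp add: distrib_left mult_left_le_one_le)
        finally have "(1 - p) * (1 - e) < (1 - p) * vratio w z" using elim(2) by (simp add: algebra_simps)
        then show ?case using p by simp
      qed
      have "(hratio w \<longlongrightarrow> 1) (toward s)"
      proof (rule tendstoI)
        fix e :: real assume "e > 0"
        from h[OF this] hl[OF this] show "eventually (\<lambda>z. dist (hratio w z) 1 < e) (toward s)"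
          by eventually_elim (simp add: dist_real_def abs_less_iff)
      qed
      moreover have "(vratio w \<longlongrightarrow> 1) (toward s)"
      proof (rule tendstoI)
        fix e :: real assume "e > 0"
        from v[OF this] vl[OF this] show "eventually (\<lambda>z. dist (vratio w z) 1 < e) (toward s)"
          by eventually_elim (simp add: dist_real_def abs_less_iff)
      qed
      ultimately show ?case unfolding ratios_tendsto_def by (intro exI[of _ 1]) auto
    qed
  qed
qed

subsection \<open>The walk on the lattice\<close>

abbreviation unit_step :: "bool \<Rightarrow> site" where
  "unit_step b \<equiv> (if b then e\<^sub>1 else e\<^sub>2)"

fun walk_prob :: "env \<Rightarrow> nat \<Rightarrow> site \<Rightarrow> site \<Rightarrow> real" where
  "walk_prob \<omega> 0 x z = of_bool (x = z)"
| "walk_prob \<omega> (Suc n) x z = \<omega> x * walk_prob \<omega> n (x + e\<^sub>1) z + (1 - \<omega> x) * walk_prob \<omega> n (x + e\<^sub>2) z"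

fun path_of :: "site \<Rightarrow> bool list \<Rightarrow> nat \<Rightarrow> site" where
  "path_of x bs 0 = x"
| "path_of x [] (Suc n) = x"
| "path_of x (b # bs) (Suc n) = path_of (x + unit_step b) bs n"

fun path_weight :: "env \<Rightarrow> site \<Rightarrow> bool list \<Rightarrow> real" where
  "path_weight \<omega> x [] = 1"
| "path_weight \<omega> x (b # bs) = (if b then \<omega> x else 1 - \<omega> x) * path_weight \<omega> (x + unit_step b) bs"

lemma path_weight_eq:
  "path_weight \<omega> x bs = (\<Prod>i<length bs. weight \<omega> (path_of x bs i) (path_of x bs (Suc i)))"
proof (induction bs arbitrary: x)
  case (Cons b bs)
  have "path_of (x + unit_step b) bs 0 = x + unit_step b" by simp
  then have "weight \<omega> x (path_of (x + unit_step b) bs 0) = (if b then \<omega> x else 1 - \<omega> x)"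
    by (simp add: weight_def)
  then show ?case
    unfolding list.size add_0_right add_Suc_right prod.lessThan_Suc_shift
    by (simp add: Cons del: prod.lessThan_Suc)
qed simp

lemma sum_lists_Suc:
  fixes f :: "bool list \<Rightarrow> real"
  shows "(\<Sum>bs | length bs = Suc n. f bs) = (\<Sum>bs | length bs = n. f (True # bs)) + (\<Sum>bs | length bs = n. f (False # bs))"
proof -
  have fin: "finite {bs :: bool list. length bs = n}"
    using finite_lists_length_eq[of "UNIV :: bool set" n] by simp
  have "{bs :: bool list. length bs = Suc n} = (#) True ` {bs. length bs = n} \<union> (#) False ` {bs. length bs = n}"
    by (auto simp: length_Suc_conv image_iff)
  then have "(\<Sum>bs | length bs = Suc n. f bs) = (\<Sum>bs\<in>(#) True ` {bs. length bs = n}. f bs) + (\<Sum>bs\<in>(#) False ` {bs. length bs = n}. f bs)"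
    by (simp only:) (intro sum.union_disjoint; use fin in auto)
  then show ?thesis
    by (simp add: sum.reindex inj_on_def)
qed

lemma sum_path_weight: "(\<Sum>bs | length bs = n. path_weight \<omega> x bs) = 1"
  by (induction n arbitrary: x) (simp_all add: sum_lists_Suc sum_distrib_left[symmetric] del: add_Pair)

lemma sum_path_weight_end:
  "(\<Sum>bs | length bs = n. path_weight \<omega> x bs * of_bool (path_of x bs n = z)) = walk_prob \<omega> n x z"
proof (induction n arbitrary: x)
  case (Suc n)
  show ?case
    using Suc[of "x + e\<^sub>1"] Suc[of "x + e\<^sub>2"]
    by (simp add: sum_lists_Suc mult.assoc sum_distrib_left[symmetric] del: add_Pair)
qed simp

lemma path_of_inj:
  assumes "length bs = n" "length cs = n" "\<And>i. i \<le> n \<Longrightarrow> path_of x bs i = path_of x cs i"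
  shows "bs = cs"
  using assms
proof (induction bs arbitrary: x cs n)
  case (Cons b bs)
  then obtain c cs' m where cs: "cs = c # cs'" and n: "n = Suc m" by (auto simp: length_Suc_conv)
  have "b = c" using Cons.prems(3)[of 1] by (auto simp: cs n split: if_splits)
  moreover have "bs = cs'"
  proof (rule Cons.IH[of m cs' "x + unit_step b"])
    show "path_of (x + unit_step b) bs i = path_of (x + unit_step b) cs' i" if "i \<le> m" for i
      using Cons.prems(3)[of "Suc i"] that \<open>b = c\<close> by (simp add: cs n)
  qed (use Cons.prems cs n in auto)
  ultimately show ?case by (simp add: cs)
qed simp

text \<open>The cylinders \<open>A bs\<close> over step words of length \<open>n\<close> are
  disjoint and of total mass 1, so the event is, up to a null set, the union of those ending at
  \<open>z\<close>. Summing path weights gives the recursive n-step transition probability.\<close>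

lemma quenched_walk_prob:
  assumes \<omega>: "\<And>y. 0 \<le> \<omega> y \<and> \<omega> y \<le> 1"
  shows "measure (quenched \<omega> x) {X \<in> space (quenched \<omega> x). X n = z} = walk_prob \<omega> n x z"
proof -
  interpret Q: prob_space "quenched \<omega> x" by (rule prob_space_quenched)
  let ?L = "{bs :: bool list. length bs = n}"
  define A where "A bs = {X \<in> space (quenched \<omega> x). \<forall>i\<le>n. X i = path_of x bs i}" for bs
  have fin: "finite ?L" using finite_lists_length_eq[of "UNIV :: bool set" n] by simp
  have comp: "(\<lambda>X. X i) \<in> quenched \<omega> x \<rightarrow>\<^sub>M count_space UNIV" for i
    by (simp add: measurable_cong_sets[OF sets_quenched refl])
  have coord: "{X \<in> space (quenched \<omega> x). X i = y} \<in> sets (quenched \<omega> x)" for i y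
    using measurable_sets[OF comp, of "{y}" i] by (simp add: vimage_def Int_def conj_commute)
  have Am: "A bs \<in> sets (quenched \<omega> x)" for bs
  proof -
    have "A bs = {X \<in> space (quenched \<omega> x). \<forall>i\<in>{..n}. X i = path_of x bs i}" by (auto simp: A_def)
    also have "\<dots> \<in> sets (quenched \<omega> x)" by (intro sets.sets_Collect_finite_All coord) simp
    finally show ?thesis .
  qed
  have pA: "Q.prob (A bs) = path_weight \<omega> x bs" if "bs \<in> ?L" for bs
    using quenched_path[of \<omega> x n "path_of x bs", OF \<omega>] that unfolding A_def path_weight_eq by simp
  have disj: "disjoint_family_on A S" if "S \<subseteq> ?L" for S
    unfolding disjoint_family_on_def
  proof (intro ballI impI)
    fix bs cs assume "bs \<in> S" "cs \<in> S" "bs \<noteq> cs"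
    then have len: "length bs = n" "length cs = n" using that by auto
    show "A bs \<inter> A cs = {}"
    proof (rule equals0I)
      fix X assume X: "X \<in> A bs \<inter> A cs"
      have "path_of x bs i = path_of x cs i" if "i \<le> n" for i
        using X that unfolding A_def by auto
      then show False using path_of_inj[OF len] \<open>bs \<noteq> cs\<close> by blast
    qed
  qed
  have un: "Q.prob (\<Union>bs\<in>S. A bs) = (\<Sum>bs\<in>S. path_weight \<omega> x bs)" if "S \<subseteq> ?L" for S
    using that fin Am pA disj[OF that]
    by (subst Q.finite_measure_finite_Union) (auto intro: finite_subset intro!: sum.cong)
  have one: "Q.prob (\<Union>bs\<in>?L. A bs) = 1"
    using un[of ?L] sum_path_weight by simp
  define E where "E = {X \<in> space (quenched \<omega> x). X n = z}"
  have Em: "E \<in> sets (quenched \<omega> x)"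
    unfolding E_def by (rule coord)
  let ?S = "{bs \<in> ?L. path_of x bs n = z}"
  have "E \<inter> (\<Union>bs\<in>?L. A bs) = (\<Union>bs\<in>?S. A bs)"
    unfolding E_def A_def by auto
  then have "Q.prob (E \<inter> (\<Union>bs\<in>?L. A bs)) = (\<Sum>bs\<in>?S. path_weight \<omega> x bs)"
    using un[of ?S] by (simp only:) blast
  also have "\<dots> = walk_prob \<omega> n x z"
    unfolding sum_path_weight_end[symmetric] using fin
    by (intro sum.mono_neutral_cong_left) auto
  also have "Q.prob (E \<inter> (\<Union>bs\<in>?L. A bs)) = Q.prob E"
    using one Em Am fin by (intro Q.measure_space_inter) (auto simp: Q.prob_space intro!: sets.finite_UN)
  finally show ?thesis unfolding E_def .
qed

section \<open>The environment seen from a lattice site\<close>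

definition quadrant_env :: "env \<Rightarrow> site \<Rightarrow> nat \<times> nat \<Rightarrow> real" where
  "quadrant_env \<omega> x = (\<lambda>(i, j). \<omega> (x + (int i, int j)))"

lemma quadrant_env_0: "quadrant_env \<omega> x (0, 0) = \<omega> x"
  by (cases x) (simp add: quadrant_env_def)

lemma walk_prob_nonzero:
  "walk_prob \<omega> n x z \<noteq> 0 \<Longrightarrow> fst x \<le> fst z \<and> snd x \<le> snd z"
proof (induction n arbitrary: x)
  case (Suc n)
  then have "walk_prob \<omega> n (x + e\<^sub>1) z \<noteq> 0 \<or> walk_prob \<omega> n (x + e\<^sub>2) z \<noteq> 0" by auto
  then show ?case using Suc.IH by fastforce
qed (auto split: if_splits)

text \<open>Every step raises the coordinate sum by one, so a displacement \<open>(i, j)\<close> can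
  only be reached at time \<open>i + j\<close>, and visiting a point is the same as being there at
  that time. On the axes the second neighbour has overshot the target.\<close>

lemma walk_prob_hit:
  "walk_prob \<omega> (i + j) (x + (int p, int q)) (x + (int (p + i), int (q + j))) = hit (quadrant_env \<omega> x) i j p q"
proof -
  have "walk_prob \<omega> (i + j) (x + (int p, int q)) (x + (int (p + i), int (q + j))) = hit v i j p q" if "v = quadrant_env \<omega> x" for v
    using that
  proof (induction v i j p q rule: hit.induct)
    case (1 v p q)
    then show ?case by simp
  next
    case (2 v i p q)
    have z: "walk_prob \<omega> i (x + (int p, int q) + e\<^sub>2) (x + (int (p + Suc i), int (q + 0))) = 0"
      using walk_prob_nonzero[of \<omega> i "x + (int p, int q) + e\<^sub>2" "x + (int (p + Suc i), int (q + 0))"] by auto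
    have e: "x + (int p, int q) + e\<^sub>1 = x + (int (Suc p), int q)" by (simp add: add.assoc)
    have "walk_prob \<omega> (Suc i + 0) (x + (int p, int q)) (x + (int (p + Suc i), int (q + 0)))
        = \<omega> (x + (int p, int q)) * walk_prob \<omega> (i + 0) (x + (int (Suc p), int q)) (x + (int (Suc p + i), int (q + 0)))"
      using z unfolding e[symmetric] by simp
    then show ?case using 2 by (simp add: quadrant_env_def)
  next
    case (3 v j p q)
    have z: "walk_prob \<omega> j (x + (int p, int q) + e\<^sub>1) (x + (int (p + 0), int (q + Suc j))) = 0"
      using walk_prob_nonzero[of \<omega> j "x + (int p, int q) + e\<^sub>1" "x + (int (p + 0), int (q + Suc j))"] by auto
    have e: "x + (int p, int q) + e\<^sub>2 = x + (int p, int (Suc q))" by (simp add: add.assoc)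
    have "walk_prob \<omega> (0 + Suc j) (x + (int p, int q)) (x + (int (p + 0), int (q + Suc j)))
        = (1 - \<omega> (x + (int p, int q))) * walk_prob \<omega> (0 + j) (x + (int p, int (Suc q))) (x + (int (p + 0), int (Suc q + j)))"
      using z unfolding e[symmetric] by simp
    then show ?case using 3 by (simp add: quadrant_env_def)
  next
    case (4 v i j p q)
    have e1: "x + (int p, int q) + e\<^sub>1 = x + (int (Suc p), int q)" by (simp add: add.assoc)
    have e2: "x + (int p, int q) + e\<^sub>2 = x + (int p, int (Suc q))" by (simp add: add.assoc)
    have "walk_prob \<omega> (Suc i + Suc j) (x + (int p, int q)) (x + (int (p + Suc i), int (q + Suc j)))
        = \<omega> (x + (int p, int q)) * walk_prob \<omega> (i + Suc j) (x + (int (Suc p), int q)) (x + (int (Suc p + i), int (q + Suc j)))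
         + (1 - \<omega> (x + (int p, int q))) * walk_prob \<omega> (Suc i + j) (x + (int p, int (Suc q))) (x + (int (p + Suc i), int (Suc q + j)))"
      unfolding e1[symmetric] e2[symmetric] by simp
    then show ?case using 4 by (simp add: quadrant_env_def)
  qed
  then show ?thesis by simp
qed

lemma distr_quadrant_env:
  assumes ab: "\<alpha> > 0" "\<beta> > 0"
  shows "distr (beta_env \<alpha> \<beta>) borelP (\<lambda>\<omega>. quadrant_env \<omega> x) = beta_envN \<alpha> \<beta>"
    and "(\<lambda>\<omega>. quadrant_env \<omega> x) \<in> beta_env \<alpha> \<beta> \<rightarrow>\<^sub>M borelP"
proof -
  interpret A: product_prob_space "\<lambda>_::site. beta_law \<alpha> \<beta>" UNIV
    using ab by (simp add: product_prob_space_def product_prob_space_axioms_def product_sigma_finite_def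
      prob_space_beta_law prob_space_imp_sigma_finite)
  interpret B: product_prob_space "\<lambda>_::nat \<times> nat. beta_real \<alpha> \<beta>" UNIV
    using ab by (simp add: product_prob_space_def product_prob_space_axioms_def product_sigma_finite_def
      prob_space_beta_real prob_space_imp_sigma_finite)
  show qm: "(\<lambda>\<omega>. quadrant_env \<omega> x) \<in> beta_env \<alpha> \<beta> \<rightarrow>\<^sub>M borelP"
  proof (rule measurable_PiM_single')
    fix y :: "nat \<times> nat"
    have "(\<lambda>\<omega>. \<omega> (x + (int (fst y), int (snd y)))) \<in> beta_env \<alpha> \<beta> \<rightarrow>\<^sub>M beta_law \<alpha> \<beta>"
      unfolding beta_env_def by (rule measurable_component_singleton) simp
    then show "(\<lambda>\<omega>. quadrant_env \<omega> x y) \<in> borel_measurable (beta_env \<alpha> \<beta>)"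
      using measurable_compose[OF _ measurable_beta_law_borel] by (simp add: quadrant_env_def split_beta)
  qed simp
  show "distr (beta_env \<alpha> \<beta>) borelP (\<lambda>\<omega>. quadrant_env \<omega> x) = beta_envN \<alpha> \<beta>"
  proof (rule B.PiM_eq)
    fix J and F :: "nat \<times> nat \<Rightarrow> real set"
    assume J: "finite J" "J \<subseteq> UNIV" and F: "\<And>j. j \<in> J \<Longrightarrow> F j \<in> sets (beta_real \<alpha> \<beta>)"
    define g where "g y = x + (int (fst y), int (snd y))" for y :: "nat \<times> nat"
    define g' where "g' u = (nat (fst (u - x)), nat (snd (u - x)))" for u :: site
    have g: "g' (g y) = y" for y by (simp add: g_def g'_def)
    then have inj: "inj_on g J" by (metis inj_on_inverseI)
    \<comment> \<open>The intersection with the unit interval is forced by \<open>beta_law\<close>,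
      whose space is that interval.\<close>
    define F' where "F' u = F (g' u) \<inter> {0..1}" for u
    have F': "F' u \<in> sets (beta_law \<alpha> \<beta>)" if "u \<in> g ` J" for u
      using that F g unfolding F'_def by (auto simp: sets_beta_law sets_restrict_space)
    have "(\<lambda>\<omega>. quadrant_env \<omega> x) -` (prod_emb UNIV (\<lambda>_. beta_real \<alpha> \<beta>) J (Pi\<^sub>E J F)) \<inter> space (beta_env \<alpha> \<beta>)
        = {\<omega> \<in> space (beta_env \<alpha> \<beta>). \<forall>u\<in>g ` J. \<omega> u \<in> F' u}"
      by (auto simp: prod_emb_def F'_def quadrant_env_def g g_def[symmetric] space_beta_env PiE_iff split_beta
          simp del: split_paired_All)
    then have "emeasure (distr (beta_env \<alpha> \<beta>) borelP (\<lambda>\<omega>. quadrant_env \<omega> x)) (prod_emb UNIV (\<lambda>_. beta_real \<alpha> \<beta>) J (Pi\<^sub>E J F))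
        = emeasure (beta_env \<alpha> \<beta>) {\<omega> \<in> space (beta_env \<alpha> \<beta>). \<forall>u\<in>g ` J. \<omega> u \<in> F' u}"
      using J F qm by (subst emeasure_distr) (auto simp flip: sets_beta_envN[of \<alpha> \<beta>] intro!: sets_PiM_I)
    also have "\<dots> = (\<Prod>u\<in>g ` J. emeasure (beta_law \<alpha> \<beta>) (F' u))"
      unfolding beta_env_def using J F' by (intro A.emeasure_PiM_Collect) auto
    also have "\<dots> = (\<Prod>y\<in>J. emeasure (beta_law \<alpha> \<beta>) (F' (g y)))"
      by (subst prod.reindex[OF inj]) simp
    also have "\<dots> = (\<Prod>y\<in>J. emeasure (beta_real \<alpha> \<beta>) (F y))"
    proof (intro prod.cong refl)
      fix y assume "y \<in> J"
      then have Fy: "F y \<in> sets borel" using F by simp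
      have "space (beta_law \<alpha> \<beta>) = {0..1}" by (simp add: beta_law_def space_restrict_space)
      then show "emeasure (beta_law \<alpha> \<beta>) (F' (g y)) = emeasure (beta_real \<alpha> \<beta>) (F y)"
        using Fy unfolding beta_real_def
        by (subst emeasure_distr) (auto simp: F'_def g measurable_beta_law_borel)
    qed
    finally show "emeasure (distr (beta_env \<alpha> \<beta>) borelP (\<lambda>\<omega>. quadrant_env \<omega> x)) (prod_emb UNIV (\<lambda>_. beta_real \<alpha> \<beta>) J (Pi\<^sub>E J F))
        = (\<Prod>y\<in>J. emeasure (beta_real \<alpha> \<beta>) (F y))" .
  qed (simp add: sets_beta_envN)
qed

section \<open>Sequences in a direction and Busemann limits\<close>

abbreviation (input) hit_prob :: "env \<Rightarrow> site \<Rightarrow> site \<Rightarrow> real" where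
  "hit_prob \<omega> z x \<equiv> measure (quenched \<omega> x) {X \<in> space (quenched \<omega> x). X (l1norm (z - x)) = z}"

lemma hit_prob_eq_hit:
  assumes "\<And>y. 0 \<le> \<omega> y \<and> \<omega> y \<le> 1"
  shows "hit_prob \<omega> (x + (int i, int j)) x = hit (quadrant_env \<omega> x) i j 0 0"
proof -
  have "l1norm (x + (int i, int j) - x) = i + j" by (simp add: l1norm_def nat_add_distrib)
  then show ?thesis
    using quenched_walk_prob[of \<omega> x "i + j" "x + (int i, int j)", OF assms]
      walk_prob_hit[of \<omega> i j x 0 0] by (simp add: zero_prod_def[symmetric])
qed

lemma hit_shift: "hit (\<lambda>(p, q). w (p + c, q + d)) i j a b = hit w i j (a + c) (b + d)"
proof -
  have "hit v i j a b = hit w i j (a + c) (b + d)" if "v = (\<lambda>(p, q). w (p + c, q + d))" for v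
    using that by (induction v i j a b rule: hit.induct) auto
  then show ?thesis by blast
qed

lemma quadrant_env_shift:
  "hit (quadrant_env \<omega> (x + (int c, int d))) i j 0 0 = hit (quadrant_env \<omega> x) i j c d"
proof -
  have "quadrant_env \<omega> (x + (int c, int d)) = (\<lambda>(p, q). quadrant_env \<omega> x (p + c, q + d))"
    by (cases x) (auto simp: quadrant_env_def fun_eq_iff add_ac)
  then show ?thesis using hit_shift[of "quadrant_env \<omega> x" c d i j 0 0] by simp
qed

definition directed :: "real \<Rightarrow> (nat \<Rightarrow> site) \<Rightarrow> bool" where
  "directed s z \<longleftrightarrow> filterlim (\<lambda>N. l1norm (z N)) at_top sequentially \<and>
     (\<lambda>N. site_vec (z N) /\<^sub>R real (l1norm (z N))) \<longlonglongrightarrow> (s, 1 - s)"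

definition offset :: "site \<Rightarrow> site \<Rightarrow> nat \<times> nat" where
  "offset x z = (nat (fst (z - x)), nat (snd (z - x)))"

text \<open>Shifting the origin to \<open>x\<close> changes the sites by a bounded amount, which
  disappears after division by the norm. As both limit coordinates are positive, the sites end up in
  the quadrant of \<open>x\<close> and inside every cone.\<close>

lemma directed_offset:
  assumes s: "0 < s" "s < 1" and z: "directed s z"
  shows "filterlim (\<lambda>N. offset x (z N)) (toward s) sequentially"
    and "eventually (\<lambda>N. z N = x + (int (fst (offset x (z N))), int (snd (offset x (z N))))) sequentially"
proof -
  define n where "n N = real (l1norm (z N))" for N
  define f where "f N = real_of_int (fst (z N - x))" for N
  define g where "g N = real_of_int (snd (z N - x))" for N
  have n: "filterlim n at_top sequentially"
    using z unfolding directed_def n_def by (auto intro: filterlim_compose[OF filterlim_real_sequentially])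
  have r: "(\<lambda>N. site_vec (z N) /\<^sub>R n N) \<longlonglongrightarrow> (s, 1 - s)"
    using z by (simp add: directed_def n_def)
  have r1: "(\<lambda>N. real_of_int (fst (z N)) / n N) \<longlonglongrightarrow> s" and r2: "(\<lambda>N. real_of_int (snd (z N)) / n N) \<longlonglongrightarrow> 1 - s"
    using tendsto_fst[OF r] tendsto_snd[OF r] by (simp_all add: site_vec_def divide_inverse mult.commute)
  have c0: "(\<lambda>N. c / n N) \<longlonglongrightarrow> 0" for c
    by (rule real_tendsto_divide_at_top[OF tendsto_const n])
  have f: "(\<lambda>N. f N / n N) \<longlonglongrightarrow> s"
    using tendsto_diff[OF r1 c0[of "real_of_int (fst x)"]] by (simp add: f_def diff_divide_distrib)
  have g: "(\<lambda>N. g N / n N) \<longlonglongrightarrow> 1 - s"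
    using tendsto_diff[OF r2 c0[of "real_of_int (snd x)"]] by (simp add: g_def diff_divide_distrib)
  have npos: "eventually (\<lambda>N. n N > 0) sequentially"
    using n by (simp add: filterlim_at_top_dense)
  have fpos: "eventually (\<lambda>N. f N > 0) sequentially"
    using order_tendstoD(1)[OF f s(1)] npos by eventually_elim (simp add: zero_less_divide_iff)
  have gpos: "eventually (\<lambda>N. g N > 0) sequentially"
  proof -
    have "0 < 1 - s" using s by simp
    from order_tendstoD(1)[OF g this] npos show ?thesis by eventually_elim (simp add: zero_less_divide_iff)
  qed
  have fg: "(\<lambda>N. f N / n N + g N / n N) \<longlonglongrightarrow> 1"
    using tendsto_add[OF f g] by simp
  have big: "filterlim (\<lambda>N. f N + g N) at_top sequentially"
  proof -
    have "filterlim (\<lambda>N. (f N / n N + g N / n N) * n N) at_top sequentially"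
      by (rule filterlim_tendsto_pos_mult_at_top[OF fg _ n]) simp
    then show ?thesis
      by (rule filterlim_mono_eventually) (use npos in \<open>auto elim!: eventually_mono simp: field_simps\<close>)
  qed
  have e: "(\<lambda>N. (f N - s * (f N + g N)) / n N) \<longlonglongrightarrow> 0"
    using tendsto_diff[OF f tendsto_mult_left[OF fg, of s]] by (simp add: add_divide_distrib diff_divide_distrib distrib_left)
  show "filterlim (\<lambda>N. offset x (z N)) (toward s) sequentially"
    unfolding filterlim_iff eventually_toward
  proof (intro allI impI, elim exE)
    fix P M assume P: "\<forall>z\<in>cone s M. P z"
    \<comment> \<open>The deviation is controlled relative to the norm of \<open>z N\<close>, while
      the cone measures it relative to the coordinate sum of the offset. That sum exceeds half the
      norm, hence the factor 2.\<close>
    have M: "1 / (2 * real (Suc M)) > 0" by simp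
    have "eventually (\<lambda>N. \<bar>(f N - s * (f N + g N)) / n N\<bar> < 1 / (2 * real (Suc M))) sequentially"
      using tendstoD[OF e M] by (simp add: dist_real_def)
    moreover have "eventually (\<lambda>N. f N / n N + g N / n N > 1 / 2) sequentially"
      using order_tendstoD(1)[OF fg, of "1 / 2"] by simp
    moreover have "eventually (\<lambda>N. f N + g N \<ge> real (Suc M)) sequentially"
      using big by (simp add: filterlim_at_top)
    ultimately show "eventually (\<lambda>N. P (offset x (z N))) sequentially"
      using fpos gpos npos
    proof eventually_elim
      case (elim N)
      define i where "i = fst (offset x (z N))"
      define j where "j = snd (offset x (z N))"
      have ij: "real i = f N" "real j = g N" using elim(4,5) by (simp_all add: i_def j_def offset_def f_def g_def)
      have "\<bar>f N - s * (f N + g N)\<bar> < n N * (1 / (2 * real (Suc M)))"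
        using elim(1,6) by (simp add: abs_divide pos_divide_less_eq mult.commute)
      also have "\<dots> = (n N / 2) / real (Suc M)" by simp
      also have "\<dots> \<le> (f N + g N) / real (Suc M)"
        using elim(2,6) by (intro divide_right_mono) (auto simp: add_divide_distrib[symmetric] field_simps)
      finally have "\<bar>real i - s * real (i + j)\<bar> \<le> real (i + j) / real (Suc M)" by (simp add: ij)
      moreover have "Suc M \<le> i + j" using elim(3) unfolding ij[symmetric] of_nat_add[symmetric] of_nat_le_iff .
      ultimately have "offset x (z N) \<in> cone s M" by (simp add: cone_def i_def j_def split_beta)
      then show ?case using P by blast
    qed
  qed
  show "eventually (\<lambda>N. z N = x + (int (fst (offset x (z N))), int (snd (offset x (z N))))) sequentially"
    using fpos gpos by eventually_elim (auto simp: offset_def f_def g_def prod_eq_iff)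
qed

lemma directed_hit_prob:
  assumes \<omega>: "\<And>y. 0 < \<omega> y \<and> \<omega> y < 1" and s: "0 < s" "s < 1" and z: "directed s z"
  shows "eventually (\<lambda>N. hit_prob \<omega> (z N) x > 0
    \<and> hit_prob \<omega> (z N) (x + e\<^sub>1) = hit_prob \<omega> (z N) x * hratio (quadrant_env \<omega> x) (offset x (z N))
    \<and> hit_prob \<omega> (z N) (x + e\<^sub>2) = hit_prob \<omega> (z N) x * vratio (quadrant_env \<omega> x) (offset x (z N))
    \<and> hit_prob \<omega> (z N) x = \<omega> x * hit_prob \<omega> (z N) (x + e\<^sub>1) + (1 - \<omega> x) * hit_prob \<omega> (z N) (x + e\<^sub>2)) sequentially"
proof -
  have \<omega>': "0 \<le> \<omega> y \<and> \<omega> y \<le> 1" for y using \<omega>[of y] by simp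
  have q: "0 < quadrant_env \<omega> x u \<and> quadrant_env \<omega> x u < 1" for u using \<omega> by (simp add: quadrant_env_def split_beta)
  have ge: "eventually (\<lambda>N. case offset x (z N) of (i, j) \<Rightarrow> 1 \<le> i \<and> 1 \<le> j) sequentially"
    using directed_offset(1)[OF s z, of x] eventually_toward_ge[OF s, of 1] unfolding filterlim_iff by blast
  show ?thesis
    using directed_offset(2)[OF s z, of x] ge
  proof eventually_elim
    case (elim N)
    obtain i j where o: "offset x (z N) = (Suc i, Suc j)"
      using elim(2) by (cases "offset x (z N)") (auto simp: Suc_le_eq gr0_conv_Suc)
    have z0: "z N = x + (int (Suc i), int (Suc j))" using elim(1) by (simp only: o fst_conv snd_conv)
    have z1: "z N = (x + e\<^sub>1) + (int i, int (Suc j))" and z2: "z N = (x + e\<^sub>2) + (int (Suc i), int j)"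
      unfolding z0 by (simp_all add: prod_eq_iff)
    have h0: "hit_prob \<omega> (z N) x = hit (quadrant_env \<omega> x) (Suc i) (Suc j) 0 0"
      unfolding z0 by (rule hit_prob_eq_hit[OF \<omega>'])
    have h1: "hit_prob \<omega> (z N) (x + e\<^sub>1) = hit (quadrant_env \<omega> x) i (Suc j) 1 0"
      unfolding z1 hit_prob_eq_hit[OF \<omega>'] using quadrant_env_shift[of \<omega> x 1 0 i "Suc j"] by simp
    have h2: "hit_prob \<omega> (z N) (x + e\<^sub>2) = hit (quadrant_env \<omega> x) (Suc i) j 0 1"
      unfolding z2 hit_prob_eq_hit[OF \<omega>'] using quadrant_env_shift[of \<omega> x 0 1 "Suc i" j] by simp
    have "0 < hit (quadrant_env \<omega> x) (Suc i) (Suc j) 0 0" by (rule hit_pos[OF q])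
    then show ?case
      unfolding h0 h1 h2 o hratio_def vratio_def
      using quadrant_env_0[of \<omega> x] by simp
  qed
qed

text \<open>One property of the environment that serves all pairs of sites and all sequences. The
  flag \<open>lln\<close> records that the direction is that of the law of large numbers.\<close>

definition regular :: "real \<Rightarrow> bool \<Rightarrow> env \<Rightarrow> bool" where
  "regular s lln \<omega> \<longleftrightarrow> (\<forall>y. 0 < \<omega> y \<and> \<omega> y < 1) \<and>
     (\<forall>x. \<exists>c d. ratios_tendsto s (quadrant_env \<omega> x) c d \<and> (lln \<longrightarrow> c = 1 \<and> d = 1))"

lemma AE_regular:
  assumes ab: "\<alpha> > 0" "\<beta> > 0" and s: "0 < s" "s < 1"
  shows "AE \<omega> in beta_env \<alpha> \<beta>. regular s (s * \<beta> = (1 - s) * \<alpha>) \<omega>"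
proof -
  have q: "AE \<omega> in beta_env \<alpha> \<beta>. P (quadrant_env \<omega> x)" if "AE w in beta_envN \<alpha> \<beta>. P w" for P x
    using that unfolding distr_quadrant_env(1)[OF ab, of x, symmetric]
    by (rule AE_distrD[OF distr_quadrant_env(2)[OF ab]])
  have "AE w in beta_envN \<alpha> \<beta>. \<forall>x. 0 < w x \<and> w x < 1"
    using stationary.AE_envM[of \<alpha> \<beta> 1] ab unfolding stationary_envM_eq[OF ab] stationary_def by simp
  then have "AE \<omega> in beta_env \<alpha> \<beta>. 0 < \<omega> y \<and> \<omega> y < 1" for y
    by (rule eventually_mono[OF q[of _ y]]) (metis quadrant_env_0)
  then have "AE \<omega> in beta_env \<alpha> \<beta>. \<forall>y. 0 < \<omega> y \<and> \<omega> y < 1"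
    by (subst AE_all_countable) blast
  moreover have "AE \<omega> in beta_env \<alpha> \<beta>. \<forall>x. \<exists>c d. ratios_tendsto s (quadrant_env \<omega> x) c d
      \<and> (s * \<beta> = (1 - s) * \<alpha> \<longrightarrow> c = 1 \<and> d = 1)"
    by (subst AE_all_countable, rule allI, rule q, rule AE_ratios_tendsto[OF ab s])
  ultimately show ?thesis unfolding regular_def by (rule AE_conjI)
qed

text \<open>The value \<open>L\<close> is common to all sequences in the direction, so such limits
  can be added along lattice paths in a fixed environment.\<close>

definition busemann_limit :: "real \<Rightarrow> env \<Rightarrow> site \<Rightarrow> site \<Rightarrow> real \<Rightarrow> bool" where
  "busemann_limit s \<omega> x y L \<longleftrightarrow> (\<forall>z. directed s z \<longrightarrow>
     (\<lambda>N. ln (hit_prob \<omega> (z N) x) - ln (hit_prob \<omega> (z N) y)) \<longlonglongrightarrow> L)"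

lemma busemann_limit_refl: "busemann_limit s \<omega> x x 0"
  by (simp add: busemann_limit_def)

lemma busemann_limit_trans:
  assumes "busemann_limit s \<omega> x y L" "busemann_limit s \<omega> y w L'"
  shows "busemann_limit s \<omega> x w (L + L')"
  unfolding busemann_limit_def
proof (intro allI impI)
  fix z assume "directed s z"
  with assms have "(\<lambda>N. (ln (hit_prob \<omega> (z N) x) - ln (hit_prob \<omega> (z N) y))
      + (ln (hit_prob \<omega> (z N) y) - ln (hit_prob \<omega> (z N) w))) \<longlonglongrightarrow> L + L'"
    unfolding busemann_limit_def by (intro tendsto_add) blast+
  then show "(\<lambda>N. ln (hit_prob \<omega> (z N) x) - ln (hit_prob \<omega> (z N) w)) \<longlonglongrightarrow> L + L'" by simp
qed

lemma busemann_limit_sym: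
  assumes "busemann_limit s \<omega> x y L"
  shows "busemann_limit s \<omega> y x (- L)"
  unfolding busemann_limit_def
proof (intro allI impI)
  fix z assume "directed s z"
  with assms have "(\<lambda>N. - (ln (hit_prob \<omega> (z N) x) - ln (hit_prob \<omega> (z N) y))) \<longlonglongrightarrow> - L"
    unfolding busemann_limit_def by (intro tendsto_minus) blast
  then show "(\<lambda>N. ln (hit_prob \<omega> (z N) y) - ln (hit_prob \<omega> (z N) x)) \<longlonglongrightarrow> - L" by simp
qed

text \<open>Along an edge the difference of logarithms is minus the logarithm of
  \<open>hratio\<close> or \<open>vratio\<close> in the quadrant of \<open>x\<close>; positivity of
  the limit makes the logarithm continuous there.\<close>

lemma busemann_limit_edge:
  assumes reg: "regular s lln \<omega>" and s: "0 < s" "s < 1"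
  shows "\<exists>L. busemann_limit s \<omega> x (x + unit_step b) L \<and> (lln \<longrightarrow> L = 0)"
proof -
  have \<omega>: "0 < \<omega> y \<and> \<omega> y < 1" for y using reg unfolding regular_def by blast
  obtain c d where cd: "ratios_tendsto s (quadrant_env \<omega> x) c d" "lln \<longrightarrow> c = 1 \<and> d = 1"
    using reg unfolding regular_def by blast
  define R where "R = (if b then hratio (quadrant_env \<omega> x) else vratio (quadrant_env \<omega> x))"
  define k where "k = (if b then c else d)"
  have k: "0 < k" "(R \<longlongrightarrow> k) (toward s)" using cd by (auto simp: ratios_tendsto_def R_def k_def)
  have "busemann_limit s \<omega> x (x + unit_step b) (- ln k)"
    unfolding busemann_limit_def
  proof (intro allI impI)
    fix z assume z: "directed s z"
    have R: "(\<lambda>N. R (offset x (z N))) \<longlonglongrightarrow> k"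
      by (rule filterlim_compose[OF k(2) directed_offset(1)[OF s z]])
    then have "(\<lambda>N. - ln (R (offset x (z N)))) \<longlonglongrightarrow> - ln k"
      using k(1) by (intro tendsto_intros) auto
    moreover have "eventually (\<lambda>N. - ln (R (offset x (z N))) = ln (hit_prob \<omega> (z N) x) - ln (hit_prob \<omega> (z N) (x + unit_step b))) sequentially"
      using directed_hit_prob[of \<omega> s z x, OF \<omega> s z] order_tendstoD(1)[OF R k(1)]
    proof eventually_elim
      case (elim N)
      then have h1: "hit_prob \<omega> (z N) (x + e\<^sub>1) = hit_prob \<omega> (z N) x * hratio (quadrant_env \<omega> x) (offset x (z N))"
        and h2: "hit_prob \<omega> (z N) (x + e\<^sub>2) = hit_prob \<omega> (z N) x * vratio (quadrant_env \<omega> x) (offset x (z N))"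
        by blast+
      have h: "hit_prob \<omega> (z N) (x + unit_step b) = hit_prob \<omega> (z N) x * R (offset x (z N))"
        by (cases b; simp only: R_def if_True if_False h1 h2)
      have "ln (hit_prob \<omega> (z N) x * R (offset x (z N))) = ln (hit_prob \<omega> (z N) x) + ln (R (offset x (z N)))"
        using elim by (intro ln_mult_pos) blast+
      then show ?case unfolding h by linarith
    qed
    ultimately show "(\<lambda>N. ln (hit_prob \<omega> (z N) x) - ln (hit_prob \<omega> (z N) (x + unit_step b))) \<longlonglongrightarrow> - ln k"
      by (rule Lim_transform_eventually)
  qed
  then show ?thesis using cd(2) by (intro exI[of _ "- ln k"]) (auto simp: k_def)
qed

text \<open>Having a limit is an equivalence relation on sites by the cocycle rules, and it contains
  all edges. The lattice is connected, and zero limits on edges add up to zero.\<close>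

lemma busemann_limit_exists:
  assumes reg: "regular s lln \<omega>" and s: "0 < s" "s < 1"
  shows "\<exists>L. busemann_limit s \<omega> x y L \<and> (lln \<longrightarrow> L = 0)"
proof -
  define C where "C x y \<longleftrightarrow> (\<exists>L. busemann_limit s \<omega> x y L \<and> (lln \<longrightarrow> L = 0))" for x y
  have refl: "C x x" for x unfolding C_def using busemann_limit_refl by blast
  have trans: "C x w" if "C x y" "C y w" for x y w
    using that unfolding C_def by (metis busemann_limit_trans add.right_neutral)
  have sym: "C y x" if "C x y" for x y
    using that unfolding C_def by (metis busemann_limit_sym neg_0_equal_iff_equal)
  have edge1: "C (i, j) (i + 1, j)" for i j
    using busemann_limit_edge[OF reg s, of "(i, j)" True] by (simp add: C_def)
  have edge2: "C (i, j) (i, j + 1)" for i j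
    using busemann_limit_edge[OF reg s, of "(i, j)" False] by (simp add: C_def)
  have row: "C (0, j) (i, j)" for i j
  proof (induction i rule: int_induct[of _ 0])
    case (step1 i)
    then show ?case using trans edge1 by blast
  next
    case (step2 i)
    then show ?case using trans sym[OF edge1[of "i - 1" j]] by simp
  qed (rule refl)
  have col: "C (0, 0) (0, j)" for j
  proof (induction j rule: int_induct[of _ 0])
    case (step1 i)
    then show ?case using trans edge2 by blast
  next
    case (step2 i)
    then show ?case using trans sym[OF edge2[of 0 "i - 1"]] by simp
  qed (rule refl)
  have "C (0, 0) x" for x using trans[OF col[of "snd x"] row[of "snd x" "fst x"]] by simp
  then have "C x y" using trans sym by blast
  then show ?thesis unfolding C_def .
qed

lemma measurable_walk_prob:
  assumes "\<And>y. (\<lambda>\<omega>. \<omega> y) \<in> borel_measurable M"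
  shows "(\<lambda>\<omega>. walk_prob \<omega> n x z) \<in> borel_measurable M"
proof (induction n arbitrary: x)
  case (Suc n)
  have [measurable]: "(\<lambda>\<omega>. \<omega> x) \<in> borel_measurable M" "(\<lambda>\<omega>. walk_prob \<omega> n x' z) \<in> borel_measurable M" for x'
    by (fact assms Suc)+
  show ?case by simp
qed simp

text \<open>On the environment space the path measure of the event is a polynomial in finitely many
  weights, which replaces a study of how \<open>quenched\<close> depends on the environment.\<close>

lemma measurable_hit_prob: "(\<lambda>\<omega>. hit_prob \<omega> z x) \<in> borel_measurable (beta_env \<alpha> \<beta>)"
proof -
  have c: "(\<lambda>\<omega>. \<omega> y) \<in> borel_measurable (beta_env \<alpha> \<beta>)" for y
  proof -
    have "(\<lambda>\<omega>. \<omega> y) \<in> beta_env \<alpha> \<beta> \<rightarrow>\<^sub>M beta_law \<alpha> \<beta>"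
      unfolding beta_env_def by (rule measurable_component_singleton) simp
    from measurable_compose[OF this measurable_beta_law_borel] show ?thesis by simp
  qed
  have "hit_prob \<omega> z x = walk_prob \<omega> (l1norm (z - x)) x z" if "\<omega> \<in> space (beta_env \<alpha> \<beta>)" for \<omega>
    using that unfolding space_beta_env by (intro quenched_walk_prob) blast
  then show ?thesis
    by (subst measurable_cong[of _ _ "\<lambda>\<omega>. walk_prob \<omega> (l1norm (z - x)) x z"]) (auto intro: measurable_walk_prob c)
qed

text \<open>A fixed deterministic sequence for each direction, so that the process can be defined as
  a limit of measurable functions; all other sequences give the same value on regular
  environments.\<close>

definition ray :: "real \<Rightarrow> nat \<Rightarrow> site" where
  "ray s N = (\<lfloor>s * real N\<rfloor>, \<lfloor>(1 - s) * real N\<rfloor>)"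

lemma directed_ray:
  assumes "0 < s" "s < 1"
  shows "directed s (ray s)"
proof -
  have n: "real (l1norm (ray s N)) = real_of_int \<lfloor>s * real N\<rfloor> + real_of_int \<lfloor>(1 - s) * real N\<rfloor>" for N
    using assms by (simp add: l1norm_def ray_def)
  have top: "filterlim (\<lambda>N. real_of_int \<lfloor>s * real N\<rfloor> + real_of_int \<lfloor>(1 - s) * real N\<rfloor>) at_top sequentially"
    using assms by real_asymp
  have a: "(\<lambda>N. real_of_int \<lfloor>s * real N\<rfloor> / (real_of_int \<lfloor>s * real N\<rfloor> + real_of_int \<lfloor>(1 - s) * real N\<rfloor>)) \<longlonglongrightarrow> s"
    using assms by real_asymp
  have b: "(\<lambda>N. real_of_int \<lfloor>(1 - s) * real N\<rfloor> / (real_of_int \<lfloor>s * real N\<rfloor> + real_of_int \<lfloor>(1 - s) * real N\<rfloor>)) \<longlonglongrightarrow> 1 - s"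
    using assms by real_asymp
  have "filterlim (\<lambda>N. real (l1norm (ray s N))) at_top sequentially" using top by (simp add: n)
  then have "filterlim (\<lambda>N. l1norm (ray s N)) at_top sequentially"
    by (simp add: filterlim_sequentially_iff_filterlim_real)
  moreover have "(\<lambda>N. site_vec (ray s N) /\<^sub>R real (l1norm (ray s N))) \<longlonglongrightarrow> (s, 1 - s)"
  proof -
    have "site_vec (ray s N) /\<^sub>R real (l1norm (ray s N))
        = (real_of_int \<lfloor>s * real N\<rfloor> / (real_of_int \<lfloor>s * real N\<rfloor> + real_of_int \<lfloor>(1 - s) * real N\<rfloor>),
           real_of_int \<lfloor>(1 - s) * real N\<rfloor> / (real_of_int \<lfloor>s * real N\<rfloor> + real_of_int \<lfloor>(1 - s) * real N\<rfloor>))" for N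
      unfolding n site_vec_def by (simp add: ray_def scaleR_Pair divide_inverse mult.commute)
    then show ?thesis using tendsto_Pair[OF a b] by (simp only:)
  qed
  ultimately show ?thesis by (simp add: directed_def)
qed

text \<open>In the law of large numbers direction the value 0 is set by definition, since it is
  claimed for every environment and not just almost surely. Elsewhere \<open>lim\<close> supplies a
  value also where there is no convergence.\<close>

definition busemann :: "real \<Rightarrow> real \<Rightarrow> real \<times> real \<Rightarrow> site \<Rightarrow> site \<Rightarrow> env \<Rightarrow> real" where
  "busemann \<alpha> \<beta> \<xi> x y \<omega> = (if \<xi> = (\<alpha> / (\<alpha> + \<beta>), \<beta> / (\<alpha> + \<beta>)) then 0
     else lim (\<lambda>N. ln (hit_prob \<omega> (ray (fst \<xi>) N) x) - ln (hit_prob \<omega> (ray (fst \<xi>) N) y)))"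

lemma riU_eq: "riU = {(s, 1 - s) | s. 0 < s \<and> s < 1}"
  by (auto simp: riU_def site_vec_def)

lemma lln_direction_iff:
  fixes \<alpha> \<beta> s :: real
  assumes "\<alpha> > 0" "\<beta> > 0"
  shows "(s, 1 - s) = (\<alpha> / (\<alpha> + \<beta>), \<beta> / (\<alpha> + \<beta>)) \<longleftrightarrow> s * \<beta> = (1 - s) * \<alpha>"
proof -
  have "1 - \<alpha> / (\<alpha> + \<beta>) = \<beta> / (\<alpha> + \<beta>)" using assms by (simp add: field_simps)
  then have "(s, 1 - s) = (\<alpha> / (\<alpha> + \<beta>), \<beta> / (\<alpha> + \<beta>)) \<longleftrightarrow> s = \<alpha> / (\<alpha> + \<beta>)" by auto
  also have "\<dots> \<longleftrightarrow> s * \<beta> = (1 - s) * \<alpha>" using assms by (simp add: field_simps)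
  finally show ?thesis .
qed

lemma measurable_busemann: "busemann \<alpha> \<beta> \<xi> x y \<in> borel_measurable (beta_env \<alpha> \<beta>)"
proof (cases "\<xi> = (\<alpha> / (\<alpha> + \<beta>), \<beta> / (\<alpha> + \<beta>))")
  case True
  then show ?thesis by (simp add: busemann_def[abs_def])
next
  case False
  have [measurable]: "(\<lambda>\<omega>. hit_prob \<omega> z u) \<in> borel_measurable (beta_env \<alpha> \<beta>)" for z u
    by (rule measurable_hit_prob)
  show ?thesis
    unfolding busemann_def[abs_def] if_not_P[OF False] by measurable
qed

lemma busemann_limit_busemann:
  assumes ab: "\<alpha> > 0" "\<beta> > 0" and s: "0 < s" "s < 1"
    and reg: "regular s (s * \<beta> = (1 - s) * \<alpha>) \<omega>"
  shows "busemann_limit s \<omega> x y (busemann \<alpha> \<beta> (s, 1 - s) x y \<omega>)"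
proof -
  obtain L where L: "busemann_limit s \<omega> x y L" "s * \<beta> = (1 - s) * \<alpha> \<longrightarrow> L = 0"
    using busemann_limit_exists[OF reg s] by blast
  have "busemann \<alpha> \<beta> (s, 1 - s) x y \<omega> = L"
  proof (cases "s * \<beta> = (1 - s) * \<alpha>")
    case True
    then show ?thesis using L(2) lln_direction_iff[OF ab, of s] unfolding busemann_def by simp
  next
    case False
    have "(\<lambda>N. ln (hit_prob \<omega> (ray s N) x) - ln (hit_prob \<omega> (ray s N) y)) \<longlonglongrightarrow> L"
      using L(1) directed_ray[OF s] unfolding busemann_limit_def by blast
    moreover have "(s, 1 - s) \<noteq> (\<alpha> / (\<alpha> + \<beta>), \<beta> / (\<alpha> + \<beta>))"
      using False lln_direction_iff[OF ab, of s] by blast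
    ultimately show ?thesis unfolding busemann_def by (simp only: if_False fst_conv limI)
  qed
  then show ?thesis using L(1) by simp
qed

text \<open>The first step equation for the hitting probabilities, divided by the one from the
  origin; each quotient converges to the exponential in question.\<close>

lemma busemann_harmonic:
  assumes \<omega>: "\<And>y. 0 < \<omega> y \<and> \<omega> y < 1" and s: "0 < s" "s < 1"
    and B: "\<And>x. busemann_limit s \<omega> 0 x (B x)"
  shows "\<omega> x * exp (- B (x + e\<^sub>1)) + (1 - \<omega> x) * exp (- B (x + e\<^sub>2)) = exp (- B x)"
proof -
  let ?h = "\<lambda>x N. hit_prob \<omega> (ray s N) x"
  note d = directed_ray[OF s]
  have pos: "eventually (\<lambda>N. ?h x N > 0) sequentially" for x
    using directed_hit_prob[of \<omega> s "ray s" x, OF \<omega> s d] by eventually_elim blast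
  have lim: "(\<lambda>N. ?h x N / ?h 0 N) \<longlonglongrightarrow> exp (- B x)" for x
  proof (rule Lim_transform_eventually)
    show "(\<lambda>N. exp (- (ln (?h 0 N) - ln (?h x N)))) \<longlonglongrightarrow> exp (- B x)"
      using B[of x] d unfolding busemann_limit_def by (intro tendsto_intros) blast
    show "eventually (\<lambda>N. exp (- (ln (?h 0 N) - ln (?h x N))) = ?h x N / ?h 0 N) sequentially"
      using pos[of x] pos[of 0] by eventually_elim (simp add: exp_diff)
  qed
  have "(\<lambda>N. \<omega> x * (?h (x + e\<^sub>1) N / ?h 0 N) + (1 - \<omega> x) * (?h (x + e\<^sub>2) N / ?h 0 N))
      \<longlonglongrightarrow> \<omega> x * exp (- B (x + e\<^sub>1)) + (1 - \<omega> x) * exp (- B (x + e\<^sub>2))"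
    by (intro tendsto_intros lim)
  moreover have "eventually (\<lambda>N. \<omega> x * (?h (x + e\<^sub>1) N / ?h 0 N) + (1 - \<omega> x) * (?h (x + e\<^sub>2) N / ?h 0 N) = ?h x N / ?h 0 N) sequentially"
    using directed_hit_prob[of \<omega> s "ray s" x, OF \<omega> s d]
  proof eventually_elim
    case (elim N)
    then have h: "?h x N = \<omega> x * ?h (x + e\<^sub>1) N + (1 - \<omega> x) * ?h (x + e\<^sub>2) N" by blast
    show ?case unfolding h by (simp only: times_divide_eq_right add_divide_distrib)
  qed
  ultimately have "(\<lambda>N. ?h x N / ?h 0 N) \<longlonglongrightarrow> \<omega> x * exp (- B (x + e\<^sub>1)) + (1 - \<omega> x) * exp (- B (x + e\<^sub>2))"
    by (rule Lim_transform_eventually)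
  then show ?thesis using lim[of x] by (rule LIMSEQ_unique)
qed

theorem theorem2p1:
  fixes \<alpha> \<beta> :: real
  assumes "\<alpha> > 0" and "\<beta> > 0"
  shows "\<exists>B :: real \<times> real \<Rightarrow> site \<Rightarrow> site \<Rightarrow> env \<Rightarrow> real.
    (\<forall>\<xi>\<in>riU. \<forall>x y. B \<xi> x y \<in> borel_measurable (beta_env \<alpha> \<beta>)) \<and>
    (\<forall>\<xi>\<in>riU. \<forall>x. AE \<omega> in beta_env \<alpha> \<beta>.
       weight \<omega> x (x + e\<^sub>1) * exp (- B \<xi> 0 (x + e\<^sub>1) \<omega>)
         + weight \<omega> x (x + e\<^sub>2) * exp (- B \<xi> 0 (x + e\<^sub>2) \<omega>)
       = exp (- B \<xi> 0 x \<omega>)) \<and>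
    (\<forall>\<xi>\<in>riU. \<exists>\<Omega>\<^sub>\<xi> \<in> sets (beta_env \<alpha> \<beta>). measure (beta_env \<alpha> \<beta>) \<Omega>\<^sub>\<xi> = 1 \<and>
       (\<forall>\<omega>\<in>\<Omega>\<^sub>\<xi>. \<forall>x y. \<forall>z :: nat \<Rightarrow> site.
          filterlim (\<lambda>N. l1norm (z N)) at_top sequentially \<longrightarrow>
          (\<lambda>N. site_vec (z N) /\<^sub>R real (l1norm (z N))) \<longlonglongrightarrow> \<xi> \<longrightarrow>
          (\<lambda>N. ln (measure (quenched \<omega> x)
                     {X \<in> space (quenched \<omega> x). X (l1norm (z N - x)) = z N})
              - ln (measure (quenched \<omega> y)
                     {X \<in> space (quenched \<omega> y). X (l1norm (z N - y)) = z N}))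
            \<longlonglongrightarrow> B \<xi> x y \<omega>)) \<and>
    (\<forall>x y. \<forall>\<omega> \<in> space (beta_env \<alpha> \<beta>).
       B (\<alpha> / (\<alpha> + \<beta>), \<beta> / (\<alpha> + \<beta>)) x y \<omega> = 0)"
proof (intro exI[of _ "busemann \<alpha> \<beta>"] conjI ballI allI)
  interpret prob_space "beta_env \<alpha> \<beta>" by (rule prob_space_beta_env[OF assms])
  show "busemann \<alpha> \<beta> \<xi> x y \<in> borel_measurable (beta_env \<alpha> \<beta>)" for \<xi> x y
    by (rule measurable_busemann)
  show "busemann \<alpha> \<beta> (\<alpha> / (\<alpha> + \<beta>), \<beta> / (\<alpha> + \<beta>)) x y \<omega> = 0" for x y \<omega>
    by (simp add: busemann_def)
  fix \<xi> :: "real \<times> real" assume "\<xi> \<in> riU"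
  then obtain s where s: "0 < s" "s < 1" and \<xi>: "\<xi> = (s, 1 - s)" unfolding riU_eq by blast
  note reg = AE_regular[OF assms s]
  show "AE \<omega> in beta_env \<alpha> \<beta>. weight \<omega> x (x + e\<^sub>1) * exp (- busemann \<alpha> \<beta> \<xi> 0 (x + e\<^sub>1) \<omega>)
      + weight \<omega> x (x + e\<^sub>2) * exp (- busemann \<alpha> \<beta> \<xi> 0 (x + e\<^sub>2) \<omega>) = exp (- busemann \<alpha> \<beta> \<xi> 0 x \<omega>)" for x
    using reg
  proof eventually_elim
    case (elim \<omega>)
    have "0 < \<omega> y \<and> \<omega> y < 1" for y using elim unfolding regular_def by blast
    from busemann_harmonic[of \<omega> s, OF this s busemann_limit_busemann[OF assms s elim]]
    show ?case by (simp add: weight_def \<xi>)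
  qed
  \<comment> \<open>A measurable event of full probability is chosen inside the regular
    environments.\<close>
  obtain \<Omega> where sub: "\<Omega> \<subseteq> {\<omega> \<in> space (beta_env \<alpha> \<beta>). regular s (s * \<beta> = (1 - s) * \<alpha>) \<omega>}"
    and \<Omega>: "\<Omega> \<in> sets (beta_env \<alpha> \<beta>)" "prob \<Omega> = 1"
    by (rule AE_E_prob[OF reg])
  have \<Omega>': "regular s (s * \<beta> = (1 - s) * \<alpha>) \<omega>" if "\<omega> \<in> \<Omega>" for \<omega> using sub that by blast
  show "\<exists>\<Omega>\<^sub>\<xi> \<in> sets (beta_env \<alpha> \<beta>). measure (beta_env \<alpha> \<beta>) \<Omega>\<^sub>\<xi> = 1 \<and>
       (\<forall>\<omega>\<in>\<Omega>\<^sub>\<xi>. \<forall>x y. \<forall>z :: nat \<Rightarrow> site.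
          filterlim (\<lambda>N. l1norm (z N)) at_top sequentially \<longrightarrow>
          (\<lambda>N. site_vec (z N) /\<^sub>R real (l1norm (z N))) \<longlonglongrightarrow> \<xi> \<longrightarrow>
          (\<lambda>N. ln (hit_prob \<omega> (z N) x) - ln (hit_prob \<omega> (z N) y)) \<longlonglongrightarrow> busemann \<alpha> \<beta> \<xi> x y \<omega>)"
    using busemann_limit_busemann[OF assms s \<Omega>'] \<Omega>
    unfolding busemann_limit_def directed_def \<xi> by blast
qed

end
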